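(* Let $f\in L^p(\mathbb{R})$ be a probability density on $\mathbb{R}$ with $\int_{\mathbb{R}}|v|^{4+r}f(v)\,dv<\infty$, for some $r\in(0,2]$ and $p>1$, and with $\int_{\mathbb{R}}v^2f(v)\,dv=1$. Then $$\left|\frac1NH\big([f^{\otimes N}]_N\mid\sigma^N\big)-H(f\mid\gamma)\right|\le C\Big(p,\|f\|_p,\int_{\mathbb{R}}|v|^{4+r}f(v)\,dv\Big)\,N^{-r/4},$$ where $C(\cdot)$ is a constant depending only on the quantities displayed.
   Context: $N\in\mathbb{N}$ is the number of variables. $\gamma(x)=\frac1{\sqrt{2\pi}}e^{-x^2/2}$. Kac's sphere is $S^{N-1}=\{x\in\mathbb{R}^N:\sum_i x_i^2=N\}$, with uniform probability measure $\sigma^N$. Relative entropy: $H(\mu\mid\nu)=\int h\log h\,d\nu$ with $h=d\mu/d\nu$, and $+\infty$ if $\mu\not\ll\nu$. The conditioned tensor product $[f^{\otimes N}]_N$ is the probability measure on $S^{N-1}$ whose density with respect to $\sigma^N$ is $$v\mapsto\frac{f^{\otimes N}(v)}{\int_{S^{N-1}}f^{\otimes N}(y)\,\sigma^N(dy)},\qquad f^{\otimes N}(v)=\prod_{i=1}^Nf(v_i).$$ (Although $S^{N-1}$ is a Lebesgue-null set, the product structure of $f^{\otimes N}$ makes this well defined for $f\in L^1(\mathbb{R})$.)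
   Formalization: The bound is stated for all N at least some threshold depending only on r, p, the L^p norm of f and its (4+r)-th moment, since for small N the conditioned tensor product may not exist; its being a probability measure for such N is part of the conclusion. *)

theory Defs
  imports "HOL-Probability.Probability"
begin

text \<open>
  Since the dimension \<open>N\<close> varies inside the statement, \<open>\<real>\<^sup>N\<close> is the product space indexed by
  \<open>{..<N}\<close>, and measures on Kac's sphere are Borel measures on \<open>\<real>\<^sup>N\<close> that give full mass to it.
\<close>

definition kac_sphere :: "nat \<Rightarrow> (nat \<Rightarrow> real) set" where
  "kac_sphere N = {x \<in> space (\<Pi>\<^sub>M i\<in>{..<N}. borel). (\<Sum>i<N. (x i)\<^sup>2) = real N}"

definition kac_ball :: "nat \<Rightarrow> (nat \<Rightarrow> real) set" where
  "kac_ball N = {x \<in> space (\<Pi>\<^sub>M i\<in>{..<N}. lborel). (\<Sum>i<N. (x i)\<^sup>2) \<le> real N}"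

definition radial_proj :: "nat \<Rightarrow> (nat \<Rightarrow> real) \<Rightarrow> (nat \<Rightarrow> real)" where
  "radial_proj N x = (\<lambda>i\<in>{..<N}. sqrt (real N) * x i / sqrt (\<Sum>j<N. (x j)\<^sup>2))"

text \<open>
  The uniform probability measure on the sphere is the cone measure: the image of the normalised
  Lebesgue measure on the enclosed ball under the radial projection (the value of the projection
  at the origin is irrelevant).
\<close>

definition kac_sigma :: "nat \<Rightarrow> (nat \<Rightarrow> real) measure" where
  "kac_sigma N =
     distr (uniform_measure (\<Pi>\<^sub>M i\<in>{..<N}. lborel) (kac_ball N)) (\<Pi>\<^sub>M i\<in>{..<N}. borel) (radial_proj N)"

definition tensor_power :: "(real \<Rightarrow> real) \<Rightarrow> nat \<Rightarrow> (nat \<Rightarrow> real) \<Rightarrow> real" where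
  "tensor_power f N v = (\<Prod>i<N. f (v i))"

text \<open>
  The quotient is taken in the extended nonnegative reals.  The result is a probability measure
  exactly when the normalising integral is neither \<open>0\<close> nor \<open>\<infinity>\<close>.
\<close>

definition conditioned_tensor :: "(real \<Rightarrow> real) \<Rightarrow> nat \<Rightarrow> (nat \<Rightarrow> real) measure" where
  "conditioned_tensor f N =
     density (kac_sigma N)
       (\<lambda>v. ennreal (tensor_power f N v) / (\<integral>\<^sup>+ y. ennreal (tensor_power f N y) \<partial>kac_sigma N))"

text \<open>
  The library's \<^const>\<open>KL_divergence\<close> is a real-valued Bochner integral, hence \<open>0\<close> when the entropy
  is infinite.  Here the value is extended real.  For a finite measure \<open>\<nu>\<close> the integral
  of the negative part is finite because \<open>h * ln h \<ge> - exp (- 1)\<close>, so the difference is meaningful.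
\<close>

definition rel_entropy :: "'a measure \<Rightarrow> 'a measure \<Rightarrow> ereal" where
  "rel_entropy \<mu> \<nu> =
     (if absolutely_continuous \<nu> \<mu>
      then let h = (\<lambda>x. enn2real (RN_deriv \<nu> \<mu> x))
           in enn2ereal (\<integral>\<^sup>+ x. ennreal (h x * ln (h x)) \<partial>\<nu>)
              - enn2ereal (\<integral>\<^sup>+ x. ennreal (- (h x * ln (h x))) \<partial>\<nu>)
      else \<infinity>)"

definition Lp_norm :: "real \<Rightarrow> (real \<Rightarrow> real) \<Rightarrow> real" where
  "Lp_norm p f = (LINT v|lborel. \<bar>f v\<bar> powr p) powr (1 / p)"

definition abs_moment :: "real \<Rightarrow> (real \<Rightarrow> real) \<Rightarrow> real" where
  "abs_moment q f = (LINT v|lborel. \<bar>v\<bar> powr q * f v)"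

lemma radial_proj_measurable:
  "radial_proj N \<in> (\<Pi>\<^sub>M i\<in>{..<N}. lborel) \<rightarrow>\<^sub>M (\<Pi>\<^sub>M i\<in>{..<N}. borel)"
  unfolding radial_proj_def by measurable

lemma kac_ball_sets: "kac_ball N \<in> sets (\<Pi>\<^sub>M i\<in>{..<N}. lborel)"
  unfolding kac_ball_def by measurable

lemma emeasure_kac_ball:
  shows "emeasure (\<Pi>\<^sub>M i\<in>{..<N}. lborel) (kac_ball N) \<noteq> 0"
    and "emeasure (\<Pi>\<^sub>M i\<in>{..<N}. lborel) (kac_ball N) \<noteq> \<infinity>"
proof -
  interpret product_sigma_finite "\<lambda>_::nat. lborel :: real measure"
    by standard
  let ?M = "\<Pi>\<^sub>M i\<in>{..<N}. (lborel :: real measure)"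
  have box: "emeasure ?M (\<Pi>\<^sub>E i\<in>{..<N}. {-a..a}) = ennreal ((2 * a) ^ N)" if "a \<ge> 0" for a :: real
    by (subst emeasure_PiM) (use that in \<open>auto simp: ennreal_power\<close>)
  have box_sets: "(\<Pi>\<^sub>E i\<in>{..<N}. {-a..a}) \<in> sets ?M" for a :: real
    by (rule sets_PiM_I_finite) auto
  have sub1: "(\<Pi>\<^sub>E i\<in>{..<N}. {-1..1}) \<subseteq> kac_ball N"
  proof
    fix x :: "nat \<Rightarrow> real" assume x: "x \<in> (\<Pi>\<^sub>E i\<in>{..<N}. {-1..1})"
    have "(\<Sum>i<N. (x i)\<^sup>2) \<le> (\<Sum>i<N. 1)"
    proof (rule sum_mono)
      fix i assume "i \<in> {..<N}"
      hence "\<bar>x i\<bar> \<le> 1" using x by (auto simp: PiE_iff abs_le_iff)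
      thus "(x i)\<^sup>2 \<le> 1" by (simp add: abs_square_le_1)
    qed
    with x show "x \<in> kac_ball N"
      by (auto simp: kac_ball_def space_PiM PiE_iff)
  qed
  have sub2: "kac_ball N \<subseteq> (\<Pi>\<^sub>E i\<in>{..<N}. {- sqrt N..sqrt N})"
  proof
    fix x assume x: "x \<in> kac_ball N"
    have "\<bar>x i\<bar> \<le> sqrt N" if "i < N" for i
    proof -
      have "(x i)\<^sup>2 \<le> (\<Sum>i<N. (x i)\<^sup>2)"
        by (rule member_le_sum) (use that in auto)
      also have "\<dots> \<le> real N" using x by (simp add: kac_ball_def)
      finally show ?thesis by (simp add: real_le_rsqrt)
    qed
    hence "\<forall>i<N. - sqrt N \<le> x i \<and> x i \<le> sqrt N"
      by (meson abs_le_iff minus_le_iff)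
    thus "x \<in> (\<Pi>\<^sub>E i\<in>{..<N}. {- sqrt N..sqrt N})" using x
      by (auto simp: kac_ball_def space_PiM PiE_iff)
  qed
  have "0 < emeasure ?M (\<Pi>\<^sub>E i\<in>{..<N}. {-1..1})"
    by (subst box) simp_all
  also have "\<dots> \<le> emeasure ?M (kac_ball N)"
    by (rule emeasure_mono[OF sub1 kac_ball_sets])
  finally show "emeasure ?M (kac_ball N) \<noteq> 0" by simp
  have "emeasure ?M (kac_ball N) \<le> emeasure ?M (\<Pi>\<^sub>E i\<in>{..<N}. {- sqrt N..sqrt N})"
    by (rule emeasure_mono[OF sub2 box_sets])
  also have "\<dots> < \<infinity>"
    by (subst box) simp_all
  finally show "emeasure ?M (kac_ball N) \<noteq> \<infinity>" by simp
qed

lemma prob_space_kac_sigma: "prob_space (kac_sigma N)"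
  unfolding kac_sigma_def
  by (rule prob_space.prob_space_distr
        [OF prob_space_uniform_measure[OF emeasure_kac_ball]])
     (simp add: radial_proj_measurable measurable_cong_sets[OF sets_uniform_measure])

lemma AE_kac_sigma_kac_sphere: "AE x in kac_sigma N. x \<in> kac_sphere N"
proof -
  interpret product_sigma_finite "\<lambda>_::nat. lborel :: real measure"
    by standard
  let ?M = "\<Pi>\<^sub>M i\<in>{..<N}. (lborel :: real measure)"
  let ?Z = "\<Pi>\<^sub>E i\<in>{..<N}. {0::real}"
  have sphere: "radial_proj N x \<in> kac_sphere N" if x: "x \<in> space ?M" and nz: "N = 0 \<or> x \<notin> ?Z" for x
  proof -
    have "(\<Sum>i<N. (radial_proj N x i)\<^sup>2) = real N"
    proof (cases "N = 0")
      case False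
      with nz x obtain i where i: "i < N" "x i \<noteq> 0"
        unfolding space_PiM PiE_iff by auto
      have "(\<Sum>j<N. (x j)\<^sup>2) > 0"
        by (rule sum_pos2[of _ i]) (use i in auto)
      moreover have "(\<Sum>i<N. (radial_proj N x i)\<^sup>2) = (\<Sum>i<N. real N * (x i)\<^sup>2 / (\<Sum>j<N. (x j)\<^sup>2))"
        by (rule sum.cong) (auto simp: radial_proj_def power_divide power_mult_distrib sum_nonneg)
      ultimately show ?thesis
        by (simp flip: sum_divide_distrib sum_distrib_left)
    qed simp
    thus ?thesis by (simp add: kac_sphere_def space_PiM radial_proj_def)
  qed
  have "AE x in ?M. N = 0 \<or> x \<notin> ?Z"
  proof (cases "N = 0")
    case False
    have "emeasure ?M ?Z = (\<Prod>i<N. emeasure lborel {0::real})"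
      by (rule emeasure_PiM) auto
    hence "?Z \<in> null_sets ?M"
      using False by (intro null_setsI sets_PiM_I_finite) (auto simp: power_0_left)
    from AE_not_in[OF this] show ?thesis by simp
  qed simp
  hence "AE x in ?M. radial_proj N x \<in> kac_sphere N"
    using AE_space by eventually_elim (rule sphere)
  hence "AE x in uniform_measure ?M (kac_ball N). radial_proj N x \<in> kac_sphere N"
    by (intro AE_uniform_measureI[OF kac_ball_sets]) auto
  moreover have "kac_sphere N \<in> sets (\<Pi>\<^sub>M i\<in>{..<N}. borel)"
    unfolding kac_sphere_def by measurable
  hence "{x \<in> space (\<Pi>\<^sub>M i\<in>{..<N}. borel). x \<in> kac_sphere N} \<in> sets (\<Pi>\<^sub>M i\<in>{..<N}. borel)"
    by auto
  ultimately show ?thesis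
    unfolding kac_sigma_def
    by (subst AE_distr_iff)
       (simp_all add: radial_proj_measurable measurable_cong_sets[OF sets_uniform_measure])
qed

end

theory Submission imports Defs begin

text \<open>
  Since \<open>\<gamma>\<close> is constant on the sphere, with \<open>h = f / \<gamma>\<close> the normalised entropy equals
  \<open>\<integral> ln h dF - ln Z / N\<close>, where \<open>F\<close> is the first marginal of the conditioned product and \<open>Z\<close> the
  integral of the tensor power of \<open>h\<close>.  If \<open>s k\<close> is the density of \<open>v\<^sub>1\<^sup>2 + \<dots> + v\<^sub>k\<^sup>2\<close> under the
  tensor power of \<open>f\<close>, then \<open>F\<close> has the density \<open>f v * s (N - 1) (N - v\<^sup>2) / s N N\<close>, and \<open>Z\<close> is the quotient of
  \<open>s N N\<close> for \<open>f\<close> and for \<open>\<gamma>\<close>.  So it suffices that \<open>s N N\<close> is at least of order \<open>1 / sqrt N\<close>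
  and that \<open>s (N - 1) (N - v\<^sup>2)\<close> differs from it by at most a multiple of \<open>(1 + v\<^sup>2) / N\<close>; applied to \<open>\<gamma>\<close> itself, the
  same bounds replace Stirling's formula.

  Both bounds follow by Fourier inversion once the characteristic function of \<open>v\<^sup>2\<close> is integrable
  to some power and uniformly bounded away from \<open>1\<close> off the origin.  Each of these is a consequence of a bound
  on the measure of its superlevel sets that depends only on \<open>p\<close> and the norm of \<open>f\<close>.
\<close>

section \<open>Polar coordinates and the recursion for sphere integrals\<close>

text \<open>The constant may depend on \<open>f\<close> through three numbers only, and this shapes
  everything: the Riemann-Lebesgue lemma or mere positivity of the variance would give a spectral
  gap depending on \<open>f\<close> itself, and an \<open>L^p\<close> bound gives no pointwise decay
  of the characteristic function of \<open>v^2\<close>. What is uniform is how large a set of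
  frequencies can carry a large value.

  A second obstacle is that the sphere is a null set, while the law of a sum of squares determines
  its density only up to null sets. Exact values at squared radius \<open>N\<close> come from
  integrating almost-everywhere information about \<open>N - 1\<close> coordinates over one further
  coordinate.

  The rate arises from dividing the error \<open>(1 + v^2) / N\<close> by \<open>s N N\<close>,
  which may be as small as a multiple of \<open>1 / sqrt N\<close>; integrating the quotient against
  \<open>f * |ln h|\<close> uses the fourth moment and the \<open>L^p\<close> bound. The term
  \<open>ln Z / N\<close> is at most of order \<open>ln N / N\<close>. For small \<open>N\<close>
  the normalising integral can be 0 or infinite, so the estimate starts at a threshold.\<close>

abbreviation lborel_PiM :: "nat set \<Rightarrow> (nat \<Rightarrow> real) measure" where
  "lborel_PiM I \<equiv> (\<Pi>\<^sub>M i\<in>I. lborel)"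

interpretation lborel_product: product_sigma_finite "\<lambda>_::nat. lborel :: real measure"
  by standard

lemma sigma_finite_lborel_PiM: "finite I \<Longrightarrow> sigma_finite_measure (lborel_PiM I)"
  by (rule lborel_product.sigma_finite)

section \<open>Product Lebesgue measure: exchange of integrals, scaling, radial projection\<close>

lemma nn_integral_lborel_PiM_swap:
  assumes "finite I" "case_prod f \<in> borel_measurable (borel \<Otimes>\<^sub>M lborel_PiM I)"
  shows "(\<integral>\<^sup>+ y. (\<integral>\<^sup>+ t. f t y \<partial>lborel) \<partial>lborel_PiM I) = (\<integral>\<^sup>+ t. (\<integral>\<^sup>+ y. f t y \<partial>lborel_PiM I) \<partial>lborel)"
proof -
  interpret sigma_finite_measure "lborel_PiM I" by (rule sigma_finite_lborel_PiM) fact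
  interpret pair_sigma_finite lborel "lborel_PiM I" ..
  have "case_prod f \<in> borel_measurable (lborel \<Otimes>\<^sub>M lborel_PiM I)"
    using assms(2) by (simp cong: measurable_cong_sets sets_pair_measure_cong)
  thus ?thesis by (rule Fubini')
qed

text \<open>One affine substitution per coordinate, by induction on \<open>I\<close>. The scaled
  argument is restricted to \<open>I\<close> because points of the product space are extensional
  functions.\<close>

lemma nn_integral_lborel_PiM_scale:
  fixes c :: real
  assumes "finite I" "c > 0" "G \<in> borel_measurable (lborel_PiM I)"
  shows "(\<integral>\<^sup>+ y. G y \<partial>lborel_PiM I) =
    ennreal (c ^ card I) * (\<integral>\<^sup>+ y. G (\<lambda>i\<in>I. c * y i) \<partial>lborel_PiM I)"
  using assms(1,3)
proof (induction I arbitrary: G rule: finite_induct)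
  case empty
  then show ?case
    by (simp add: PiM_empty nn_integral_count_space_finite restrict_def)
next
  case (insert i I)
  note [measurable] = insert.prems
  have [simp]: "finite I" by fact
  interpret sigma_finite_measure "lborel_PiM I" by (rule sigma_finite_lborel_PiM) fact
  have upd: "(\<lambda>j\<in>I. c * x j)(i := c * v) = (\<lambda>j\<in>insert i I. c * (x(i := v)) j)" for x v
    using insert.hyps by (auto simp: fun_eq_iff restrict_def)
  have "(\<integral>\<^sup>+ y. G y \<partial>lborel_PiM (insert i I)) = (\<integral>\<^sup>+ x. (\<integral>\<^sup>+ v. G (x(i := v)) \<partial>lborel) \<partial>lborel_PiM I)"
    by (rule lborel_product.product_nn_integral_insert) (use insert in auto)
  also have "\<dots> = (\<integral>\<^sup>+ x. ennreal c * (\<integral>\<^sup>+ v. G (x(i := c * v)) \<partial>lborel) \<partial>lborel_PiM I)"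
  proof (rule nn_integral_cong)
    fix x assume [measurable]: "x \<in> space (lborel_PiM I)"
    have [measurable]: "(\<lambda>v. x(i := v)) \<in> borel \<rightarrow>\<^sub>M lborel_PiM (insert i I)"
      using measurable_component_update[of x I "\<lambda>_. lborel" i] \<open>i \<notin> I\<close> by simp
    show "(\<integral>\<^sup>+ v. G (x(i := v)) \<partial>lborel) = ennreal c * (\<integral>\<^sup>+ v. G (x(i := c * v)) \<partial>lborel)"
      by (subst nn_integral_real_affine[of _ c 0]) (use \<open>c > 0\<close> in simp_all)
  qed
  also have "\<dots> = ennreal c * (\<integral>\<^sup>+ x. (\<integral>\<^sup>+ v. G (x(i := c * v)) \<partial>lborel) \<partial>lborel_PiM I)"
    by (rule nn_integral_cmult) measurable
  also have "(\<integral>\<^sup>+ x. (\<integral>\<^sup>+ v. G (x(i := c * v)) \<partial>lborel) \<partial>lborel_PiM I) = ennreal (c ^ card I) *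
      (\<integral>\<^sup>+ x. (\<integral>\<^sup>+ v. G ((\<lambda>j\<in>I. c * x j)(i := c * v)) \<partial>lborel) \<partial>lborel_PiM I)"
    by (rule insert.IH) measurable
  also have "(\<integral>\<^sup>+ x. (\<integral>\<^sup>+ v. G ((\<lambda>j\<in>I. c * x j)(i := c * v)) \<partial>lborel) \<partial>lborel_PiM I) =
      (\<integral>\<^sup>+ y. G (\<lambda>j\<in>insert i I. c * y j) \<partial>lborel_PiM (insert i I))"
    unfolding upd
    by (rule lborel_product.product_nn_integral_insert[symmetric]) (use insert in auto)
  finally show ?case
    using insert.hyps \<open>c > 0\<close>
    by (simp add: mult.assoc[symmetric] ennreal_mult del: restrict_apply insert_iff)
qed

definition sq_norm :: "nat set \<Rightarrow> (nat \<Rightarrow> real) \<Rightarrow> real" where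
  "sq_norm I y = (\<Sum>i\<in>I. (y i)\<^sup>2)"

lemma sq_norm_nonneg: "0 \<le> sq_norm I y"
  by (simp add: sq_norm_def sum_nonneg)

lemma sq_norm_measurable [measurable]: "sq_norm I \<in> borel_measurable (lborel_PiM I)"
  unfolding sq_norm_def by measurable

lemma AE_sq_norm_pos:
  assumes "finite I" "I \<noteq> {}"
  shows "AE y in lborel_PiM I. 0 < sq_norm I y"
proof -
  let ?Z = "\<Pi>\<^sub>E i\<in>I. {0::real}"
  have "emeasure (lborel_PiM I) ?Z = (\<Prod>i\<in>I. emeasure lborel {0::real})"
    by (rule lborel_product.emeasure_PiM) (use assms in auto)
  hence "?Z \<in> null_sets (lborel_PiM I)"
    using assms by (intro null_setsI sets_PiM_I_finite) (auto simp: power_0_left)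
  from AE_not_in[OF this] AE_space show ?thesis
  proof eventually_elim
    case (elim y)
    have "\<not> (\<forall>i\<in>I. y i = 0)"
      using elim unfolding space_PiM PiE_iff by auto
    then obtain i where i: "i \<in> I" "y i \<noteq> 0" by blast
    show ?case unfolding sq_norm_def by (rule sum_pos2[of _ i]) (use i assms in auto)
  qed
qed

text \<open>For \<open>I = {..<N}\<close> and \<open>t = N\<close> this is
  \<open>radial_proj N\<close>. The parameter is the squared radius, since that is the quantity that
  adds up over disjoint sets of coordinates.\<close>

definition radial :: "nat set \<Rightarrow> real \<Rightarrow> (nat \<Rightarrow> real) \<Rightarrow> nat \<Rightarrow> real" where
  "radial I t y = (\<lambda>i\<in>I. sqrt t * y i / sqrt (sq_norm I y))"

lemma radial_measurable [measurable (raw)]: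
  assumes [measurable]: "g \<in> borel_measurable M" "f \<in> M \<rightarrow>\<^sub>M lborel_PiM I"
  shows "(\<lambda>x. radial I (g x) (f x)) \<in> M \<rightarrow>\<^sub>M lborel_PiM I"
proof -
  have [measurable]: "(\<lambda>x. f x i) \<in> borel_measurable M" if "i \<in> I" for i
    using measurable_compose[OF assms(2) measurable_component_singleton[OF that]] by simp
  have [measurable]: "(\<lambda>x. sq_norm I (f x)) \<in> borel_measurable M"
    by (rule measurable_compose[OF assms(2) sq_norm_measurable])
  show ?thesis unfolding radial_def by measurable
qed

lemma sq_norm_radial:
  assumes "0 \<le> t" "0 < sq_norm I y"
  shows "sq_norm I (radial I t y) = t"
proof -
  have "sq_norm I (radial I t y) = (\<Sum>i\<in>I. t / sq_norm I y * (y i)\<^sup>2)"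
    unfolding sq_norm_def[of I "radial I t y"]
    by (rule sum.cong) (use assms in \<open>auto simp: radial_def power_divide power_mult_distrib\<close>)
  also have "\<dots> = t / sq_norm I y * sq_norm I y"
    unfolding sq_norm_def by (rule sum_distrib_left[symmetric])
  also have "\<dots> = t" using assms by simp
  finally show ?thesis .
qed

lemma sq_norm_scale: "sq_norm I (\<lambda>i\<in>I. c * y i) = c\<^sup>2 * sq_norm I y"
  by (simp add: sq_norm_def power_mult_distrib sum_distrib_left)

lemma radial_scale: "c > 0 \<Longrightarrow> radial I t (\<lambda>i\<in>I. c * y i) = radial I t y"
  unfolding radial_def sq_norm_scale
  by (auto simp: fun_eq_iff restrict_def real_sqrt_mult)

text \<open>
  The integral over the sphere of squared radius \<open>t\<close>, weighted such that integrating over \<open>t\<close>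
  gives Lebesgue measure.
\<close>

definition sphere_integral :: "nat set \<Rightarrow> real \<Rightarrow> ((nat \<Rightarrow> real) \<Rightarrow> ennreal) \<Rightarrow> ennreal" where
  "sphere_integral I t G = indicator {0<..} t * ennreal (card I / 2 * t powr (card I / 2 - 1)) *
     (\<integral>\<^sup>+ y. indicator {y. sq_norm I y \<le> 1} y * G (radial I t y) \<partial>lborel_PiM I)"

section \<open>The polar decomposition\<close>

text \<open>In \<open>nn_integral_polar\<close> a point of squared norm \<open>q\<close> is reached
  from every \<mu> \<ge> \<open>q\<close>, with this weight; total weight 1 is what makes the
  decomposition exact.\<close>

lemma nn_integral_powr_tail:
  fixes a q :: real
  assumes "a > 0" "q > 0"
  shows "(\<integral>\<^sup>+ \<mu>. indicator {q..} \<mu> * ennreal (a * q powr a * \<mu> powr (- a - 1)) \<partial>lborel) = 1"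
proof -
  have "(\<integral>\<^sup>+ \<mu>. indicator {q..} \<mu> * ennreal (a * q powr a * \<mu> powr (- a - 1)) \<partial>lborel) =
     (\<integral>\<^sup>+ \<mu>. ennreal (a * q powr a * \<mu> powr (- a - 1)) * indicator {q..} \<mu> \<partial>lborel)"
    by (simp add: mult.commute)
  also have "\<dots> = ennreal (0 - (- (q powr a * q powr (-a))))"
  proof (rule nn_integral_FTC_atLeast[where F = "\<lambda>\<mu>. - (q powr a * \<mu> powr (- a))"])
    show "((\<lambda>\<mu>. - (q powr a * \<mu> powr - a)) has_real_derivative a * q powr a * x powr (- a - 1)) (at x)"
      if "q \<le> x" for x
      using that assms by (auto intro!: derivative_eq_intros)
    have "((\<lambda>\<mu>::real. \<mu> powr (- a)) \<longlongrightarrow> 0) at_top"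
      using assms by (intro tendsto_neg_powr filterlim_ident) auto
    from tendsto_minus[OF tendsto_mult_left[OF this, of "q powr a"]]
    show "((\<lambda>\<mu>. - (q powr a * \<mu> powr - a)) \<longlongrightarrow> 0) at_top" by simp
  qed (use assms in auto)
  also have "\<dots> = 1" using assms by (simp flip: powr_add)
  finally show ?thesis .
qed

lemma sphere_integral_measurable [measurable]:
  assumes "finite I" and [measurable]: "G \<in> borel_measurable (lborel_PiM I)"
  shows "(\<lambda>t. sphere_integral I t G) \<in> borel_measurable borel"
proof -
  interpret sigma_finite_measure "lborel_PiM I" by (rule sigma_finite_lborel_PiM) fact
  show ?thesis unfolding sphere_integral_def by measurable
qed

text \<open>The sphere is sampled through the unit ball, without a surface measure. For fixed
  \<open>y\<close> the substitution \<open>t = \<mu> * sq_norm I y\<close> turns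
  \<open>radial I t y\<close> into \<open>sqrt \<mu> * y\<close>; for fixed \<mu> the substitution
  \<open>z = sqrt \<mu> * y\<close> then frees the argument of \<open>G\<close> from \<mu>, and what
  remains is a weight in \<mu> that integrates to 1.\<close>

theorem nn_integral_polar:
  assumes "finite I" "I \<noteq> {}" and [measurable]: "G \<in> borel_measurable (lborel_PiM I)"
  shows "(\<integral>\<^sup>+ y. G y \<partial>lborel_PiM I) = (\<integral>\<^sup>+ t. sphere_integral I t G \<partial>lborel)"
proof -
  interpret sigma_finite_measure "lborel_PiM I" by (rule sigma_finite_lborel_PiM) fact
  define a where "a = real (card I) / 2"
  have a: "a > 0" using assms by (simp add: a_def card_gt_0_iff)
  have ac: "s * (p * j * e * g) = p * (s * e) * (j * g)" for s p j e g :: ennreal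
    by (simp only: mult_ac)
  let ?q = "sq_norm I"
  let ?B = "\<lambda>y. indicator {y. ?q y \<le> 1} y :: ennreal"
  let ?P = "\<lambda>t::real. indicator {0<..} t :: ennreal"
  have "(\<integral>\<^sup>+ t. sphere_integral I t G \<partial>lborel) =
    (\<integral>\<^sup>+ t. (\<integral>\<^sup>+ y. ?P t * ennreal (a * t powr (a - 1)) * (?B y * G (radial I t y)) \<partial>lborel_PiM I) \<partial>lborel)"
    unfolding sphere_integral_def a_def
    by (rule nn_integral_cong) (subst nn_integral_cmult, measurable)
  also have "\<dots> = (\<integral>\<^sup>+ y. (\<integral>\<^sup>+ t. ?P t * ennreal (a * t powr (a - 1)) * (?B y * G (radial I t y)) \<partial>lborel) \<partial>lborel_PiM I)"
    by (rule nn_integral_lborel_PiM_swap[symmetric]) (fact, measurable)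
  also have "\<dots> = (\<integral>\<^sup>+ y. (\<integral>\<^sup>+ \<mu>. ?P \<mu> * ennreal (a * ?q y powr a * \<mu> powr (a - 1)) * (?B y * G (\<lambda>i\<in>I. sqrt \<mu> * y i)) \<partial>lborel) \<partial>lborel_PiM I)"
  proof (rule nn_integral_cong_AE, use AE_sq_norm_pos[OF assms(1,2)] AE_space in eventually_elim)
    case (elim y)
    hence [measurable]: "y \<in> space (lborel_PiM I)" by simp
    have rad: "radial I (0 + ?q y * \<mu>) y = (\<lambda>i\<in>I. sqrt \<mu> * y i)" for \<mu>
      using elim by (auto simp: radial_def fun_eq_iff restrict_def real_sqrt_mult)
    have "(\<integral>\<^sup>+ t. ?P t * ennreal (a * t powr (a - 1)) * (?B y * G (radial I t y)) \<partial>lborel) =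
      ennreal \<bar>?q y\<bar> * (\<integral>\<^sup>+ \<mu>. ?P (0 + ?q y * \<mu>) * ennreal (a * (0 + ?q y * \<mu>) powr (a - 1)) * (?B y * G (radial I (0 + ?q y * \<mu>) y)) \<partial>lborel)"
      by (rule nn_integral_real_affine) (use elim in \<open>measurable, auto\<close>)
    also have "\<dots> = (\<integral>\<^sup>+ \<mu>. ennreal \<bar>?q y\<bar> * (?P (0 + ?q y * \<mu>) * ennreal (a * (0 + ?q y * \<mu>) powr (a - 1)) * (?B y * G (radial I (0 + ?q y * \<mu>) y))) \<partial>lborel)"
      by (rule nn_integral_cmult[symmetric]) measurable
    also have "\<dots> = (\<integral>\<^sup>+ \<mu>. ?P \<mu> * ennreal (a * ?q y powr a * \<mu> powr (a - 1)) * (?B y * G (\<lambda>i\<in>I. sqrt \<mu> * y i)) \<partial>lborel)"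
    proof (rule nn_integral_cong)
      fix \<mu> :: real
      show "ennreal \<bar>?q y\<bar> * (?P (0 + ?q y * \<mu>) * ennreal (a * (0 + ?q y * \<mu>) powr (a - 1)) * (?B y * G (radial I (0 + ?q y * \<mu>) y)))
        = ?P \<mu> * ennreal (a * ?q y powr a * \<mu> powr (a - 1)) * (?B y * G (\<lambda>i\<in>I. sqrt \<mu> * y i))"
      proof (cases "\<mu> > 0")
        case True
        have "ennreal \<bar>?q y\<bar> * ennreal (a * (0 + ?q y * \<mu>) powr (a - 1)) = ennreal (a * ?q y powr a * \<mu> powr (a - 1))"
          using elim True a
          by (subst ennreal_mult[symmetric]) (auto simp: powr_mult powr_diff field_simps)
        with True elim show ?thesis unfolding rad by (simp add: mult.assoc[symmetric])
      qed (use elim in \<open>simp add: zero_less_mult_iff\<close>)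
    qed
    finally show ?case .
  qed
  also have "\<dots> = (\<integral>\<^sup>+ \<mu>. (\<integral>\<^sup>+ y. ?P \<mu> * ennreal (a * ?q y powr a * \<mu> powr (a - 1)) * (?B y * G (\<lambda>i\<in>I. sqrt \<mu> * y i)) \<partial>lborel_PiM I) \<partial>lborel)"
    by (rule nn_integral_lborel_PiM_swap) (fact, measurable)
  also have "\<dots> = (\<integral>\<^sup>+ \<mu>. (\<integral>\<^sup>+ z. ?P \<mu> * indicator {z. ?q z \<le> \<mu>} z * ennreal (a * ?q z powr a * \<mu> powr (- a - 1)) * G z \<partial>lborel_PiM I) \<partial>lborel)"
  proof (rule nn_integral_cong)
    fix \<mu> :: real
    show "(\<integral>\<^sup>+ y. ?P \<mu> * ennreal (a * ?q y powr a * \<mu> powr (a - 1)) * (?B y * G (\<lambda>i\<in>I. sqrt \<mu> * y i)) \<partial>lborel_PiM I) =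
      (\<integral>\<^sup>+ z. ?P \<mu> * indicator {z. ?q z \<le> \<mu>} z * ennreal (a * ?q z powr a * \<mu> powr (- a - 1)) * G z \<partial>lborel_PiM I)"
    proof (cases "\<mu> > 0")
      case True
      have "(\<integral>\<^sup>+ z. ?P \<mu> * indicator {z. ?q z \<le> \<mu>} z * ennreal (a * ?q z powr a * \<mu> powr (- a - 1)) * G z \<partial>lborel_PiM I) =
        ennreal (sqrt \<mu> ^ card I) * (\<integral>\<^sup>+ y. ?P \<mu> * indicator {z. ?q z \<le> \<mu>} (\<lambda>i\<in>I. sqrt \<mu> * y i) * ennreal (a * ?q (\<lambda>i\<in>I. sqrt \<mu> * y i) powr a * \<mu> powr (- a - 1)) * G (\<lambda>i\<in>I. sqrt \<mu> * y i) \<partial>lborel_PiM I)"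
        by (rule nn_integral_lborel_PiM_scale) (use True \<open>finite I\<close> in \<open>measurable, auto\<close>)
      also have "\<dots> = (\<integral>\<^sup>+ y. ennreal (sqrt \<mu> ^ card I) * (?P \<mu> * indicator {z. ?q z \<le> \<mu>} (\<lambda>i\<in>I. sqrt \<mu> * y i) * ennreal (a * ?q (\<lambda>i\<in>I. sqrt \<mu> * y i) powr a * \<mu> powr (- a - 1)) * G (\<lambda>i\<in>I. sqrt \<mu> * y i)) \<partial>lborel_PiM I)"
        by (rule nn_integral_cmult[symmetric]) measurable
      also have "\<dots> = (\<integral>\<^sup>+ y. ?P \<mu> * ennreal (a * ?q y powr a * \<mu> powr (a - 1)) * (?B y * G (\<lambda>i\<in>I. sqrt \<mu> * y i)) \<partial>lborel_PiM I)"
      proof (rule nn_integral_cong)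
        fix y
        have 1: "sqrt \<mu> ^ card I = \<mu> powr a"
          using True by (simp add: a_def powr_half_sqrt[symmetric] powr_powr flip: powr_realpow)
        have "ennreal (sqrt \<mu> ^ card I) * ennreal (a * ?q (\<lambda>i\<in>I. sqrt \<mu> * y i) powr a * \<mu> powr (- a - 1)) =
          ennreal (a * ?q y powr a * \<mu> powr (a - 1))"
          unfolding sq_norm_scale 1 using True a
          by (subst ennreal_mult[symmetric]) (auto simp: powr_mult powr_diff powr_minus field_simps sq_norm_nonneg)
        moreover have "indicator {z. ?q z \<le> \<mu>} (\<lambda>i\<in>I. sqrt \<mu> * y i) = ?B y"
          using True by (simp add: indicator_def sq_norm_scale mult_le_cancel_left1)
        ultimately show "ennreal (sqrt \<mu> ^ card I) * (?P \<mu> * indicator {z. ?q z \<le> \<mu>} (\<lambda>i\<in>I. sqrt \<mu> * y i) * ennreal (a * ?q (\<lambda>i\<in>I. sqrt \<mu> * y i) powr a * \<mu> powr (- a - 1)) * G (\<lambda>i\<in>I. sqrt \<mu> * y i))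
          = ?P \<mu> * ennreal (a * ?q y powr a * \<mu> powr (a - 1)) * (?B y * G (\<lambda>i\<in>I. sqrt \<mu> * y i))"
          using ac[of "ennreal (sqrt \<mu> ^ card I)"] by simp
      qed
      finally show ?thesis by simp
    qed simp
  qed
  also have "\<dots> = (\<integral>\<^sup>+ z. (\<integral>\<^sup>+ \<mu>. ?P \<mu> * indicator {z. ?q z \<le> \<mu>} z * ennreal (a * ?q z powr a * \<mu> powr (- a - 1)) * G z \<partial>lborel) \<partial>lborel_PiM I)"
    by (rule nn_integral_lborel_PiM_swap[symmetric]) (fact, measurable)
  also have "\<dots> = (\<integral>\<^sup>+ z. G z \<partial>lborel_PiM I)"
  proof (rule nn_integral_cong_AE, use AE_sq_norm_pos[OF assms(1,2)] in eventually_elim)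
    case (elim z)
    have "(\<integral>\<^sup>+ \<mu>. ?P \<mu> * indicator {z. ?q z \<le> \<mu>} z * ennreal (a * ?q z powr a * \<mu> powr (- a - 1)) * G z \<partial>lborel) =
      (\<integral>\<^sup>+ \<mu>. (indicator {?q z..} \<mu> * ennreal (a * ?q z powr a * \<mu> powr (- a - 1))) * G z \<partial>lborel)"
      by (rule nn_integral_cong) (use elim in \<open>auto simp: indicator_def\<close>)
    also have "\<dots> = 1 * G z"
      by (subst nn_integral_multc) (use nn_integral_powr_tail[OF a elim] in auto)
    finally show ?case by simp
  qed
  finally show ?thesis ..
qed

section \<open>The recursion over one coordinate\<close>

lemma nn_integral_powr_unit_interval:
  assumes "a > -1"
  shows "(\<integral>\<^sup>+ x. indicator {0<..1} x * ennreal (x powr a) \<partial>lborel) = ennreal (1 / (a + 1))"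
proof -
  have "((\<lambda>x. x powr a) has_integral (1 powr (a + 1) / (a + 1))) {0..1}"
    using assms by (intro has_integral_powr_from_0) auto
  hence "(\<integral>\<^sup>+ x. ennreal (x powr a) * indicator {0..1} x \<partial>lborel) = ennreal (1 / (a + 1))"
    by (subst nn_integral_has_integral_lebesgue') auto
  moreover have "(\<integral>\<^sup>+ x. indicator {0<..1} x * ennreal (x powr a) \<partial>lborel) =
      (\<integral>\<^sup>+ x. ennreal (x powr a) * indicator {0..1} x \<partial>lborel)"
    by (intro nn_integral_cong) (auto simp: indicator_def)
  ultimately show ?thesis by simp
qed

lemma sq_norm_insert:
  "finite I \<Longrightarrow> i \<notin> I \<Longrightarrow> sq_norm (insert i I) (x(i := v)) = v\<^sup>2 + sq_norm I x"
  by (auto simp: sq_norm_def intro!: sum.cong)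

text \<open>The vector with new coordinate \<open>v\<close> and remaining squared norm
  \<open>s\<close> has squared norm \<open>v^2 + s\<close>, so projecting it to squared radius
  \<open>t\<close> multiplies both parts by \<open>sqrt (t / (v^2 + s))\<close>.\<close>

lemma radial_insert_radial:
  assumes "finite I" "i \<notin> I" "0 < sq_norm I y" "0 < s" "0 \<le> t"
  shows "radial (insert i I) t ((radial I s y)(i := v)) =
     (radial I (s * t / (v\<^sup>2 + s)) y)(i := v * sqrt t / sqrt (v\<^sup>2 + s))"
proof -
  have q: "sq_norm (insert i I) ((radial I s y)(i := v)) = v\<^sup>2 + s"
    using assms by (simp add: sq_norm_insert sq_norm_radial)
  show ?thesis unfolding radial_def[of "insert i I"] q using assms
    by (auto simp: fun_eq_iff restrict_def radial_def real_sqrt_mult real_sqrt_divide mult_ac)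
qed

lemma upd_measurable [measurable (raw)]:
  assumes "f \<in> M \<rightarrow>\<^sub>M lborel_PiM I" "g \<in> borel_measurable M"
  shows "(\<lambda>x. (f x)(i := g x)) \<in> M \<rightarrow>\<^sub>M lborel_PiM (insert i I)"
  by (rule measurable_fun_upd[where J = I]) (use assms in auto)

text \<open>
  The identity holds for every radius, not merely for almost every one, because both sides are
  defined by integrals over the solid ball: only \<open>s = \<lambda> - v\<^sup>2\<close> and \<open>v = sqrt (\<lambda> / t) * w\<close> are
  substituted.
\<close>

theorem sphere_integral_insert:
  assumes fin: "finite I" and "I \<noteq> {}" "i \<notin> I" "t > 0"
    and [measurable]: "G \<in> borel_measurable (lborel_PiM (insert i I))"
  shows "sphere_integral (insert i I) t G =
    (\<integral>\<^sup>+ v. sphere_integral I (t - v\<^sup>2) (\<lambda>y. G (y(i := v))) \<partial>lborel)"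
proof -
  interpret sigma_finite_measure "lborel_PiM I" by (rule sigma_finite_lborel_PiM) fact
  define a where "a = real (card I) / 2"
  have a: "a \<ge> 1/2" using assms by (simp add: a_def Suc_le_eq card_gt_0_iff)
  \<comment> \<open>The unweighted average over the slice with new coordinate \<open>w\<close> and
    remaining squared radius \<sigma>. As a function of both variables it has a joint measurability
    statement, on which the exchanges of integrals below rely.\<close>
  define E where "E \<sigma> w = (\<integral>\<^sup>+ y. indicator {y. sq_norm I y \<le> 1} y * G ((radial I \<sigma> y)(i := w)) \<partial>lborel_PiM I)" for \<sigma> w
  have [measurable]: "case_prod E \<in> borel_measurable (borel \<Otimes>\<^sub>M borel)"
    unfolding E_def by measurable
  have E_meas [measurable (raw)]: "(\<lambda>x. E (f x) (g x)) \<in> borel_measurable M"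
    if [measurable]: "f \<in> borel_measurable M" "g \<in> borel_measurable M" for f g and M :: "'z measure"
  proof -
    have "(\<lambda>x. case_prod E (f x, g x)) \<in> borel_measurable M" by measurable
    thus ?thesis by simp
  qed
  have sph: "sphere_integral I \<sigma> (\<lambda>y. G (y(i := w))) = indicator {0<..} \<sigma> * ennreal (a * \<sigma> powr (a - 1)) * E \<sigma> w" for \<sigma> w
    by (simp add: sphere_integral_def a_def E_def)
  define R where "R = (\<integral>\<^sup>+ v. sphere_integral I (t - v\<^sup>2) (\<lambda>y. G (y(i := v))) \<partial>lborel)"
  let ?H = "\<lambda>v x. indicator {y. sq_norm (insert i I) y \<le> 1} (x(i := v)) * G (radial (insert i I) t (x(i := v)))"
  have "(\<integral>\<^sup>+ y. indicator {y. sq_norm (insert i I) y \<le> 1} y * G (radial (insert i I) t y) \<partial>lborel_PiM (insert i I)) =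
    (\<integral>\<^sup>+ v. (\<integral>\<^sup>+ x. ?H v x \<partial>lborel_PiM I) \<partial>lborel)"
    by (rule lborel_product.product_nn_integral_insert_rev) (use assms in \<open>auto, measurable\<close>)
  also have "\<dots> = (\<integral>\<^sup>+ v. (\<integral>\<^sup>+ s. indicator {0<..} s * indicator {..1} (v\<^sup>2 + s) * ennreal (a * s powr (a - 1)) *
      E (s * t / (v\<^sup>2 + s)) (v * sqrt t / sqrt (v\<^sup>2 + s)) \<partial>lborel) \<partial>lborel)"
  proof (rule nn_integral_cong)
    fix v :: real
    have "(\<integral>\<^sup>+ x. ?H v x \<partial>lborel_PiM I) = (\<integral>\<^sup>+ s. sphere_integral I s (?H v) \<partial>lborel)"
      by (rule nn_integral_polar[OF fin \<open>I \<noteq> {}\<close>]) measurable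
    also have "\<dots> = (\<integral>\<^sup>+ s. indicator {0<..} s * indicator {..1} (v\<^sup>2 + s) * ennreal (a * s powr (a - 1)) *
      E (s * t / (v\<^sup>2 + s)) (v * sqrt t / sqrt (v\<^sup>2 + s)) \<partial>lborel)"
    proof (rule nn_integral_cong)
      fix s :: real
      show "sphere_integral I s (?H v) = indicator {0<..} s * indicator {..1} (v\<^sup>2 + s) * ennreal (a * s powr (a - 1)) *
        E (s * t / (v\<^sup>2 + s)) (v * sqrt t / sqrt (v\<^sup>2 + s))"
      proof (cases "s > 0")
        case True
        have "(\<integral>\<^sup>+ y. indicator {y. sq_norm I y \<le> 1} y * ?H v (radial I s y) \<partial>lborel_PiM I) =
          (\<integral>\<^sup>+ y. indicator {..1} (v\<^sup>2 + s) * (indicator {y. sq_norm I y \<le> 1} y *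
             G ((radial I (s * t / (v\<^sup>2 + s)) y)(i := v * sqrt t / sqrt (v\<^sup>2 + s)))) \<partial>lborel_PiM I)"
        proof (rule nn_integral_cong_AE, use AE_sq_norm_pos[OF fin \<open>I \<noteq> {}\<close>] in eventually_elim)
          case (elim y)
          have 1: "sq_norm (insert i I) ((radial I s y)(i := v)) = v\<^sup>2 + s"
            using assms elim True by (simp add: sq_norm_insert sq_norm_radial)
          have 2: "radial (insert i I) t ((radial I s y)(i := v)) =
              (radial I (s * t / (v\<^sup>2 + s)) y)(i := v * sqrt t / sqrt (v\<^sup>2 + s))"
            by (rule radial_insert_radial) (use assms elim True in auto)
          show ?case unfolding 2 by (simp add: 1 indicator_def)
        qed
        also have "\<dots> = indicator {..1} (v\<^sup>2 + s) * E (s * t / (v\<^sup>2 + s)) (v * sqrt t / sqrt (v\<^sup>2 + s))"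
          unfolding E_def by (rule nn_integral_cmult) measurable
        finally show ?thesis
          unfolding sphere_integral_def a_def by (simp add: mult_ac)
      qed (simp add: sphere_integral_def)
    qed
    finally show "(\<integral>\<^sup>+ x. ?H v x \<partial>lborel_PiM I) = (\<integral>\<^sup>+ s. indicator {0<..} s * indicator {..1} (v\<^sup>2 + s) * ennreal (a * s powr (a - 1)) *
      E (s * t / (v\<^sup>2 + s)) (v * sqrt t / sqrt (v\<^sup>2 + s)) \<partial>lborel)" .
  qed
  also have "\<dots> = (\<integral>\<^sup>+ v. (\<integral>\<^sup>+ l. indicator {0<..} (l - v\<^sup>2) * indicator {..1} l * ennreal (a * (l - v\<^sup>2) powr (a - 1)) *
      E ((l - v\<^sup>2) * t / l) (v * sqrt t / sqrt l) \<partial>lborel) \<partial>lborel)"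
  proof (rule nn_integral_cong, goal_cases)
    case (1 v)
    have "(\<lambda>s. indicator {0<..} s * indicator {..1} (v\<^sup>2 + s) * ennreal (a * s powr (a - 1)) *
      E (s * t / (v\<^sup>2 + s)) (v * sqrt t / sqrt (v\<^sup>2 + s))) \<in> borel_measurable borel"
      by measurable
    from nn_integral_real_affine[OF this, of 1 "- v\<^sup>2"] show ?case
      by (simp add: algebra_simps)
  qed
  also have "\<dots> = (\<integral>\<^sup>+ l. (\<integral>\<^sup>+ v. indicator {0<..} (l - v\<^sup>2) * indicator {..1} l * ennreal (a * (l - v\<^sup>2) powr (a - 1)) *
      E ((l - v\<^sup>2) * t / l) (v * sqrt t / sqrt l) \<partial>lborel) \<partial>lborel)"
    by (intro lborel_pair.Fubini') measurable
  also have "\<dots> = (\<integral>\<^sup>+ l. indicator {0<..1} l * ennreal (l powr (a - 1/2)) * (ennreal (t powr (1/2 - a)) * R) \<partial>lborel)"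
  proof (rule nn_integral_cong)
    fix l :: real
    show "(\<integral>\<^sup>+ v. indicator {0<..} (l - v\<^sup>2) * indicator {..1} l * ennreal (a * (l - v\<^sup>2) powr (a - 1)) *
      E ((l - v\<^sup>2) * t / l) (v * sqrt t / sqrt l) \<partial>lborel) =
      indicator {0<..1} l * ennreal (l powr (a - 1/2)) * (ennreal (t powr (1/2 - a)) * R)"
    proof (cases "0 < l \<and> l \<le> 1")
      case True
      \<comment> \<open>Scaling by \<open>c\<close> carries the slice of squared radius
        \<open>t\<close> to that of squared radius \<open>l\<close>. The inner integral is therefore
        the same number \<open>R\<close> for all \<open>l\<close>, up to powers of \<open>l\<close>
        and \<open>t\<close>.\<close>
      define c where "c = sqrt (l / t)"
      have c: "c > 0" using True \<open>t > 0\<close> by (simp add: c_def)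
      have c2: "c\<^sup>2 = l / t" using True \<open>t > 0\<close> by (simp add: c_def)
      have "(\<integral>\<^sup>+ v. indicator {0<..} (l - v\<^sup>2) * indicator {..1} l * ennreal (a * (l - v\<^sup>2) powr (a - 1)) *
          E ((l - v\<^sup>2) * t / l) (v * sqrt t / sqrt l) \<partial>lborel) =
        ennreal \<bar>c\<bar> * (\<integral>\<^sup>+ w. indicator {0<..} (l - (0 + c * w)\<^sup>2) * indicator {..1} l * ennreal (a * (l - (0 + c * w)\<^sup>2) powr (a - 1)) *
          E ((l - (0 + c * w)\<^sup>2) * t / l) ((0 + c * w) * sqrt t / sqrt l) \<partial>lborel)"
        by (rule nn_integral_real_affine) (use c in \<open>measurable, auto\<close>)
      also have "\<dots> = (\<integral>\<^sup>+ w. ennreal \<bar>c\<bar> * (indicator {0<..} (l - (0 + c * w)\<^sup>2) * indicator {..1} l * ennreal (a * (l - (0 + c * w)\<^sup>2) powr (a - 1)) *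
          E ((l - (0 + c * w)\<^sup>2) * t / l) ((0 + c * w) * sqrt t / sqrt l)) \<partial>lborel)"
        by (rule nn_integral_cmult[symmetric]) measurable
      also have "\<dots> = (\<integral>\<^sup>+ w. ennreal (l powr (a - 1/2) * t powr (1/2 - a)) * sphere_integral I (t - w\<^sup>2) (\<lambda>y. G (y(i := w))) \<partial>lborel)"
      proof (rule nn_integral_cong)
        fix w :: real
        have 1: "l - (0 + c * w)\<^sup>2 = l / t * (t - w\<^sup>2)"
          using \<open>t > 0\<close> by (simp add: power_mult_distrib c2 field_simps)
        have 2: "l / t * (t - w\<^sup>2) * t / l = t - w\<^sup>2"
          using \<open>t > 0\<close> True by simp
        have 3: "(0 + c * w) * sqrt t / sqrt l = w"
          using \<open>t > 0\<close> True by (simp add: c_def real_sqrt_divide)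
        show "ennreal \<bar>c\<bar> * (indicator {0<..} (l - (0 + c * w)\<^sup>2) * indicator {..1} l * ennreal (a * (l - (0 + c * w)\<^sup>2) powr (a - 1)) *
          E ((l - (0 + c * w)\<^sup>2) * t / l) ((0 + c * w) * sqrt t / sqrt l)) =
          ennreal (l powr (a - 1/2) * t powr (1/2 - a)) * sphere_integral I (t - w\<^sup>2) (\<lambda>y. G (y(i := w)))"
        proof (cases "t - w\<^sup>2 > 0")
          case pos: True
          have "c = (l / t) powr (1/2)"
            using True \<open>t > 0\<close> by (simp add: c_def powr_half_sqrt)
          hence "\<bar>c\<bar> * (a * (l / t * (t - w\<^sup>2)) powr (a - 1)) = (l/t) powr (1/2 + (a - 1)) * (a * (t - w\<^sup>2) powr (a - 1))"
            using c True \<open>t > 0\<close> pos by (simp only: powr_add powr_mult) simp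
          also have "(l/t) powr (1/2 + (a - 1)) = l powr (1/2 + (a - 1)) * t powr - (1/2 + (a - 1))"
            using True \<open>t > 0\<close> powr_divide[of l t "1/2 + (a - 1)"]
              powr_minus_divide[of t "1/2 + (a - 1)"] by simp
          also have "\<dots> = l powr (a - 1/2) * t powr (1/2 - a)" by simp
          finally have e: "ennreal \<bar>c\<bar> * ennreal (a * (l / t * (t - w\<^sup>2)) powr (a - 1)) =
            ennreal (l powr (a - 1/2) * t powr (1/2 - a)) * ennreal (a * (t - w\<^sup>2) powr (a - 1))"
            using a by (simp flip: ennreal_mult)
          have "l / t * (t - w\<^sup>2) > 0" using pos True \<open>t > 0\<close> by simp
          thus ?thesis unfolding 1 2 3 sph using pos True e
            by (simp add: mult.assoc[symmetric])
        next
          case False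
          hence "\<not> l / t * (t - w\<^sup>2) > 0" using True \<open>t > 0\<close>
            by (meson divide_pos_pos zero_less_mult_pos)
          thus ?thesis unfolding 1 sph using False by simp
        qed
      qed
      also have "\<dots> = ennreal (l powr (a - 1/2) * t powr (1/2 - a)) * R"
        unfolding R_def sph by (rule nn_integral_cmult) measurable
      finally show ?thesis using True by (simp add: ennreal_mult mult.assoc)
    next
      case False
      have "indicator {0<..} (l - v\<^sup>2) * indicator {..1} l = (0 :: ennreal)" for v
        using False order.strict_trans1[OF zero_le_power2[of v], of l] by (auto simp: indicator_def)
      thus ?thesis using False by (auto simp: indicator_def)
    qed
  qed
  also have "\<dots> = ennreal (1 / (a - 1/2 + 1)) * (ennreal (t powr (1/2 - a)) * R)"
    by (subst nn_integral_multc) (use a nn_integral_powr_unit_interval[of "a - 1/2"] in auto)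
  finally have *: "(\<integral>\<^sup>+ y. indicator {y. sq_norm (insert i I) y \<le> 1} y * G (radial (insert i I) t y) \<partial>lborel_PiM (insert i I)) =
    ennreal (1 / (a - 1/2 + 1)) * (ennreal (t powr (1/2 - a)) * R)" .
  have m: "ennreal x * (ennreal y * (ennreal z * R)) = ennreal (x * (y * z)) * R"
    if "0 \<le> x" "0 \<le> y" "0 \<le> z" for x y z
    using that by (simp add: ennreal_mult mult.assoc)
  have b: "real (card (insert i I)) / 2 = a + 1/2"
    using assms by (simp add: a_def add_divide_distrib)
  have "sphere_integral (insert i I) t G = ennreal ((a + 1/2) * t powr (a + 1/2 - 1)) * (ennreal (1 / (a - 1/2 + 1)) * (ennreal (t powr (1/2 - a)) * R))"
    unfolding sphere_integral_def b * using \<open>t > 0\<close> by simp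
  also have "\<dots> = ennreal (((a + 1/2) * t powr (a + 1/2 - 1)) * (1 / (a - 1/2 + 1) * t powr (1/2 - a))) * R"
    by (rule m) (use a in auto)
  \<comment> \<open>The weight built into \<open>sphere_integral\<close> in the higher dimension
    cancels the integral over \<open>l\<close>: \<open>a + 1/2\<close> meets its reciprocal, and the
    two powers of \<open>t\<close> have opposite exponents.\<close>
  also have "((a + 1/2) * t powr (a + 1/2 - 1)) * (1 / (a - 1/2 + 1) * t powr (1/2 - a)) = 1"
    using a \<open>t > 0\<close> by (simp add: powr_diff powr_add)
  finally show ?thesis by (simp add: R_def)
qed

section \<open>The square map on the line, and integration over Kac's sphere\<close>

text \<open>The polar formula in dimension one. The Jacobian of the square map is
  \<open>2 * |v|\<close> on each of its two branches, and the two branches together absorb the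
  factor 2.\<close>

lemma nn_integral_abs_square:
  assumes [measurable]: "k \<in> borel_measurable borel"
  shows "(\<integral>\<^sup>+ v. ennreal \<bar>v\<bar> * k (v\<^sup>2) \<partial>lborel) = (\<integral>\<^sup>+ t. indicator {0<..} t * k t \<partial>lborel)"
proof -
  let ?I = "{0::nat}"
  let ?G = "\<lambda>y. ennreal \<bar>y 0\<bar> * k ((y 0)\<^sup>2)"
  have "(\<integral>\<^sup>+ v. ennreal \<bar>v\<bar> * k (v\<^sup>2) \<partial>lborel) = (\<integral>\<^sup>+ y. ?G y \<partial>lborel_PiM ?I)"
    by (rule lborel_product.product_nn_integral_singleton[symmetric]) simp
  also have "\<dots> = (\<integral>\<^sup>+ t. sphere_integral ?I t ?G \<partial>lborel)"
    by (rule nn_integral_polar) auto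
  also have "\<dots> = (\<integral>\<^sup>+ t. indicator {0<..} t * k t \<partial>lborel)"
  proof (rule nn_integral_cong)
    fix t :: real
    show "sphere_integral ?I t ?G = indicator {0<..} t * k t"
    proof (cases "t > 0")
      case True
      have "(\<integral>\<^sup>+ y. indicator {y. sq_norm ?I y \<le> 1} y * ?G (radial ?I t y) \<partial>lborel_PiM ?I) =
        (\<integral>\<^sup>+ y. indicator {-1..1} (y 0) * (ennreal (sqrt t) * k t) \<partial>lborel_PiM ?I)"
      proof (rule nn_integral_cong_AE, use AE_sq_norm_pos[of ?I, simplified] in eventually_elim)
        case (elim y)
        hence "(radial ?I t y 0)\<^sup>2 = t"
          using sq_norm_radial[of t ?I y] True by (simp add: sq_norm_def)
        moreover from this have "\<bar>radial ?I t y 0\<bar> = sqrt t"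
          by (metis real_sqrt_abs)
        ultimately show ?case
          by (auto simp: indicator_def sq_norm_def abs_square_le_1 abs_le_iff)
      qed
      also have "\<dots> = (\<integral>\<^sup>+ y. indicator {-1..1::real} y * (ennreal (sqrt t) * k t) \<partial>lborel)"
        by (rule lborel_product.product_nn_integral_singleton) simp
      also have "\<dots> = 2 * (ennreal (sqrt t) * k t)"
        by (subst nn_integral_multc) auto
      finally have *: "sphere_integral ?I t ?G = ennreal (1/2 * t powr (-1/2)) * (ennreal 2 * (ennreal (sqrt t) * k t))"
        using True by (simp add: sphere_integral_def)
      also have "\<dots> = ennreal ((1/2 * t powr (-1/2)) * (2 * sqrt t)) * k t"
        using True by (subst (1 2) ennreal_mult) (auto simp: ennreal_mult' mult.assoc simp del: ennreal_numeral)
      also have "(1/2 * t powr (-1/2)) * (2 * sqrt t) = 1"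
        using True by (simp add: powr_minus powr_half_sqrt)
      finally show ?thesis using True by simp
    qed (simp add: sphere_integral_def)
  qed
  finally show ?thesis .
qed

text \<open>The Jacobian weight \<open>|v|\<close> vanishes at the origin alone, so the square map
  pulls null sets back to null sets. This permits a density known only almost everywhere to be
  evaluated along \<open>s - v^2\<close>.\<close>

lemma AE_minus_square:
  fixes s :: real
  assumes "AE t in lborel. P t"
  shows "AE v in lborel. P (s - v\<^sup>2)"
proof -
  from assms obtain Z where Z: "{t. \<not> P t} \<subseteq> Z" "Z \<in> null_sets lborel"
    by (auto elim!: AE_E simp: null_sets_def)
  hence [measurable]: "Z \<in> sets borel" by auto
  have "(\<integral>\<^sup>+ v. ennreal \<bar>v\<bar> * indicator Z (s - v\<^sup>2) \<partial>lborel) = (\<integral>\<^sup>+ t. indicator {0<..} t * indicator Z (s - t) \<partial>lborel)"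
    by (rule nn_integral_abs_square) measurable
  also have "\<dots> \<le> (\<integral>\<^sup>+ t. indicator Z (s + (-1) * t) \<partial>lborel)"
    by (rule nn_integral_mono) (auto simp: indicator_def)
  also have "\<dots> = ennreal \<bar>-1\<bar> * (\<integral>\<^sup>+ t. indicator Z (s + (-1) * t) \<partial>lborel)" by simp
  also have "\<dots> = (\<integral>\<^sup>+ t. indicator Z t \<partial>lborel)"
    by (rule nn_integral_real_affine[symmetric]) auto
  also have "\<dots> = 0" using Z by (auto simp: null_sets_def)
  finally have "(\<integral>\<^sup>+ v. ennreal \<bar>v\<bar> * indicator Z (s - v\<^sup>2) \<partial>lborel) = 0" by simp
  hence "AE v in lborel. ennreal \<bar>v\<bar> * indicator Z (s - v\<^sup>2) = 0"
    by (subst (asm) nn_integral_0_iff_AE) measurable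
  moreover have "AE v in lborel. v \<noteq> (0::real)" by (rule AE_lborel_singleton)
  ultimately show ?thesis
    by eventually_elim (use Z in \<open>auto simp: indicator_def split: if_splits\<close>)
qed

text \<open>\<open>kac_sigma N\<close> averages over the ball of squared radius \<open>N\<close>,
  \<open>sphere_integral\<close> over the unit ball. Since radial projection ignores scaling, both
  are multiples of the same integral \<open>V\<close>, and the factors cancel in the
  quotient.\<close>

lemma sphere_integral_total:
  assumes "N > 0"
  shows "sphere_integral {..<N} N (\<lambda>_. 1) \<noteq> 0" "sphere_integral {..<N} N (\<lambda>_. 1) \<noteq> \<infinity>"
    and nn_integral_kac_sigma: "G \<in> borel_measurable (\<Pi>\<^sub>M i\<in>{..<N}. borel) \<Longrightarrow>
      (\<integral>\<^sup>+ x. G x \<partial>kac_sigma N) = sphere_integral {..<N} N G / sphere_integral {..<N} N (\<lambda>_. 1)"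
proof -
  let ?I = "{..<N}"
  let ?B = "\<lambda>y. indicator {y. sq_norm ?I y \<le> 1} y :: ennreal"
  define V where "V G = (\<integral>\<^sup>+ y. ?B y * G (radial ?I N y) \<partial>lborel_PiM ?I)" for G
  define c where "c = ennreal (sqrt N ^ N)"
  define d where "d = ennreal (real N / 2 * real N powr (real N / 2 - 1))"
  have c: "c \<noteq> 0" "c \<noteq> \<infinity>" using assms by (auto simp: c_def)
  have d: "d \<noteq> 0" "d \<noteq> \<infinity>" using assms by (auto simp: d_def)
  have sph: "sphere_integral ?I N G = d * V G" for G
    using assms by (simp add: sphere_integral_def V_def d_def)
  have ball: "(\<integral>\<^sup>+ y. G (radial ?I N y) * indicator (kac_ball N) y \<partial>lborel_PiM ?I) = c * V G"
    if [measurable]: "G \<in> borel_measurable (lborel_PiM ?I)" for G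
  proof -
    have [measurable]: "kac_ball N \<in> sets (lborel_PiM ?I)" by (rule kac_ball_sets)
    have "(\<integral>\<^sup>+ y. G (radial ?I N y) * indicator (kac_ball N) y \<partial>lborel_PiM ?I) =
      ennreal (sqrt N ^ card ?I) * (\<integral>\<^sup>+ y. G (radial ?I N (\<lambda>i\<in>?I. sqrt N * y i)) * indicator (kac_ball N) (\<lambda>i\<in>?I. sqrt N * y i) \<partial>lborel_PiM ?I)"
      by (rule nn_integral_lborel_PiM_scale) (use assms in auto)
    also have "(\<integral>\<^sup>+ y. G (radial ?I N (\<lambda>i\<in>?I. sqrt N * y i)) * indicator (kac_ball N) (\<lambda>i\<in>?I. sqrt N * y i) \<partial>lborel_PiM ?I) = V G"
      unfolding V_def
    proof (rule nn_integral_cong, goal_cases)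
      case (1 y)
      have "(\<lambda>i\<in>?I. sqrt N * y i) \<in> kac_ball N \<longleftrightarrow> sq_norm ?I (\<lambda>i\<in>?I. sqrt N * y i) \<le> N"
        by (auto simp: kac_ball_def sq_norm_def space_PiM)
      also have "\<dots> \<longleftrightarrow> sq_norm ?I y \<le> 1"
        unfolding sq_norm_scale using assms by simp
      finally show ?case
        using assms by (simp add: radial_scale indicator_def del: restrict_apply)
    qed
    finally show ?thesis by (simp add: c_def)
  qed
  have vol: "emeasure (lborel_PiM ?I) (kac_ball N) = c * V (\<lambda>_. 1)"
    using ball[of "\<lambda>_. 1"] kac_ball_sets by simp
  have V1: "V (\<lambda>_. 1) \<noteq> 0" "V (\<lambda>_. 1) \<noteq> \<infinity>"
    using emeasure_kac_ball[of N] c unfolding vol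
    by (auto simp: ennreal_mult_eq_top_iff)
  show "sphere_integral {..<N} N (\<lambda>_. 1) \<noteq> 0" "sphere_integral {..<N} N (\<lambda>_. 1) \<noteq> \<infinity>"
    unfolding sph using V1 d by (auto simp: ennreal_mult_eq_top_iff)
  assume G [measurable]: "G \<in> borel_measurable (\<Pi>\<^sub>M i\<in>{..<N}. borel)"
  have sets_eq: "sets (lborel_PiM ?I) = sets (\<Pi>\<^sub>M i\<in>?I. borel)"
    by (rule sets_PiM_cong) auto
  have G' [measurable]: "G \<in> borel_measurable (lborel_PiM ?I)"
    using G by (simp cong: measurable_cong_sets add: sets_eq)
  have proj: "radial_proj N = radial ?I N"
    by (simp add: fun_eq_iff radial_proj_def radial_def sq_norm_def)
  have "(\<integral>\<^sup>+ x. G x \<partial>kac_sigma N) = (\<integral>\<^sup>+ x. G (radial ?I N x) \<partial>uniform_measure (lborel_PiM ?I) (kac_ball N))"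
    unfolding kac_sigma_def proj[symmetric]
    by (rule nn_integral_distr) (simp_all add: radial_proj_measurable measurable_cong_sets[OF sets_uniform_measure])
  also have "\<dots> = (\<integral>\<^sup>+ x. G (radial ?I N x) * indicator (kac_ball N) x \<partial>lborel_PiM ?I) / emeasure (lborel_PiM ?I) (kac_ball N)"
    by (rule nn_integral_uniform_measure) (use kac_ball_sets in measurable)
  also have "\<dots> = (c * V G) / (c * V (\<lambda>_. 1))" by (simp only: ball[OF G'] vol)
  also have "\<dots> = V G / V (\<lambda>_. 1)"
    using divide_mult_eq[OF c, of "V G" "V (\<lambda>_. 1)"] by (simp add: mult.commute)
  also have "\<dots> = (d * V G) / (d * V (\<lambda>_. 1))"
    using divide_mult_eq[OF d, of "V G" "V (\<lambda>_. 1)"] by (simp add: mult.commute)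
  finally show "(\<integral>\<^sup>+ x. G x \<partial>kac_sigma N) = sphere_integral {..<N} N G / sphere_integral {..<N} N (\<lambda>_. 1)"
    by (simp add: sph)
qed

section \<open>Characteristic functions of laws of squares\<close>

text \<open>\<open>|char|^2\<close> is the characteristic function of the difference of two
  independent copies, which is why the product measure appears.\<close>

lemma char_norm_square:
  assumes "finite_measure \<nu>" and [measurable_cong, simp]: "sets \<nu> = sets borel"
  shows "complex_of_real ((norm (char \<nu> \<xi>))\<^sup>2) = (CLINT z|(\<nu> \<Otimes>\<^sub>M \<nu>). iexp (\<xi> * (fst z - snd z)))"
    and "integrable (\<nu> \<Otimes>\<^sub>M \<nu>) (\<lambda>z. iexp (\<xi> * (fst z - snd z)))"
proof -
  interpret finite_measure \<nu> by fact
  interpret pair_sigma_finite \<nu> \<nu> ..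
  interpret P: finite_measure "\<nu> \<Otimes>\<^sub>M \<nu>" by (rule finite_measure_pair_measure) fact+
  show int: "integrable (\<nu> \<Otimes>\<^sub>M \<nu>) (\<lambda>z. iexp (\<xi> * (fst z - snd z)))"
    by (rule P.integrable_const_bound[of _ 1]) auto
  have i: "integrable \<nu> (\<lambda>x. iexp (\<xi> * x))" for \<xi>
    by (rule integrable_const_bound[of _ 1]) auto
  have "complex_of_real ((norm (char \<nu> \<xi>))\<^sup>2) = char \<nu> \<xi> * cnj (char \<nu> \<xi>)"
    by (simp add: complex_mult_cnj cmod_power2 mult.commute)
  also have "\<dots> = (CLINT x|\<nu>. iexp (\<xi> * x) * cnj (char \<nu> \<xi>))"
    unfolding char_def by (rule integral_mult_left_zero[symmetric])
  also have "cnj (char \<nu> \<xi>) = (CLINT y|\<nu>. iexp (- \<xi> * y))"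
  proof -
    have "(CLINT y|\<nu>. iexp (- \<xi> * y)) = (CLINT y|\<nu>. cnj (iexp (\<xi> * y)))"
      by (intro Bochner_Integration.integral_cong refl) (simp add: exp_cnj)
    thus ?thesis unfolding char_def by (simp only: Bochner_Integration.integral_cnj)
  qed
  also have "(CLINT x|\<nu>. iexp (\<xi> * x) * (CLINT y|\<nu>. iexp (- \<xi> * y))) =
      (CLINT x|\<nu>. (CLINT y|\<nu>. iexp (\<xi> * (fst (x, y) - snd (x, y)))))"
    by (intro Bochner_Integration.integral_cong refl)
       (simp flip: integral_mult_right_zero exp_add add: algebra_simps)
  also have "\<dots> = (CLINT z|(\<nu> \<Otimes>\<^sub>M \<nu>). iexp (\<xi> * (fst z - snd z)))"
    by (rule integral_fst'[OF int])
  finally show "complex_of_real ((norm (char \<nu> \<xi>))\<^sup>2) = (CLINT z|(\<nu> \<Otimes>\<^sub>M \<nu>). iexp (\<xi> * (fst z - snd z)))" .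
qed

lemma char_std_normal_distribution': "char std_normal_distribution t = complex_of_real (exp (- (t\<^sup>2) / 2))"
  by (simp add: char_std_normal_distribution)

text \<open>Fubini, and the fact that the standard Gaussian is its own Fourier transform up to
  normalisation: averaging over Gaussian frequencies yields a Gaussian in the difference of the two
  copies.\<close>

lemma gaussian_average_char_square:
  assumes fm: "finite_measure \<nu>" and [measurable_cong, simp]: "sets \<nu> = sets borel"
  shows "(LINT x|std_normal_distribution. (norm (char \<nu> (\<sigma> * x)))\<^sup>2) =
    (LINT z|(\<nu> \<Otimes>\<^sub>M \<nu>). exp (- ((\<sigma> * (fst z - snd z))\<^sup>2) / 2))"
proof -
  interpret \<nu>: finite_measure \<nu> by fact
  interpret N: real_distribution std_normal_distribution by (rule real_dist_normal_dist)
  interpret P: finite_measure "\<nu> \<Otimes>\<^sub>M \<nu>" by (rule finite_measure_pair_measure) fact+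
  interpret pair_sigma_finite std_normal_distribution "\<nu> \<Otimes>\<^sub>M \<nu>" ..
  interpret T: finite_measure "std_normal_distribution \<Otimes>\<^sub>M (\<nu> \<Otimes>\<^sub>M \<nu>)"
    by (rule finite_measure_pair_measure) unfold_locales
  have [measurable_cong]: "sets std_normal_distribution = sets borel" by simp
  have "complex_of_real (LINT x|std_normal_distribution. (norm (char \<nu> (\<sigma> * x)))\<^sup>2) =
    (CLINT x|std_normal_distribution. (CLINT z|(\<nu> \<Otimes>\<^sub>M \<nu>). iexp ((\<sigma> * x) * (fst z - snd z))))"
    by (subst integral_complex_of_real[symmetric]) (simp only: char_norm_square[OF assms])
  also have "\<dots> = (CLINT z|(\<nu> \<Otimes>\<^sub>M \<nu>). (CLINT x|std_normal_distribution. iexp ((\<sigma> * x) * (fst z - snd z))))"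
    by (rule Fubini_integral[symmetric], rule T.integrable_const_bound[of _ 1])
       (auto simp: split_beta simp del: of_real_mult of_real_diff)
  also have "\<dots> = (CLINT z|(\<nu> \<Otimes>\<^sub>M \<nu>). complex_of_real (exp (- ((\<sigma> * (fst z - snd z))\<^sup>2) / 2)))"
  proof (intro Bochner_Integration.integral_cong refl, goal_cases)
    case (1 z)
    have "(CLINT x|std_normal_distribution. iexp ((\<sigma> * x) * (fst z - snd z))) = char std_normal_distribution (\<sigma> * (fst z - snd z))"
      unfolding char_def by (intro Bochner_Integration.integral_cong refl) (simp add: mult_ac)
    thus ?case by (simp only: char_std_normal_distribution')
  qed
  also have "\<dots> = complex_of_real (LINT z|(\<nu> \<Otimes>\<^sub>M \<nu>). exp (- ((\<sigma> * (fst z - snd z))\<^sup>2) / 2))"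
    by (rule integral_complex_of_real)
  finally show ?thesis by (simp only: of_real_eq_iff)
qed

lemma nn_integral_gaussian:
  assumes "\<sigma> > 0"
  shows "(\<integral>\<^sup>+ t. ennreal (exp (- ((\<sigma> * (x - t))\<^sup>2) / 2)) \<partial>lborel) = ennreal (sqrt (2 * pi) / \<sigma>)"
proof -
  have e: "exp (- ((\<sigma> * (x - t))\<^sup>2) / 2) = (sqrt (2 * pi) / \<sigma>) * normal_density x (1 / \<sigma>) t" for t
  proof -
    have "(\<sigma> * (x - t))\<^sup>2 = \<sigma>\<^sup>2 * (t - x)\<^sup>2"
      by (simp add: power_mult_distrib power2_commute)
    thus ?thesis using assms unfolding normal_density_def
      by (simp add: real_sqrt_mult real_sqrt_divide power_divide)
  qed
  interpret prob_space "density lborel (normal_density x (1 / \<sigma>))"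
    by (rule prob_space_normal_density) (use assms in simp)
  have "(\<integral>\<^sup>+ t. ennreal (normal_density x (1 / \<sigma>) t) \<partial>lborel) = 1"
    using emeasure_space_1 by (simp add: emeasure_density)
  moreover have "(\<integral>\<^sup>+ t. ennreal (exp (- ((\<sigma> * (x - t))\<^sup>2) / 2)) \<partial>lborel) =
      (\<integral>\<^sup>+ t. ennreal (sqrt (2 * pi) / \<sigma>) * ennreal (normal_density x (1 / \<sigma>) t) \<partial>lborel)"
    unfolding e using assms by (intro nn_integral_cong ennreal_mult) auto
  ultimately show ?thesis by (simp add: nn_integral_cmult)
qed

text \<open>
  A one-sided Plancherel estimate: the square map has density at most \<open>l / e\<close> on the support of
  \<open>a\<close>, and a Gaussian cutoff in frequency makes Fubini's theorem applicable.
\<close>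

lemma nn_integral_char_square_le:
  fixes a :: "real \<Rightarrow> real" and l e :: real
  assumes [measurable]: "a \<in> borel_measurable borel" and a0: "\<And>v. 0 \<le> a v"
    and mass: "(\<integral>\<^sup>+ v. ennreal (a v) \<partial>lborel) \<le> 1"
    and le: "l > 0" "e > 0" and a: "\<And>v. a v \<le> l" "\<And>v. \<bar>v\<bar> < e \<Longrightarrow> a v = 0"
  defines "\<nu> \<equiv> distr (density lborel (\<lambda>v. ennreal (a v))) borel (\<lambda>v. v\<^sup>2)"
  shows "(\<integral>\<^sup>+ \<xi>. ennreal ((norm (char \<nu> \<xi>))\<^sup>2) \<partial>lborel) \<le> ennreal (2 * pi * l / e)"
proof -
  have sets_\<nu> [measurable_cong, simp]: "sets \<nu> = sets borel" by (simp add: \<nu>_def)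
  have nn_\<nu>: "(\<integral>\<^sup>+ x. g x \<partial>\<nu>) = (\<integral>\<^sup>+ v. ennreal (a v) * g (v\<^sup>2) \<partial>lborel)"
    if [measurable]: "g \<in> borel_measurable borel" for g
    unfolding \<nu>_def by (simp add: nn_integral_distr nn_integral_density)
  have mass_\<nu>: "emeasure \<nu> (space \<nu>) \<le> 1"
    using mass nn_\<nu>[of "\<lambda>_. 1"] by (simp add: emeasure_distr \<nu>_def emeasure_density)
  have fm: "finite_measure \<nu>"
    using mass_\<nu> by (intro finite_measureI) (auto simp: top_unique)
  interpret \<nu>: finite_measure \<nu> by fact
  interpret P: finite_measure "\<nu> \<Otimes>\<^sub>M \<nu>" by (rule finite_measure_pair_measure) fact+
  interpret N: real_distribution std_normal_distribution by (rule real_dist_normal_dist)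
  have [measurable]: "char \<nu> \<in> borel_measurable borel"
  proof -
    interpret pair_sigma_finite lborel \<nu> ..
    show ?thesis unfolding char_def by measurable
  qed
  have main: "(\<integral>\<^sup>+ \<xi>. ennreal ((norm (char \<nu> \<xi>))\<^sup>2 * exp (- ((\<xi> / \<sigma>)\<^sup>2) / 2)) \<partial>lborel) \<le> ennreal (2 * pi * l / e)"
    if \<sigma>: "\<sigma> > 0" for \<sigma> :: real
  proof -
    have inner: "(\<integral>\<^sup>+ y. ennreal (exp (- ((\<sigma> * (x - y))\<^sup>2) / 2)) \<partial>\<nu>) \<le> ennreal (l / e * (sqrt (2 * pi) / \<sigma>))" for x
    proof -
      have "(\<integral>\<^sup>+ y. ennreal (exp (- ((\<sigma> * (x - y))\<^sup>2) / 2)) \<partial>\<nu>) =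
        (\<integral>\<^sup>+ v. ennreal (a v) * ennreal (exp (- ((\<sigma> * (x - v\<^sup>2))\<^sup>2) / 2)) \<partial>lborel)"
        by (rule nn_\<nu>) measurable
      also have "\<dots> \<le> (\<integral>\<^sup>+ v. ennreal (l / e) * (ennreal \<bar>v\<bar> * ennreal (exp (- ((\<sigma> * (x - v\<^sup>2))\<^sup>2) / 2))) \<partial>lborel)"
      proof (rule nn_integral_mono)
        fix v :: real
        \<comment> \<open>The factor \<open>|v|\<close> is inserted so that the substitution
          \<open>t = v^2\<close> applies. It costs \<open>1 / e\<close>, since \<open>a\<close>
          lives on \<open>|v| >= e\<close>.\<close>
        have "a v \<le> l / e * \<bar>v\<bar>"
        proof (cases "\<bar>v\<bar> < e")
          case True thus ?thesis using a(2)[of v] le by simp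
        next
          case False
          hence "l / e * e \<le> l / e * \<bar>v\<bar>" using le by (intro mult_left_mono) auto
          with a(1)[of v] le show ?thesis by simp
        qed
        hence "ennreal (a v) \<le> ennreal (l / e) * ennreal \<bar>v\<bar>"
          using le by (simp flip: ennreal_mult add: ennreal_leI)
        thus "ennreal (a v) * ennreal (exp (- ((\<sigma> * (x - v\<^sup>2))\<^sup>2) / 2)) \<le>
          ennreal (l / e) * (ennreal \<bar>v\<bar> * ennreal (exp (- ((\<sigma> * (x - v\<^sup>2))\<^sup>2) / 2)))"
          unfolding mult.assoc[symmetric] by (rule mult_right_mono) simp
      qed
      also have "\<dots> = ennreal (l / e) * (\<integral>\<^sup>+ v. ennreal \<bar>v\<bar> * ennreal (exp (- ((\<sigma> * (x - v\<^sup>2))\<^sup>2) / 2)) \<partial>lborel)"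
        by (rule nn_integral_cmult) measurable
      also have "(\<integral>\<^sup>+ v. ennreal \<bar>v\<bar> * ennreal (exp (- ((\<sigma> * (x - v\<^sup>2))\<^sup>2) / 2)) \<partial>lborel) =
        (\<integral>\<^sup>+ t. indicator {0<..} t * ennreal (exp (- ((\<sigma> * (x - t))\<^sup>2) / 2)) \<partial>lborel)"
        by (rule nn_integral_abs_square) measurable
      also have "\<dots> \<le> (\<integral>\<^sup>+ t. ennreal (exp (- ((\<sigma> * (x - t))\<^sup>2) / 2)) \<partial>lborel)"
        by (rule nn_integral_mono) (auto simp: indicator_def)
      also have "\<dots> = ennreal (sqrt (2 * pi) / \<sigma>)" by (rule nn_integral_gaussian) fact
      finally show ?thesis
        by (subst ennreal_mult) (use le \<sigma> in \<open>auto simp: mult_left_mono\<close>)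
    qed
    have "ennreal (LINT z|(\<nu> \<Otimes>\<^sub>M \<nu>). exp (- ((\<sigma> * (fst z - snd z))\<^sup>2) / 2)) =
      (\<integral>\<^sup>+ z. ennreal (exp (- ((\<sigma> * (fst z - snd z))\<^sup>2) / 2)) \<partial>(\<nu> \<Otimes>\<^sub>M \<nu>))"
      by (rule nn_integral_eq_integral[symmetric], rule P.integrable_const_bound[of _ 1]) auto
    also have "\<dots> = (\<integral>\<^sup>+ x. (\<integral>\<^sup>+ y. ennreal (exp (- ((\<sigma> * (x - y))\<^sup>2) / 2)) \<partial>\<nu>) \<partial>\<nu>)"
      by (subst \<nu>.nn_integral_fst[symmetric]) auto
    also have "\<dots> \<le> (\<integral>\<^sup>+ x. ennreal (l / e * (sqrt (2 * pi) / \<sigma>)) \<partial>\<nu>)"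
      by (rule nn_integral_mono) (rule inner)
    also have "\<dots> \<le> ennreal (l / e * (sqrt (2 * pi) / \<sigma>)) * 1"
      unfolding nn_integral_const by (rule mult_left_mono[OF mass_\<nu>]) simp
    finally have P_le: "ennreal (LINT z|(\<nu> \<Otimes>\<^sub>M \<nu>). exp (- ((\<sigma> * (fst z - snd z))\<^sup>2) / 2)) \<le> ennreal (l / e * (sqrt (2 * pi) / \<sigma>))"
      by simp
    have bounded: "norm (char \<nu> \<xi>) \<le> measure \<nu> (space \<nu>)" for \<xi>
    proof -
      have "norm (char \<nu> \<xi>) \<le> (LINT x|\<nu>. norm (iexp (\<xi> * x)))"
        unfolding char_def by (rule integral_norm_bound)
      thus ?thesis by (simp del: of_real_mult)
    qed
    have int: "integrable std_normal_distribution (\<lambda>x. (norm (char \<nu> (\<sigma> * x)))\<^sup>2)"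
      by (rule N.integrable_const_bound[of _ "(measure \<nu> (space \<nu>))\<^sup>2"])
         (use bounded in \<open>auto intro!: power_mono\<close>)
    have "(\<integral>\<^sup>+ \<xi>. ennreal ((norm (char \<nu> \<xi>))\<^sup>2 * exp (- ((\<xi> / \<sigma>)\<^sup>2) / 2)) \<partial>lborel) =
      ennreal \<bar>\<sigma>\<bar> * (\<integral>\<^sup>+ x. ennreal ((norm (char \<nu> (0 + \<sigma> * x)))\<^sup>2 * exp (- (((0 + \<sigma> * x) / \<sigma>)\<^sup>2) / 2)) \<partial>lborel)"
      by (rule nn_integral_real_affine) (use \<sigma> in auto)
    also have "(\<integral>\<^sup>+ x. ennreal ((norm (char \<nu> (0 + \<sigma> * x)))\<^sup>2 * exp (- (((0 + \<sigma> * x) / \<sigma>)\<^sup>2) / 2)) \<partial>lborel) =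
      (\<integral>\<^sup>+ x. ennreal (sqrt (2 * pi)) * (ennreal (std_normal_density x) * ennreal ((norm (char \<nu> (\<sigma> * x)))\<^sup>2)) \<partial>lborel)"
      by (rule nn_integral_cong) (use \<sigma> in \<open>simp add: std_normal_density_def mult_ac flip: ennreal_mult\<close>)
    also have "\<dots> = ennreal (sqrt (2 * pi)) * (\<integral>\<^sup>+ x. ennreal (std_normal_density x) * ennreal ((norm (char \<nu> (\<sigma> * x)))\<^sup>2) \<partial>lborel)"
      by (rule nn_integral_cmult) measurable
    also have "(\<integral>\<^sup>+ x. ennreal (std_normal_density x) * ennreal ((norm (char \<nu> (\<sigma> * x)))\<^sup>2) \<partial>lborel) =
      (\<integral>\<^sup>+ x. ennreal ((norm (char \<nu> (\<sigma> * x)))\<^sup>2) \<partial>std_normal_distribution)"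
      by (rule nn_integral_density[symmetric]) measurable
    also have "\<dots> = ennreal (LINT x|std_normal_distribution. (norm (char \<nu> (\<sigma> * x)))\<^sup>2)"
      by (rule nn_integral_eq_integral[OF int]) simp
    also have "\<dots> \<le> ennreal (l / e * (sqrt (2 * pi) / \<sigma>))"
      unfolding gaussian_average_char_square[OF fm sets_\<nu>] by (rule P_le)
    finally have "(\<integral>\<^sup>+ \<xi>. ennreal ((norm (char \<nu> \<xi>))\<^sup>2 * exp (- ((\<xi> / \<sigma>)\<^sup>2) / 2)) \<partial>lborel) \<le>
      ennreal \<bar>\<sigma>\<bar> * (ennreal (sqrt (2 * pi)) * ennreal (l / e * (sqrt (2 * pi) / \<sigma>)))"
      by (simp add: mult_left_mono)
    also have "\<dots> = ennreal (2 * pi * l / e)"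
      using le \<sigma> by (simp flip: ennreal_mult)
    finally show ?thesis .
  qed
  have "(\<integral>\<^sup>+ \<xi>. ennreal ((norm (char \<nu> \<xi>))\<^sup>2) \<partial>lborel) =
    (\<integral>\<^sup>+ \<xi>. liminf (\<lambda>n. ennreal ((norm (char \<nu> \<xi>))\<^sup>2 * exp (- ((\<xi> / real (Suc n))\<^sup>2) / 2))) \<partial>lborel)"
  proof (rule nn_integral_cong)
    fix \<xi> :: real
    have "(\<lambda>n. (\<xi> / real (Suc n))) \<longlonglongrightarrow> 0"
      using tendsto_mult[OF tendsto_const[of \<xi>] LIMSEQ_inverse_real_of_nat] by (simp add: divide_inverse)
    hence "(\<lambda>n. (norm (char \<nu> \<xi>))\<^sup>2 * exp (- ((\<xi> / real (Suc n))\<^sup>2) / 2)) \<longlonglongrightarrow> (norm (char \<nu> \<xi>))\<^sup>2 * exp (- (0\<^sup>2) / 2)"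
      by (intro tendsto_intros) auto
    hence "(\<lambda>n. ennreal ((norm (char \<nu> \<xi>))\<^sup>2 * exp (- ((\<xi> / real (Suc n))\<^sup>2) / 2))) \<longlonglongrightarrow> ennreal ((norm (char \<nu> \<xi>))\<^sup>2)"
      by (intro tendsto_ennrealI) simp
    thus "ennreal ((norm (char \<nu> \<xi>))\<^sup>2) = liminf (\<lambda>n. ennreal ((norm (char \<nu> \<xi>))\<^sup>2 * exp (- ((\<xi> / real (Suc n))\<^sup>2) / 2)))"
      by (rule lim_imp_Liminf[symmetric, rotated]) simp
  qed
  \<comment> \<open>The frequency cutoff tends to 1 as its width grows, and the bound
    \<open>main\<close> does not involve the width, so Fatou's lemma removes the cutoff.\<close>
  also have "\<dots> \<le> liminf (\<lambda>n. (\<integral>\<^sup>+ \<xi>. ennreal ((norm (char \<nu> \<xi>))\<^sup>2 * exp (- ((\<xi> / real (Suc n))\<^sup>2) / 2)) \<partial>lborel))"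
    by (rule nn_integral_liminf) measurable
  also have "\<dots> \<le> limsup (\<lambda>n. (\<integral>\<^sup>+ \<xi>. ennreal ((norm (char \<nu> \<xi>))\<^sup>2 * exp (- ((\<xi> / real (Suc n))\<^sup>2) / 2)) \<partial>lborel))"
    by (rule Liminf_le_Limsup) simp
  also have "\<dots> \<le> ennreal (2 * pi * l / e)"
    by (rule Limsup_bounded) (use main in auto)
  finally show ?thesis .
qed

section \<open>Superlevel sets of the characteristic function of a square\<close>

definition square_law :: "(real \<Rightarrow> real) \<Rightarrow> real measure" where
  "square_law f = distr (density lborel (\<lambda>v. ennreal (f v))) borel (\<lambda>v. v\<^sup>2)"

lemma integral_square_law:
  fixes g :: "real \<Rightarrow> 'b :: {banach, second_countable_topology}"
  assumes [measurable]: "f \<in> borel_measurable borel" "g \<in> borel_measurable borel" and "\<And>v. 0 \<le> f v"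
  shows "integral\<^sup>L (square_law f) g = (LINT v|lborel. f v *\<^sub>R g (v\<^sup>2))"
    and "integrable (square_law f) g \<longleftrightarrow> integrable lborel (\<lambda>v. f v *\<^sub>R g (v\<^sup>2))"
  using assms(3) unfolding square_law_def
  by (simp_all add: integral_distr integral_density integrable_distr_eq integrable_density)

lemma real_distribution_square_law:
  assumes [measurable]: "f \<in> borel_measurable borel" and f0: "\<And>v. 0 \<le> f v" and f1: "(LINT v|lborel. f v) = 1"
  shows "real_distribution (square_law f)"
proof -
  \<comment> \<open>A function that is not integrable has Bochner integral 0, so the value 1 forces
    integrability. The same argument recurs for \<open>v^2 * f v\<close>.\<close>
  have "integrable lborel f" using f1 by (metis not_integrable_integral_eq zero_neq_one)
  hence "(\<integral>\<^sup>+ v. ennreal (f v) \<partial>lborel) = 1"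
    using f0 f1 by (subst nn_integral_eq_integral) auto
  hence "prob_space (density lborel (\<lambda>v. ennreal (f v)))"
    by (intro prob_spaceI) (simp add: emeasure_density)
  hence "prob_space (square_law f)" unfolding square_law_def
    by (rule prob_space.prob_space_distr) simp
  thus ?thesis by (simp add: real_distribution_def real_distribution_axioms_def square_law_def)
qed

lemma norm_char_square_law_diff:
  assumes [measurable]: "f \<in> borel_measurable borel" "a \<in> borel_measurable borel"
    and "\<And>v. 0 \<le> a v" "\<And>v. a v \<le> f v" and f: "integrable lborel f"
  shows "norm (char (square_law f) \<xi> - char (square_law a) \<xi>) \<le> (LINT v|lborel. f v - a v)"
proof -
  have f0: "0 \<le> f v" for v using assms(3,4)[of v] by linarith
  have a: "integrable lborel a"
    by (rule Bochner_Integration.integrable_bound[OF f]) (use assms f0 in auto)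
  have i: "integrable lborel (\<lambda>v. g v *\<^sub>R iexp (\<xi> * v\<^sup>2))" if "integrable lborel g" for g :: "real \<Rightarrow> real"
    by (rule Bochner_Integration.integrable_bound[OF that]) (use that in \<open>auto simp del: of_real_mult\<close>)
  have "char (square_law f) \<xi> - char (square_law a) \<xi> =
     (CLINT v|lborel. f v *\<^sub>R iexp (\<xi> * v\<^sup>2)) - (CLINT v|lborel. a v *\<^sub>R iexp (\<xi> * v\<^sup>2))"
    unfolding char_def using f0 assms(3) by (subst (1 2) integral_square_law) auto
  also have "\<dots> = (CLINT v|lborel. (f v - a v) *\<^sub>R iexp (\<xi> * v\<^sup>2))"
    unfolding scaleR_diff_left by (rule Bochner_Integration.integral_diff[symmetric]) (intro i f a)+
  also have "norm \<dots> \<le> (LINT v|lborel. norm ((f v - a v) *\<^sub>R iexp (\<xi> * v\<^sup>2)))"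
    by (rule integral_norm_bound)
  also have "\<dots> = (LINT v|lborel. f v - a v)"
    using assms by (intro Bochner_Integration.integral_cong refl) (simp del: of_real_mult)
  finally show ?thesis .
qed

text \<open>
  \<open>f\<close> is split into a part on which the law of \<open>v\<^sup>2\<close> has a bounded density and a part of mass
  \<open>h\<close>, so the frequencies with \<open>\<bar>char\<bar> > 2 * h\<close> come from the first part.
\<close>

lemma char_square_law_level:
  fixes f :: "real \<Rightarrow> real"
  assumes [measurable]: "f \<in> borel_measurable borel" and f0: "\<And>v. 0 \<le> f v"
    and f1: "(LINT v|lborel. f v) = 1" and p: "1 < p"
    and fp: "integrable lborel (\<lambda>v. f v powr p)" and A: "(LINT v|lborel. f v powr p) \<le> A" "A > 0"
    and h: "h > 0"
  shows "emeasure lborel {\<xi>. norm (char (square_law f) \<xi>) > 2 * h} \<le>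
    ennreal (8 * pi * ((2 * A / h) powr (1 / (p - 1)))\<^sup>2 / h ^ 3)"
proof -
  \<comment> \<open>\<open>l\<close> and \<open>e\<close> split the admissible loss \<open>h\<close>
    evenly: the part of \<open>f\<close> above height \<open>l\<close> has mass at most
    \<open>l powr (1 - p) * A = h / 2\<close>, and the part of height at most \<open>l\<close> on
    \<open>|v| < e\<close> has mass at most \<open>2 * e * l = h / 2\<close>.\<close>
  define l where "l = (2 * A / h) powr (1 / (p - 1))"
  define e where "e = h / (4 * l)"
  have l: "l > 0" using A h by (simp add: l_def)
  have e: "e > 0" using l h by (simp add: e_def)
  have lp: "l powr (1 - p) * A = h / 2"
  proof -
    have "l powr (1 - p) = (2 * A / h) powr (-1)"
    proof -
      have "1 / (p - 1) * (1 - p) = -1" using p by (simp add: field_simps)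
      thus ?thesis unfolding l_def powr_powr by (simp only:)
    qed
    thus ?thesis using A h by (simp add: powr_minus_divide)
  qed
  define a where "a v = (if f v \<le> l \<and> e \<le> \<bar>v\<bar> then f v else 0)" for v
  have [measurable]: "a \<in> borel_measurable borel" unfolding a_def by measurable
  have a0: "0 \<le> a v" "a v \<le> f v" "a v \<le> l" for v using f0[of v] l by (auto simp: a_def)
  have intf: "integrable lborel f" using f1 by (metis not_integrable_integral_eq zero_neq_one)
  have f1': "(\<integral>\<^sup>+ v. ennreal (f v) \<partial>lborel) = 1"
    using f0 f1 intf by (subst nn_integral_eq_integral) auto
  have mass: "(\<integral>\<^sup>+ v. ennreal (a v) \<partial>lborel) \<le> 1"
    unfolding f1'[symmetric] by (rule nn_integral_mono) (use a0 in \<open>auto intro: ennreal_leI\<close>)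
  have inta: "integrable lborel a"
    by (rule Bochner_Integration.integrable_bound[OF intf]) (use a0 f0 in auto)
  have L2: "(\<integral>\<^sup>+ \<xi>. ennreal ((norm (char (square_law a) \<xi>))\<^sup>2) \<partial>lborel) \<le> ennreal (2 * pi * l / e)"
    unfolding square_law_def by (rule nn_integral_char_square_le) (use a0 mass l e in \<open>auto simp: a_def\<close>)
  have "(LINT v|lborel. f v - a v) \<le> (LINT v|lborel. l powr (1 - p) * f v powr p + l * indicator {-e..e} v)"
  proof (rule integral_mono)
    show "f v - a v \<le> l powr (1 - p) * f v powr p + l * indicator {-e..e} v" for v
    proof (cases "f v \<le> l")
      case True
      have "f v - a v \<le> l * indicator {-e..e} v"
        using True f0[of v] l by (auto simp: a_def indicator_def)
      also have "\<dots> \<le> l powr (1 - p) * f v powr p + l * indicator {-e..e} v" by simp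
      finally show ?thesis .
    next
      case False
      have "f v - a v = f v powr (1 - p) * f v powr p"
        using False l f0[of v] by (auto simp: a_def simp flip: powr_add)
      also have "\<dots> \<le> l powr (1 - p) * f v powr p"
        using False l p by (intro mult_right_mono powr_mono2') auto
      also have "\<dots> \<le> l powr (1 - p) * f v powr p + l * indicator {-e..e} v" using l by simp
      finally show ?thesis .
    qed
    show "integrable lborel (\<lambda>v. l powr (1 - p) * f v powr p + l * indicator {-e..e} v)"
      by (intro Bochner_Integration.integrable_add integrable_mult_right fp integrable_real_indicator)
         (use e in auto)
  qed (use intf inta in auto)
  also have "\<dots> = l powr (1 - p) * (LINT v|lborel. f v powr p) + l * (2 * e)"
    using fp e by (subst Bochner_Integration.integral_add) auto
  also have "\<dots> \<le> l powr (1 - p) * A + l * (2 * e)"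
    using A by (intro add_right_mono mult_left_mono) auto
  also have "\<dots> = h" unfolding lp using l by (simp add: e_def field_simps)
  finally have diff: "(LINT v|lborel. f v - a v) \<le> h" .
  interpret F: real_distribution "square_law f"
    by (rule real_distribution_square_law) (use assms in auto)
  have fm: "finite_measure (square_law a)"
    using mass by (intro finite_measureI) (auto simp: square_law_def emeasure_distr emeasure_density top_unique)
  have [measurable]: "char (square_law a) \<in> borel_measurable borel"
  proof -
    interpret finite_measure "square_law a" by fact
    interpret pair_sigma_finite lborel "square_law a" ..
    have [measurable_cong]: "sets (square_law a) = sets borel" by (simp add: square_law_def)
    show ?thesis unfolding char_def by measurable
  qed
  have "emeasure lborel {\<xi>. norm (char (square_law f) \<xi>) > 2 * h} \<le>
    emeasure lborel ({\<xi>\<in>UNIV. 1 \<le> ennreal (1 / h\<^sup>2) * ennreal ((norm (char (square_law a) \<xi>))\<^sup>2)})"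
  proof (rule emeasure_mono)
    show "{\<xi>. norm (char (square_law f) \<xi>) > 2 * h} \<subseteq> {\<xi>\<in>UNIV. 1 \<le> ennreal (1 / h\<^sup>2) * ennreal ((norm (char (square_law a) \<xi>))\<^sup>2)}"
    proof (intro subsetI CollectI conjI UNIV_I)
      fix \<xi> assume "\<xi> \<in> {\<xi>. norm (char (square_law f) \<xi>) > 2 * h}"
      hence *: "2 * h < norm (char (square_law f) \<xi>)" by simp
      have "norm (char (square_law f) \<xi>) \<le> norm (char (square_law f) \<xi> - char (square_law a) \<xi>) + norm (char (square_law a) \<xi>)"
        by (metis diff_add_cancel norm_triangle_ineq)
      moreover have "norm (char (square_law f) \<xi> - char (square_law a) \<xi>) \<le> (LINT v|lborel. f v - a v)"
        by (rule norm_char_square_law_diff) (use a0 intf in auto)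
      ultimately have "h \<le> norm (char (square_law a) \<xi>)"
        using * diff by linarith
      hence "h\<^sup>2 \<le> (norm (char (square_law a) \<xi>))\<^sup>2" using h by (intro power_mono) auto
      hence "1 \<le> 1 / h\<^sup>2 * (norm (char (square_law a) \<xi>))\<^sup>2" using h by (simp add: field_simps)
      thus "1 \<le> ennreal (1 / h\<^sup>2) * ennreal ((norm (char (square_law a) \<xi>))\<^sup>2)"
        by (simp flip: ennreal_mult)
    qed
  qed measurable
  \<comment> \<open>Markov's inequality for the square of the truncated transform at height
    \<open>h^2\<close>, to which the one-sided Plancherel bound is then applied.\<close>
  also have "\<dots> \<le> ennreal (1 / h\<^sup>2) * (\<integral>\<^sup>+ \<xi>. ennreal ((norm (char (square_law a) \<xi>))\<^sup>2) * indicator UNIV \<xi> \<partial>lborel)"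
    by (rule nn_integral_Markov_inequality) auto
  also have "\<dots> \<le> ennreal (1 / h\<^sup>2) * ennreal (2 * pi * l / e)"
    using L2 by (intro mult_left_mono) auto
  also have "\<dots> = ennreal (8 * pi * l\<^sup>2 / h ^ 3)"
    using h l by (simp flip: ennreal_mult add: e_def power2_eq_square power3_eq_cube field_simps)
  finally show ?thesis by (simp add: l_def)
qed

section \<open>A uniform gap for the characteristic function\<close>

text \<open>A weak \<open>L^\<alpha>\<close> bound on the characteristic function. In this form the
  exponent \<open>p\<close> and the norm of \<open>f\<close> enter the local limit theorem.\<close>

definition char_level_bound :: "real \<Rightarrow> real \<Rightarrow> real measure \<Rightarrow> bool" where
  "char_level_bound W \<alpha> \<mu> \<longleftrightarrow>
     (\<forall>h. 0 < h \<longrightarrow> h \<le> 1 \<longrightarrow> emeasure lborel {\<xi>. norm (char \<mu> \<xi>) > h} \<le> ennreal (W * h powr (- \<alpha>)))"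

text \<open>A weak bound of order \<alpha> gives integrability of every power \<open>s\<close> above
  \<alpha>: between the heights \<open>(1/2) ^ Suc k\<close> and \<open>(1/2) ^ k\<close> the
  integrand is at most \<open>(1/2) ^ (k * s)\<close>, and the measures of these layers leave a
  geometric series of ratio \<open>2 powr (\<alpha> - s)\<close>.\<close>

lemma nn_integral_char_power:
  assumes "real_distribution \<mu>" and lev: "char_level_bound W \<alpha> \<mu>" and W: "0 \<le> W"
    and \<alpha>: "0 < \<alpha>" "\<alpha> < real s"
  shows "(\<integral>\<^sup>+ \<xi>. ennreal (norm (char \<mu> \<xi>) ^ s) \<partial>lborel) \<le> ennreal (W * 2 powr \<alpha> / (1 - 2 powr (\<alpha> - s)))"
proof -
  interpret real_distribution \<mu> by fact
  let ?x = "\<lambda>\<xi>. norm (char \<mu> \<xi>)"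
  have [measurable]: "char \<mu> \<in> borel_measurable borel" by (rule char_measurable)
  define E where "E k = {\<xi>. ?x \<xi> > (1/2) ^ Suc k}" for k
  have [measurable]: "E k \<in> sets borel" for k unfolding E_def by measurable
  have pt: "ennreal (?x \<xi> ^ s) \<le> (\<Sum>k. ennreal ((1/2) ^ (k * s)) * indicator (E k) \<xi>)" for \<xi>
  proof (cases "?x \<xi> = 0")
    case True
    then show ?thesis using \<alpha> by (simp add: power_0_left)
  next
    case False
    hence pos: "?x \<xi> > 0" by simp
    obtain n where "(1/2::real) ^ n < ?x \<xi>"
      using real_arch_pow_inv[OF pos, of "1/2"] by auto
    moreover have "(1/2::real) ^ Suc n \<le> (1/2) ^ n" by (rule power_decreasing) auto
    ultimately have "\<exists>k. (1/2::real) ^ Suc k < ?x \<xi>" by (meson le_less_trans)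
    then obtain k where k: "(1/2::real) ^ Suc k < ?x \<xi>" "\<And>j. j < k \<Longrightarrow> \<not> (1/2::real) ^ Suc j < ?x \<xi>"
      using exists_least_iff[of "\<lambda>k. (1/2::real) ^ Suc k < ?x \<xi>"] by blast
    have "?x \<xi> \<le> (1/2) ^ k"
    proof (cases k)
      case 0 thus ?thesis using cmod_char_le_1[of \<xi>] by simp
    next
      case (Suc j) thus ?thesis using k(2)[of j] by simp
    qed
    hence "?x \<xi> ^ s \<le> ((1/2) ^ k) ^ s" by (rule power_mono) simp
    hence "ennreal (?x \<xi> ^ s) \<le> ennreal ((1/2) ^ (k * s)) * indicator (E k) \<xi>"
      using k(1) by (simp add: E_def power_mult[symmetric] ennreal_leI)
    also have "\<dots> = (\<Sum>k\<in>{k}. ennreal ((1/2) ^ (k * s)) * indicator (E k) \<xi>)"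
      by (simp only: sum.insert sum.empty finite.emptyI empty_iff not_False_eq_True add_0_right)
    also have "\<dots> \<le> (\<Sum>k. ennreal ((1/2) ^ (k * s)) * indicator (E k) \<xi>)"
      by (rule sum_le_suminf) auto
    finally show ?thesis .
  qed
  define q where "q = (2::real) powr (\<alpha> - s)"
  have q: "0 < q" "q < 1"
    using \<alpha> powr_less_mono[of "\<alpha> - s" 0 2] by (auto simp: q_def)
  have "(\<integral>\<^sup>+ \<xi>. ennreal (?x \<xi> ^ s) \<partial>lborel) \<le> (\<integral>\<^sup>+ \<xi>. (\<Sum>k. ennreal ((1/2) ^ (k * s)) * indicator (E k) \<xi>) \<partial>lborel)"
    by (rule nn_integral_mono) (rule pt)
  also have "\<dots> = (\<Sum>k. (\<integral>\<^sup>+ \<xi>. ennreal ((1/2) ^ (k * s)) * indicator (E k) \<xi> \<partial>lborel))"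
    by (rule nn_integral_suminf) measurable
  also have "\<dots> \<le> (\<Sum>k. ennreal (W * 2 powr \<alpha> * q ^ k))"
  proof (rule suminf_le)
    fix k
    have "(\<integral>\<^sup>+ \<xi>. ennreal ((1/2) ^ (k * s)) * indicator (E k) \<xi> \<partial>lborel) = ennreal ((1/2) ^ (k * s)) * emeasure lborel (E k)"
      by (subst nn_integral_cmult_indicator) auto
    also have "\<dots> \<le> ennreal ((1/2) ^ (k * s)) * ennreal (W * ((1/2) ^ Suc k) powr (- \<alpha>))"
      using lev unfolding char_level_bound_def E_def
      by (intro mult_left_mono) (auto simp: power_le_one simp del: power_Suc)
    also have "\<dots> = ennreal (W * 2 powr \<alpha> * q ^ k)"
    proof -
      have "((1/2::real) ^ Suc k) powr (- \<alpha>) = 2 powr \<alpha> * 2 powr (\<alpha> * k)"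
      proof -
        have "(1/2::real) ^ Suc k = 2 powr (- real (Suc k))"
          by (simp add: powr_minus powr_realpow power_one_over inverse_eq_divide del: power_Suc of_nat_Suc)
        hence "((1/2::real) ^ Suc k) powr (- \<alpha>) = 2 powr (\<alpha> + \<alpha> * k)"
          by (simp add: powr_powr algebra_simps)
        thus ?thesis by (simp add: powr_add)
      qed
      moreover have "(1/2::real) ^ (k * s) = 2 powr (- (real s * k))"
        by (simp add: powr_minus powr_realpow[symmetric] power_one_over inverse_eq_divide mult.commute)
      moreover have "q ^ k = 2 powr (\<alpha> * k) * 2 powr (- (real s * k))"
        by (simp add: q_def powr_realpow[symmetric] powr_powr powr_add[symmetric] algebra_simps)
      ultimately show ?thesis using W by (simp flip: ennreal_mult add: mult_ac)
    qed
    finally show "(\<integral>\<^sup>+ \<xi>. ennreal ((1/2) ^ (k * s)) * indicator (E k) \<xi> \<partial>lborel) \<le> ennreal (W * 2 powr \<alpha> * q ^ k)" .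
  qed auto
  also have "\<dots> = ennreal (W * 2 powr \<alpha> * (1 / (1 - q)))"
    using q W by (intro suminf_ennreal_eq sums_mult geometric_sums) auto
  finally show ?thesis by (simp add: q_def)
qed

section \<open>The defect of the characteristic function\<close>

lemma one_minus_cos_eq: "1 - cos z = 2 * (sin (z / 2))\<^sup>2" for z :: real
  using cos_double_sin[of "z / 2"] by simp

lemma abs_sin_mult_le: "\<bar>sin (real n * z)\<bar> \<le> real n * \<bar>sin z\<bar>"
proof (induction n)
  case (Suc n)
  have "\<bar>sin (real (Suc n) * z)\<bar> = \<bar>sin (real n * z) * cos z + cos (real n * z) * sin z\<bar>"
    using sin_add[of "real n * z" z] by (simp add: algebra_simps)
  also have "\<dots> \<le> \<bar>sin (real n * z)\<bar> * \<bar>cos z\<bar> + \<bar>cos (real n * z)\<bar> * \<bar>sin z\<bar>"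
    by (metis abs_mult abs_triangle_ineq)
  also have "\<dots> \<le> \<bar>sin (real n * z)\<bar> * 1 + 1 * \<bar>sin z\<bar>"
    by (intro add_mono mult_left_mono mult_right_mono) auto
  also have "\<dots> \<le> real (Suc n) * \<bar>sin z\<bar>" using Suc by (simp add: distrib_right)
  finally show ?case .
qed simp

lemma one_minus_cos_mult_le: "1 - cos (real n * z) \<le> (real n)\<^sup>2 * (1 - cos z)"
proof -
  have "(sin (real n * (z / 2)))\<^sup>2 \<le> (real n * \<bar>sin (z / 2)\<bar>)\<^sup>2"
    using abs_sin_mult_le[of n "z / 2"] by (metis abs_ge_zero power2_abs power_mono)
  thus ?thesis by (simp add: one_minus_cos_eq power_mult_distrib)
qed

lemma one_minus_cos_add_le: "1 - cos (x + y) \<le> 2 * (1 - cos x) + 2 * (1 - cos y)" for x y :: real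
proof -
  let ?a = "x / 2" and ?b = "y / 2"
  have "\<bar>sin (?a + ?b)\<bar> \<le> \<bar>sin ?a * cos ?b\<bar> + \<bar>cos ?a * sin ?b\<bar>"
    unfolding sin_add by (rule abs_triangle_ineq)
  also have "\<dots> \<le> \<bar>sin ?a\<bar> * 1 + 1 * \<bar>sin ?b\<bar>"
    unfolding abs_mult by (intro add_mono mult_left_mono mult_right_mono) auto
  finally have "(sin (?a + ?b))\<^sup>2 \<le> (\<bar>sin ?a\<bar> + \<bar>sin ?b\<bar>)\<^sup>2"
    by (metis abs_ge_zero mult.right_neutral mult_1 power2_abs power_mono)
  also have "\<dots> \<le> 2 * (sin ?a)\<^sup>2 + 2 * (sin ?b)\<^sup>2"
    using zero_le_power2[of "\<bar>sin ?a\<bar> - \<bar>sin ?b\<bar>"] by (simp add: power2_eq_square algebra_simps)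
  finally show ?thesis by (simp add: one_minus_cos_eq add_divide_distrib)
qed

lemma one_minus_cos_le: "1 - cos z \<le> z\<^sup>2 / 2" for z :: real
proof -
  have "(sin (z / 2))\<^sup>2 \<le> (z / 2)\<^sup>2"
    using abs_sin_le_one abs_sin_x_le_abs_x[of "z / 2"] by (metis abs_ge_zero power2_abs power_mono)
  thus ?thesis by (simp add: one_minus_cos_eq power_divide)
qed

context real_distribution
begin

text \<open>As an average of \<open>1 - cos\<close>, the defect inherits every pointwise inequality
  for \<open>1 - cos\<close>: quadratic growth along integer multiples, and near-subadditivity in
  the frequency.\<close>

lemma char_defect_eq:
  "1 - (norm (char M \<xi>))\<^sup>2 = (LINT z|(M \<Otimes>\<^sub>M M). 1 - cos (\<xi> * (fst z - snd z)))"
  and char_defect_integrable: "integrable (M \<Otimes>\<^sub>M M) (\<lambda>z. 1 - cos (\<xi> * (fst z - snd z)))"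
proof -
  interpret P: prob_space "M \<Otimes>\<^sub>M M"
    by (rule prob_space_pair) unfold_locales
  have fm: "finite_measure M" by unfold_locales
  have [simp]: "sets M = sets borel" by simp
  have m: "(\<lambda>z. cos (\<xi> * (fst z - snd z))) \<in> borel_measurable (M \<Otimes>\<^sub>M M)" by measurable
  have i: "integrable (M \<Otimes>\<^sub>M M) (\<lambda>z. cos (\<xi> * (fst z - snd z)))"
    by (rule P.integrable_const_bound[of _ 1]) (use m in auto)
  have "Re (complex_of_real ((norm (char M \<xi>))\<^sup>2)) = (LINT z|(M \<Otimes>\<^sub>M M). Re (iexp (\<xi> * (fst z - snd z))))"
    unfolding char_norm_square(1)[OF fm \<open>sets M = sets borel\<close>]
    by (rule integral_Re[symmetric]) (rule char_norm_square(2)[OF fm \<open>sets M = sets borel\<close>])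
  also have "\<dots> = (LINT z|(M \<Otimes>\<^sub>M M). cos (\<xi> * (fst z - snd z)))"
    by (intro Bochner_Integration.integral_cong refl) (simp add: Re_exp)
  finally show "1 - (norm (char M \<xi>))\<^sup>2 = (LINT z|(M \<Otimes>\<^sub>M M). 1 - cos (\<xi> * (fst z - snd z)))"
    using i by (simp only: Re_complex_of_real) (simp add: P.prob_space)
  show "integrable (M \<Otimes>\<^sub>M M) (\<lambda>z. 1 - cos (\<xi> * (fst z - snd z)))"
    using i by simp
qed

lemma char_defect_mult_le:
  "1 - (norm (char M (real n * \<xi>)))\<^sup>2 \<le> (real n)\<^sup>2 * (1 - (norm (char M \<xi>))\<^sup>2)"
  unfolding char_defect_eq integral_mult_right_zero[symmetric]
  by (intro integral_mono integrable_mult_right char_defect_integrable)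
     (use one_minus_cos_mult_le in \<open>auto simp: mult.assoc\<close>)

lemma char_defect_add_le:
  "1 - (norm (char M (\<xi> + \<eta>)))\<^sup>2 \<le> 2 * (1 - (norm (char M \<xi>))\<^sup>2) + 2 * (1 - (norm (char M \<eta>))\<^sup>2)"
  unfolding char_defect_eq integral_mult_right_zero[symmetric]
  by (subst Bochner_Integration.integral_add[symmetric],
      (intro integrable_mult_right char_defect_integrable)+,
      intro integral_mono Bochner_Integration.integrable_add integrable_mult_right char_defect_integrable)
     (use one_minus_cos_add_le in \<open>auto simp: distrib_right\<close>)

text \<open>\<open>|char|\<close> is at least its real part, which is at least
  \<open>1 - B * \<xi>^2 / 2\<close>; passing to the square costs a factor 2. This keeps the
  characteristic function large on an interval whose length depends on \<open>B\<close>
  alone.\<close>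

lemma char_defect_le_square:
  assumes "integrable M (\<lambda>x. x\<^sup>2)" "expectation (\<lambda>x. x\<^sup>2) \<le> B"
  shows "1 - (norm (char M \<xi>))\<^sup>2 \<le> B * \<xi>\<^sup>2"
proof -
  have i: "integrable M (\<lambda>x. iexp (\<xi> * x))"
    by (rule integrable_const_bound[of _ 1]) auto
  have ic: "integrable M (\<lambda>x. cos (\<xi> * x))"
    by (rule integrable_const_bound[of _ 1]) auto
  have "Re (char M \<xi>) = expectation (\<lambda>x. Re (iexp (\<xi> * x)))"
    unfolding char_def by (rule integral_Re[symmetric, OF i])
  also have "\<dots> = expectation (\<lambda>x. cos (\<xi> * x))"
    by (intro Bochner_Integration.integral_cong refl) (simp add: Re_exp)
  finally have "1 - Re (char M \<xi>) = expectation (\<lambda>x. 1 - cos (\<xi> * x))"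
    using ic prob_space by simp
  also have "\<dots> \<le> expectation (\<lambda>x. \<xi>\<^sup>2 / 2 * x\<^sup>2)"
    using one_minus_cos_le[of "\<xi> * x" for x] assms(1) ic
    by (intro integral_mono) (auto simp: power_mult_distrib)
  also have "\<dots> \<le> \<xi>\<^sup>2 / 2 * B" using assms by (simp add: mult_left_mono)
  finally have 1: "1 - Re (char M \<xi>) \<le> \<xi>\<^sup>2 / 2 * B" .
  let ?n = "norm (char M \<xi>)"
  have "1 - ?n\<^sup>2 = (1 - ?n) * (1 + ?n)" by (simp add: power2_eq_square algebra_simps)
  also have "\<dots> \<le> (1 - ?n) * 2"
    using cmod_char_le_1[of \<xi>] by (intro mult_left_mono) auto
  also have "\<dots> \<le> 2 * (1 - Re (char M \<xi>))"
    using complex_Re_le_cmod[of "char M \<xi>"] by simp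
  finally show ?thesis using 1 by (simp add: mult.commute)
qed

text \<open>
  If \<open>\<bar>char\<bar>\<close> were close to \<open>1\<close> at \<open>\<xi>\<close>, it would stay above \<open>1 / 2\<close> near every multiple
  \<open>n * \<xi>\<close> with \<open>n \<le> m\<close>, and these intervals have too large a total length.
\<close>

lemma char_defect_far:
  assumes B: "integrable M (\<lambda>x. x\<^sup>2)" "expectation (\<lambda>x. x\<^sup>2) \<le> B" "B > 0"
    and \<tau>: "\<tau> > 0" "8 * B * \<tau>\<^sup>2 = 1" and W: "W \<ge> 0"
    and lev: "emeasure lborel {\<xi>. norm (char M \<xi>) > 1 / 2} \<le> ennreal W"
    and m: "W < 2 * \<tau> * real m" "m > 0" and \<xi>: "2 * \<tau> \<le> \<xi>"
  shows "1 / (4 * (real m)\<^sup>2) \<le> 1 - (norm (char M \<xi>))\<^sup>2"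
proof (rule ccontr)
  assume "\<not> ?thesis"
  hence small: "1 - (norm (char M \<xi>))\<^sup>2 < 1 / (4 * (real m)\<^sup>2)" by simp
  define J where "J n = {real n * \<xi> - \<tau><..<real n * \<xi> + \<tau>}" for n
  have disj: "disjoint_family_on J {1..m}"
  proof -
    have aux: "J i \<inter> J j = {}" if "i < j" for i j
    proof -
      have "real i + 1 \<le> real j" using that by linarith
      hence "(real i + 1) * \<xi> \<le> real j * \<xi>" using \<xi> \<tau> by (intro mult_right_mono) auto
      hence "real i * \<xi> + \<tau> \<le> real j * \<xi> - \<tau>" using \<xi> by (simp add: distrib_right)
      thus ?thesis by (auto simp: J_def)
    qed
    have "J i \<inter> J j = {}" if "i \<noteq> j" for i j
      using aux[of i j] aux[of j i] that by (cases "i < j") (auto simp: Int_commute)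
    thus ?thesis by (auto simp: disjoint_family_on_def)
  qed
  have sub: "(\<Union>n\<in>{1..m}. J n) \<subseteq> {\<xi>. norm (char M \<xi>) > 1 / 2}"
  proof safe
    fix n \<zeta> assume n: "n \<in> {1..m}" and z: "\<zeta> \<in> J n"
    define y where "y = \<zeta> - real n * \<xi>"
    have y: "\<bar>y\<bar> \<le> \<tau>" using z by (auto simp: J_def y_def)
    have "1 - (norm (char M (real n * \<xi>)))\<^sup>2 \<le> (real n)\<^sup>2 * (1 - (norm (char M \<xi>))\<^sup>2)"
      by (rule char_defect_mult_le)
    also have "\<dots> \<le> (real m)\<^sup>2 * (1 - (norm (char M \<xi>))\<^sup>2)"
    proof (rule mult_right_mono)
      show "0 \<le> 1 - (norm (char M \<xi>))\<^sup>2" using cmod_char_le_1[of \<xi>] by (simp add: power_le_one)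
    qed (use n in \<open>auto intro!: power_mono\<close>)
    also have "\<dots> < (real m)\<^sup>2 * (1 / (4 * (real m)\<^sup>2))"
      using small m by (intro mult_strict_left_mono) auto
    also have "\<dots> = 1 / 4" using m by simp
    finally have 1: "1 - (norm (char M (real n * \<xi>)))\<^sup>2 < 1 / 4" .
    have "1 - (norm (char M y))\<^sup>2 \<le> B * y\<^sup>2" by (rule char_defect_le_square) fact+
    also have "\<dots> \<le> B * \<tau>\<^sup>2"
      using B y by (intro mult_left_mono) (auto intro: abs_le_square_iff[THEN iffD1] simp: abs_of_pos[OF \<tau>(1)])
    also have "\<dots> = 1 / 8" using \<tau> by simp
    finally have 2: "1 - (norm (char M y))\<^sup>2 \<le> 1 / 8" .
    \<comment> \<open>The numbers fit together here: \<open>2 * (1/4) + 2 * (1/8) = 3/4\<close> is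
      the defect at which the modulus is \<open>1/2\<close>. This is the origin of the constants in
      \<open>4 * m^2\<close> and in \<open>8 * B * \<tau>^2 = 1\<close>.\<close>
    have "\<zeta> = real n * \<xi> + y" by (simp add: y_def)
    hence "1 - (norm (char M \<zeta>))\<^sup>2 < 3 / 4"
      using char_defect_add_le[of "real n * \<xi>" y] 1 2 by simp
    hence "(1 / 2)\<^sup>2 < (norm (char M \<zeta>))\<^sup>2" by (simp add: power2_eq_square)
    thus "norm (char M \<zeta>) > 1 / 2" by (rule power_less_imp_less_base) simp
  qed
  have [measurable]: "char M \<in> borel_measurable borel" by (rule char_measurable)
  have "ennreal (2 * \<tau> * real m) = (\<Sum>n\<in>{1..m}. ennreal (2 * \<tau>))"
    using \<tau> by (simp add: ennreal_mult ennreal_of_nat_eq_real_of_nat mult.commute)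
  also have "\<dots> = (\<Sum>n\<in>{1..m}. emeasure lborel (J n))"
    using \<tau> by (intro sum.cong) (auto simp: J_def)
  also have "\<dots> = emeasure lborel (\<Union>n\<in>{1..m}. J n)"
    by (rule sum_emeasure[OF _ disj]) (auto simp: J_def)
  also have "\<dots> \<le> emeasure lborel {\<xi>. norm (char M \<xi>) > 1 / 2}"
    by (rule emeasure_mono[OF sub]) measurable
  also have "\<dots> \<le> ennreal W" by (rule lev)
  finally show False using m W by simp
qed

text \<open>Some multiple \<open>n * \<xi>\<close> with \<open>n <= 4 * \<tau> / \<xi>\<close> lies
  beyond \<open>2 * \<tau>\<close>, where the defect is at least \<kappa>. Multiplying the frequency
  by \<open>n\<close> raises the defect at most by \<open>n^2\<close>, so it was already of order
  \<open>\<xi>^2\<close> at \<xi>. In this way a bound on superlevel sets contains a lower bound on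
  the variance.\<close>

lemma char_defect_near:
  assumes far: "\<And>\<xi>. 2 * \<tau> \<le> \<xi> \<Longrightarrow> \<kappa> \<le> 1 - (norm (char M \<xi>))\<^sup>2" and "\<tau> > 0" "\<kappa> > 0"
    and \<xi>: "0 < \<xi>" "\<xi> \<le> 2 * \<tau>"
  shows "\<kappa> / (16 * \<tau>\<^sup>2) * \<xi>\<^sup>2 \<le> 1 - (norm (char M \<xi>))\<^sup>2"
proof -
  define n where "n = nat \<lceil>2 * \<tau> / \<xi>\<rceil>"
  have n: "2 * \<tau> / \<xi> \<le> real n" "real n \<le> 2 * \<tau> / \<xi> + 1"
    using \<xi> \<open>\<tau> > 0\<close> by (auto simp: n_def of_nat_nat less_imp_le intro!: real_nat_ceiling_ge)
  have "real n \<le> 4 * \<tau> / \<xi>" using n \<xi> by (simp add: field_simps)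
  hence "(real n)\<^sup>2 \<le> (4 * \<tau> / \<xi>)\<^sup>2" by (intro power_mono) auto
  have n1: "real n > 0" using n(1) \<xi> \<open>\<tau> > 0\<close> by (meson divide_pos_pos less_le_trans mult_pos_pos zero_less_numeral)
  have "2 * \<tau> \<le> real n * \<xi>" using n \<xi> by (simp add: field_simps)
  from far[OF this] have "\<kappa> \<le> (real n)\<^sup>2 * (1 - (norm (char M \<xi>))\<^sup>2)"
    using char_defect_mult_le[of n \<xi>] by linarith
  also have "\<dots> \<le> (4 * \<tau> / \<xi>)\<^sup>2 * (1 - (norm (char M \<xi>))\<^sup>2)"
    using \<open>(real n)\<^sup>2 \<le> (4 * \<tau> / \<xi>)\<^sup>2\<close> cmod_char_le_1[of \<xi>]
    by (intro mult_right_mono) (auto simp: power_le_one)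
  finally show ?thesis using \<xi> \<open>\<tau> > 0\<close> by (simp add: power_divide power_mult_distrib field_simps)
qed

lemma norm_char_minus: "norm (char M (- \<xi>)) = norm (char M \<xi>)"
proof -
  have "char M (- \<xi>) = (CLINT x|M. cnj (iexp (\<xi> * x)))"
    unfolding char_def by (intro Bochner_Integration.integral_cong refl) (simp add: exp_cnj)
  also have "\<dots> = cnj (char M \<xi>)"
    unfolding char_def by (rule Bochner_Integration.integral_cnj)
  finally show ?thesis by simp
qed

end

text \<open>The point is the order of quantifiers: \<tau>, \<kappa> and \<open>c\<close> are found
  from \<open>W\<close> and \<open>B\<close> before the distribution is given.\<close>

lemma char_gap:
  fixes W B :: real
  assumes "W \<ge> 0" "B > 0"
  obtains \<tau> \<kappa> c :: real where "0 < \<tau>" "0 < \<kappa>" "\<kappa> < 1" "0 < c"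
    "\<And>M \<xi>. real_distribution M \<Longrightarrow> integrable M (\<lambda>x. x\<^sup>2) \<Longrightarrow> (LINT x|M. x\<^sup>2) \<le> B \<Longrightarrow>
      emeasure lborel {\<xi>. norm (char M \<xi>) > 1 / 2} \<le> ennreal W \<Longrightarrow> \<bar>\<xi>\<bar> \<le> 2 * \<tau> \<Longrightarrow>
      (norm (char M \<xi>))\<^sup>2 \<le> 1 - c * \<xi>\<^sup>2"
    "\<And>M \<xi>. real_distribution M \<Longrightarrow> integrable M (\<lambda>x. x\<^sup>2) \<Longrightarrow> (LINT x|M. x\<^sup>2) \<le> B \<Longrightarrow>
      emeasure lborel {\<xi>. norm (char M \<xi>) > 1 / 2} \<le> ennreal W \<Longrightarrow> 2 * \<tau> \<le> \<bar>\<xi>\<bar> \<Longrightarrow>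
      (norm (char M \<xi>))\<^sup>2 \<le> 1 - \<kappa>"
proof -
  define \<tau> where "\<tau> = 1 / sqrt (8 * B)"
  have \<tau>: "\<tau> > 0" "8 * B * \<tau>\<^sup>2 = 1" using \<open>B > 0\<close> by (auto simp: \<tau>_def power_divide)
  \<comment> \<open>Enough disjoint intervals of length \<open>2 * \<tau>\<close> for their total
    length to exceed \<open>W\<close>.\<close>
  define m where "m = nat \<lceil>W / (2 * \<tau>)\<rceil> + 1"
  have "W / (2 * \<tau>) < real m"
    using \<tau> \<open>W \<ge> 0\<close> unfolding m_def by (metis add.commute le_less_trans less_add_one of_nat_1 of_nat_add real_nat_ceiling_ge)
  hence m: "W < 2 * \<tau> * real m" "m > 0" using \<tau> by (auto simp: field_simps m_def)
  define \<kappa> where "\<kappa> = 1 / (4 * (real m)\<^sup>2)"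
  have "(real m)\<^sup>2 \<ge> 1" using m by (simp add: one_le_power)
  hence "4 * (real m)\<^sup>2 > 1" by linarith
  hence \<kappa>: "0 < \<kappa>" "\<kappa> < 1"
    unfolding \<kappa>_def by (simp_all only: zero_less_divide_1_iff divide_less_eq_1_pos)
  have far: "\<kappa> \<le> 1 - (norm (char M \<xi>))\<^sup>2"
    if M: "real_distribution M" "integrable M (\<lambda>x. x\<^sup>2)" "(LINT x|M. x\<^sup>2) \<le> B"
      "emeasure lborel {\<xi>. norm (char M \<xi>) > 1 / 2} \<le> ennreal W" and "2 * \<tau> \<le> \<xi>" for M \<xi>
    unfolding \<kappa>_def
    by (rule real_distribution.char_defect_far[OF M(1-3) \<open>B > 0\<close> \<tau> \<open>W \<ge> 0\<close> M(4) m]) fact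
  show thesis
  proof (rule that[of \<tau> \<kappa> "\<kappa> / (16 * \<tau>\<^sup>2)"])
    fix M \<xi>
    assume M: "real_distribution M" "integrable M (\<lambda>x. x\<^sup>2)" "(LINT x|M. x\<^sup>2) \<le> B"
      "emeasure lborel {\<xi>. norm (char M \<xi>) > 1 / 2} \<le> ennreal W"
    interpret real_distribution M by fact
    have ab: "norm (char M \<bar>\<xi>\<bar>) = norm (char M \<xi>)"
      using norm_char_minus[of \<xi>] by (cases "0 \<le> \<xi>") auto
    show "(norm (char M \<xi>))\<^sup>2 \<le> 1 - \<kappa> / (16 * \<tau>\<^sup>2) * \<xi>\<^sup>2" if "\<bar>\<xi>\<bar> \<le> 2 * \<tau>"
    proof (cases "\<xi> = 0")
      case True
      thus ?thesis using cmod_char_le_1[of 0] by (simp add: power_le_one)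
    next
      case False
      thus ?thesis using char_defect_near[OF far[OF M] \<tau>(1) \<kappa>(1), of "\<bar>\<xi>\<bar>"] that ab by simp
    qed
    show "(norm (char M \<xi>))\<^sup>2 \<le> 1 - \<kappa>" if "2 * \<tau> \<le> \<bar>\<xi>\<bar>"
      using far[OF M that] ab by simp
  qed (use \<tau> \<kappa> in auto)
qed

section \<open>Local limit bounds\<close>

lemma gaussian_abs_moment:
  fixes a :: real
  assumes "a > 0"
  shows "integrable lborel (\<lambda>x::real. \<bar>x\<bar> * exp (- (a * x\<^sup>2)))"
    and "(LINT x::real|lborel. \<bar>x\<bar> * exp (- (a * x\<^sup>2))) = 1 / a"
proof -
  have "(\<integral>\<^sup>+ x. ennreal (\<bar>x::real\<bar> * exp (- (a * x\<^sup>2))) \<partial>lborel) =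
      (\<integral>\<^sup>+ x. ennreal \<bar>x\<bar> * ennreal (exp (- (a * x\<^sup>2))) \<partial>lborel)"
    by (simp add: ennreal_mult)
  also have "\<dots> = (\<integral>\<^sup>+ t. indicator {0<..} t * ennreal (exp (- (a * t))) \<partial>lborel)"
    by (rule nn_integral_abs_square) measurable
  also have "\<dots> = (\<integral>\<^sup>+ t. ennreal (exp (- (a * t))) * indicator {0..} t \<partial>lborel)"
    using AE_lborel_singleton[of "0::real"]
    by (intro nn_integral_cong_AE) (auto simp: indicator_def)
  also have "\<dots> = ennreal (0 - (- exp (- (a * 0)) / a))"
  proof (rule nn_integral_FTC_atLeast[where F = "\<lambda>t. - exp (- (a * t)) / a"])
    show "((\<lambda>t. - exp (- (a * t)) / a) has_real_derivative exp (- (a * x))) (at x)" for x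
      using assms by (auto intro!: derivative_eq_intros)
    have "filterlim (\<lambda>t. a * t) at_top at_top"
      by (rule filterlim_tendsto_pos_mult_at_top[OF tendsto_const assms filterlim_ident])
    hence "((\<lambda>t. exp (- (a * t))) \<longlongrightarrow> 0) at_top"
      by (intro filterlim_compose[OF exp_at_bot]) (simp add: filterlim_uminus_at_bot)
    from tendsto_divide[OF tendsto_minus[OF this] tendsto_const, of a]
    show "((\<lambda>t. - exp (- (a * t)) / a) \<longlongrightarrow> 0) at_top" using assms by simp
  qed auto
  finally have nn: "(\<integral>\<^sup>+ x. ennreal (\<bar>x::real\<bar> * exp (- (a * x\<^sup>2))) \<partial>lborel) = ennreal (1 / a)" by simp
  show "integrable lborel (\<lambda>x::real. \<bar>x\<bar> * exp (- (a * x\<^sup>2)))"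
    by (rule integrableI_nonneg) (auto simp: nn)
  show "(LINT x::real|lborel. \<bar>x\<bar> * exp (- (a * x\<^sup>2))) = 1 / a"
    using assms by (subst integral_eq_nn_integral) (auto simp: nn)
qed

text \<open>For powers of a characteristic function the inversion integral is real by conjugate
  symmetry; taking \<open>Re\<close> provides a real-valued density candidate without invoking
  this.\<close>

definition fourier_inv :: "(real \<Rightarrow> complex) \<Rightarrow> real \<Rightarrow> real" where
  "fourier_inv \<phi> t = Re (CLINT \<xi>|lborel. \<phi> \<xi> * iexp (- (\<xi> * t))) / (2 * pi)"

lemma norm_iexp_minus_one_le: "norm (iexp x - 1) \<le> \<bar>x\<bar>"
  using iexp_approx1[of x 0] by simp

text \<open>The Taylor remainder of a characteristic function is controlled by this minimum, whose
  cubic branch alone would ask for a third moment. Interpolating between the branches, according to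
  whether \<open>|t * x|\<close> exceeds 1, makes a moment of order \<open>2 + \<delta>\<close>
  sufficient.\<close>

lemma min_cube_le_powr:
  fixes t x \<delta> :: real
  assumes "0 < \<delta>" "\<delta> \<le> 1"
  shows "min (6 * x\<^sup>2) (\<bar>t\<bar> * \<bar>x\<bar> ^ 3) \<le> 6 * \<bar>t\<bar> powr \<delta> * \<bar>x\<bar> powr (2 + \<delta>)"
proof (cases "x = 0 \<or> t = 0")
  case False
  hence x: "\<bar>x\<bar> powr (2 + \<delta>) = x\<^sup>2 * \<bar>x\<bar> powr \<delta>" by (simp add: powr_add)
  hence e: "6 * \<bar>t\<bar> powr \<delta> * \<bar>x\<bar> powr (2 + \<delta>) = 6 * (x\<^sup>2 * \<bar>t * x\<bar> powr \<delta>)"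
    by (simp add: abs_mult powr_mult)
  show ?thesis
  proof (cases "\<bar>t * x\<bar> \<le> 1")
    case True
    have "\<bar>t\<bar> * \<bar>x\<bar> ^ 3 = x\<^sup>2 * \<bar>t * x\<bar>"
      by (simp add: abs_mult power2_eq_square power3_eq_cube)
    also have "\<bar>t * x\<bar> = \<bar>t * x\<bar> powr 1" by simp
    also have "x\<^sup>2 * \<bar>t * x\<bar> powr 1 \<le> x\<^sup>2 * \<bar>t * x\<bar> powr \<delta>"
      using True False assms by (intro mult_left_mono powr_mono') auto
    also have "\<dots> \<le> 6 * (x\<^sup>2 * \<bar>t * x\<bar> powr \<delta>)" by simp
    finally show ?thesis unfolding e by simp
  next
    case False
    hence "1 \<le> \<bar>t * x\<bar> powr \<delta>" using assms by (intro ge_one_powr_ge_zero) auto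
    hence "6 * (x\<^sup>2 * 1) \<le> 6 * (x\<^sup>2 * \<bar>t * x\<bar> powr \<delta>)" by (intro mult_left_mono) auto
    thus ?thesis unfolding e by simp
  qed
qed auto

lemma centred_powr_le:
  fixes x \<delta> :: real
  assumes "0 < \<delta>" "\<delta> \<le> 1"
  shows "\<bar>x - 1\<bar> powr (2 + \<delta>) \<le> 8 * (\<bar>x\<bar> powr (2 + \<delta>) + 1)"
proof -
  define m where "m = max \<bar>x\<bar> 1"
  have "\<bar>x - 1\<bar> powr (2 + \<delta>) \<le> (2 * m) powr (2 + \<delta>)"
    using assms by (intro powr_mono2) (auto simp: m_def)
  also have "\<dots> = 2 powr (2 + \<delta>) * m powr (2 + \<delta>)"
    by (simp add: powr_mult m_def)
  also have "\<dots> \<le> 2 powr 3 * (\<bar>x\<bar> powr (2 + \<delta>) + 1)"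
    using assms by (intro mult_mono powr_mono) (auto simp: m_def max_def)
  finally show ?thesis by simp
qed

text \<open>The class over which the local limit bounds are uniform. It is used for
  \<open>square_law f\<close> with \<delta> equal to \<open>r / 2\<close>: mean 1 is then the
  normalisation of the second moment of \<open>f\<close>, and the order \<open>2 + \<delta>\<close>
  corresponds to \<open>4 + r\<close>.\<close>

definition admissible_law :: "real \<Rightarrow> real \<Rightarrow> real \<Rightarrow> real \<Rightarrow> real measure \<Rightarrow> bool" where
  "admissible_law W \<alpha> B \<delta> \<mu> \<longleftrightarrow> real_distribution \<mu> \<and> char_level_bound W \<alpha> \<mu> \<and>
     integrable \<mu> (\<lambda>x. x) \<and> (LINT x|\<mu>. x) = 1 \<and>
     integrable \<mu> (\<lambda>x. x\<^sup>2) \<and> (LINT x|\<mu>. x\<^sup>2) \<le> B \<and>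
     integrable \<mu> (\<lambda>x. \<bar>x\<bar> powr (2 + \<delta>)) \<and> (LINT x|\<mu>. \<bar>x\<bar> powr (2 + \<delta>)) \<le> B"

text \<open>\<open>N - 1\<close> summands at \<open>N - x\<close> are compared with \<open>N\<close>
  summands at \<open>N\<close>, because the remaining coordinate takes away \<open>x = v^2\<close>.
  Integrability is recorded for the power \<open>N - 1\<close>, since the smaller sum is the one
  inverted as a density.\<close>

definition local_limit_at :: "real \<Rightarrow> real \<Rightarrow> (real \<Rightarrow> complex) \<Rightarrow> nat \<Rightarrow> bool" where
  "local_limit_at L c \<phi> N \<longleftrightarrow> integrable lborel (\<lambda>\<xi>. \<phi> \<xi> ^ (N - 1)) \<and>
     c / sqrt N \<le> fourier_inv (\<lambda>\<xi>. \<phi> \<xi> ^ N) N \<and> fourier_inv (\<lambda>\<xi>. \<phi> \<xi> ^ N) N \<le> L \<and>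
     (\<forall>x\<ge>0. \<bar>fourier_inv (\<lambda>\<xi>. \<phi> \<xi> ^ (N - 1)) (real N - x) - fourier_inv (\<lambda>\<xi>. \<phi> \<xi> ^ N) N\<bar>
        \<le> L * (1 + x) / N)"

text \<open>
  Only a lower bound at the mean and a Lipschitz bound of the same order are needed, so the sum is
  not compared with a Gaussian density: near the origin the characteristic function is compared
  with \<open>1 - v * \<xi>\<^sup>2 / 2\<close>.  The constants do not depend on \<open>\<delta>\<close>, only \<open>N0\<close> does.
\<close>

theorem local_limit_bounds:
  fixes W \<alpha> B :: real
  assumes W: "W > 0" and \<alpha>: "\<alpha> > 0" and B: "B \<ge> 1"
  shows "\<exists>L c0. 0 < L \<and> 0 < c0 \<and> (\<forall>\<delta>. 0 < \<delta> \<longrightarrow> \<delta> \<le> 1 \<longrightarrow> (\<exists>N0::nat. \<forall>\<mu>. admissible_law W \<alpha> B \<delta> \<mu> \<longrightarrow>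
    (\<forall>N\<ge>N0. local_limit_at L c0 (char \<mu>) N)))"
proof -
  \<comment> \<open>Of the available factors of the characteristic function, \<open>s\<close> are
    spent on integrability, uniformly over the class; away from the origin the others provide
    exponential decay.\<close>
  define s where "s = nat \<lceil>\<alpha>\<rceil> + 1"
  have s: "\<alpha> < real s" by (simp add: s_def) linarith
  define Cs where "Cs = W * 2 powr \<alpha> / (1 - 2 powr (\<alpha> - s))"
  have "(2::real) powr (\<alpha> - s) < 1" using s powr_less_mono[of "\<alpha> - s" 0 "2::real"] by simp
  hence Cs: "Cs > 0" using W by (simp add: Cs_def)
  define W2 where "W2 = W * (1 / 2) powr (- \<alpha>)"
  have "W2 \<ge> 0" using W by (simp add: W2_def)
  obtain \<tau> \<kappa> c :: real where \<tau>: "0 < \<tau>" and \<kappa>: "0 < \<kappa>" "\<kappa> < 1" and c: "0 < c"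
    and near0: "\<And>M \<xi>. real_distribution M \<Longrightarrow> integrable M (\<lambda>x. x\<^sup>2) \<Longrightarrow> (LINT x|M. x\<^sup>2) \<le> B \<Longrightarrow>
      emeasure lborel {\<xi>. norm (char M \<xi>) > 1 / 2} \<le> ennreal W2 \<Longrightarrow> \<bar>\<xi>\<bar> \<le> 2 * \<tau> \<Longrightarrow>
      (norm (char M \<xi>))\<^sup>2 \<le> 1 - c * \<xi>\<^sup>2"
    and far0: "\<And>M \<xi>. real_distribution M \<Longrightarrow> integrable M (\<lambda>x. x\<^sup>2) \<Longrightarrow> (LINT x|M. x\<^sup>2) \<le> B \<Longrightarrow>
      emeasure lborel {\<xi>. norm (char M \<xi>) > 1 / 2} \<le> ennreal W2 \<Longrightarrow> 2 * \<tau> \<le> \<bar>\<xi>\<bar> \<Longrightarrow>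
      (norm (char M \<xi>))\<^sup>2 \<le> 1 - \<kappa>"
    by (rule char_gap[OF \<open>W2 \<ge> 0\<close>, of B]) (use B in auto)
  define T where "T = 2 * \<tau>"
  have T: "T > 0" using \<tau> by (simp add: T_def)
  define \<rho> where "\<rho> = sqrt (1 - \<kappa>)"
  have \<rho>: "0 < \<rho>" "\<rho> < 1" using \<kappa> by (auto simp: \<rho>_def)
  \<comment> \<open>For \<open>|\<xi>| <= b / sqrt N\<close> one has
    \<open>N * \<xi>^2 * v <= 1\<close>, so Bernoulli's inequality keeps the main term above
    \<open>1/2\<close> there. Taylor expansion is used up to \<open>a / sqrt N\<close>, and
    \<open>a >= 8 / (b * c)\<close> makes the Gaussian tail beyond cost at most a quarter of the
    main term.\<close>
  define b where "b = 1 / sqrt B"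
  have b: "b > 0" "b\<^sup>2 * B = 1" using B by (auto simp: b_def power_divide)
  define a where "a = max b (8 / (b * c))"
  have a: "a > 0" "b \<le> a" "8 / (b * c) \<le> a" using b by (auto simp: a_def)
  define K where "K = 8 * (B + 1)"
  have K: "K > 0" using B by (simp add: K_def)
  \<comment> \<open>The exponential decay at far frequencies is used in the form
    \<open>D / N\<close>, the order of the Lipschitz bound. Boundedness of the whole sequence gives
    this for every positive \<open>N\<close>, truncated subtraction included.\<close>
  have "(\<lambda>N. real N * \<rho> ^ (N - 1 - s)) \<longlonglongrightarrow> 0"
  proof -
    have "(\<lambda>n. real n * \<rho> ^ n) \<longlonglongrightarrow> 0"
      using \<rho> by (intro powser_times_n_limit_0) auto
    moreover have "(\<lambda>n. \<rho> ^ n) \<longlonglongrightarrow> 0" using \<rho> by (intro LIMSEQ_realpow_zero) auto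
    ultimately have "(\<lambda>n. real n * \<rho> ^ n + (1 + real s) * \<rho> ^ n) \<longlonglongrightarrow> 0 + (1 + real s) * 0"
      by (rule tendsto_add[OF _ tendsto_mult[OF tendsto_const]])
    hence "(\<lambda>n. real (n + (1 + s)) * \<rho> ^ (n + (1 + s) - 1 - s)) \<longlonglongrightarrow> 0"
      by (simp add: algebra_simps)
    thus ?thesis by (rule LIMSEQ_offset)
  qed
  hence "Bseq (\<lambda>N. real N * \<rho> ^ (N - 1 - s))" by (intro convergent_imp_Bseq convergentI)
  then obtain D where D: "D > 0" "\<And>N. norm (real N * \<rho> ^ (N - 1 - s)) \<le> D"
    unfolding Bseq_def by blast
  have D_le: "\<rho> ^ (N - 1 - s) \<le> D / N" if "N > 0" for N
    using D(2)[of N] that \<rho> by (simp add: field_simps)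
  \<comment> \<open>\<open>Cs\<close> bounds the density; the other two summands are the near and
    far contributions to the Lipschitz estimate. In \<open>c0\<close> below, \<open>b / 4\<close> is
    what survives of the main term after three losses of \<open>b / 4\<close>, and the rest is the
    inversion factor \<open>1 / (2 * pi)\<close>.\<close>
  define L where "L = Cs + 4 * B / c + 2 * D * Cs"
  have L: "L > 0" using Cs c B D by (auto simp: L_def intro!: add_pos_pos)
  define c0 where "c0 = b / (8 * pi)"
  have c0: "c0 > 0" using b by (simp add: c0_def)
  have "\<exists>N0::nat. \<forall>\<mu>. admissible_law W \<alpha> B \<delta> \<mu> \<longrightarrow>
    (\<forall>N\<ge>N0. local_limit_at L c0 (char \<mu>) N)" if \<delta>: "0 < \<delta>" "\<delta> \<le> 1" for \<delta>
  proof -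
    \<comment> \<open>Relative to the main term, of order \<open>1 / sqrt N\<close>, the Taylor
      error has order \<open>N powr (- \<delta> / 2)\<close>. Of the five conditions on the
      threshold this is the one that involves \<delta>.\<close>
    have "(\<lambda>N. 2 * a powr (3 + \<delta>) * K * real N powr (- \<delta> / 2)) \<longlonglongrightarrow> 2 * a powr (3 + \<delta>) * K * 0"
      using \<delta> by (intro tendsto_mult tendsto_const tendsto_neg_powr filterlim_real_sequentially) auto
    hence "eventually (\<lambda>N. 2 * a powr (3 + \<delta>) * K * real N powr (- \<delta> / 2) < b / 4) sequentially"
      using b by (intro order_tendstoD(2)) auto
    moreover have "eventually (\<lambda>N. s + 2 \<le> N) sequentially" by (rule eventually_ge_at_top)
    moreover have "eventually (\<lambda>N. a\<^sup>2 * B \<le> real N) sequentially"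
      by (rule eventually_ge_at_top[of "nat \<lceil>a\<^sup>2 * B\<rceil>", THEN eventually_mono]) linarith
    moreover have "eventually (\<lambda>N. (a / T)\<^sup>2 \<le> real N) sequentially"
      by (rule eventually_ge_at_top[of "nat \<lceil>(a / T)\<^sup>2\<rceil>", THEN eventually_mono]) linarith
    moreover have "eventually (\<lambda>N. (4 * D * Cs / b)\<^sup>2 \<le> real N) sequentially"
      by (rule eventually_ge_at_top[of "nat \<lceil>(4 * D * Cs / b)\<^sup>2\<rceil>", THEN eventually_mono]) linarith
    ultimately have "eventually (\<lambda>N. 2 * a powr (3 + \<delta>) * K * real N powr (- \<delta> / 2) < b / 4 \<and>
      s + 2 \<le> N \<and> a\<^sup>2 * B \<le> real N \<and> (a / T)\<^sup>2 \<le> real N \<and> (4 * D * Cs / b)\<^sup>2 \<le> real N) sequentially"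
      by eventually_elim blast
    then obtain N0 where N0: "\<And>N. N \<ge> N0 \<Longrightarrow> 2 * a powr (3 + \<delta>) * K * real N powr (- \<delta> / 2) < b / 4"
      "\<And>N. N \<ge> N0 \<Longrightarrow> s + 2 \<le> N" "\<And>N. N \<ge> N0 \<Longrightarrow> a\<^sup>2 * B \<le> real N"
      "\<And>N. N \<ge> N0 \<Longrightarrow> (a / T)\<^sup>2 \<le> real N" "\<And>N. N \<ge> N0 \<Longrightarrow> (4 * D * Cs / b)\<^sup>2 \<le> real N"
      unfolding eventually_sequentially by blast
    show ?thesis
    proof (intro exI[of _ N0] allI impI, goal_cases)
      case (1 \<mu> N)
      note N = N0[OF \<open>N0 \<le> N\<close>]
      from 1 interpret real_distribution \<mu> by (simp add: admissible_law_def)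
      have rd: "real_distribution \<mu>" by unfold_locales
      have lev: "char_level_bound W \<alpha> \<mu>"
        and i1: "integrable \<mu> (\<lambda>x. x)" and e1: "(LINT x|\<mu>. x) = 1"
        and i2: "integrable \<mu> (\<lambda>x. x\<^sup>2)" and e2: "(LINT x|\<mu>. x\<^sup>2) \<le> B"
        and i3: "integrable \<mu> (\<lambda>x. \<bar>x\<bar> powr (2 + \<delta>))" and e3: "(LINT x|\<mu>. \<bar>x\<bar> powr (2 + \<delta>)) \<le> B"
        using 1 by (auto simp: admissible_law_def)
      let ?\<phi> = "char \<mu>"
      have [measurable]: "?\<phi> \<in> borel_measurable borel" by (rule char_measurable)
      have lev2: "emeasure lborel {\<xi>. norm (?\<phi> \<xi>) > 1 / 2} \<le> ennreal W2"
        unfolding W2_def by (rule lev[unfolded char_level_bound_def, rule_format]) auto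
      have Npos: "N > 0" "real N > 0" and Ns: "s \<le> N - 1" using N(2) by auto
      have le1: "norm (?\<phi> \<xi>) \<le> 1" for \<xi> by (rule cmod_char_le_1)
      have near: "norm (?\<phi> \<xi>) ^ n \<le> exp (- (c * n / 2 * \<xi>\<^sup>2))" if "\<bar>\<xi>\<bar> \<le> T" for \<xi> and n :: nat
      proof -
        have "(norm (?\<phi> \<xi>))\<^sup>2 \<le> 1 - c * \<xi>\<^sup>2"
          using near0[OF rd i2 e2 lev2, of \<xi>] that by (simp add: T_def)
        also have "\<dots> \<le> exp (- (c * \<xi>\<^sup>2))" using exp_ge_add_one_self[of "- (c * \<xi>\<^sup>2)"] by simp
        also have "\<dots> = (exp (- (c / 2 * \<xi>\<^sup>2)))\<^sup>2" by (simp flip: exp_double)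
        finally have "norm (?\<phi> \<xi>) \<le> exp (- (c / 2 * \<xi>\<^sup>2))"
          by (rule power2_le_imp_le) simp
        hence "norm (?\<phi> \<xi>) ^ n \<le> exp (- (c / 2 * \<xi>\<^sup>2)) ^ n" by (rule power_mono) simp
        also have "\<dots> = exp (- (c * n / 2 * \<xi>\<^sup>2))" by (simp flip: exp_of_nat_mult add: algebra_simps)
        finally show ?thesis .
      qed
      have far: "norm (?\<phi> \<xi>) ^ n \<le> \<rho> ^ (n - s) * norm (?\<phi> \<xi>) ^ s" if "T \<le> \<bar>\<xi>\<bar>" "s \<le> n" for \<xi> n
      proof -
        have "(norm (?\<phi> \<xi>))\<^sup>2 \<le> 1 - \<kappa>"
          using far0[OF rd i2 e2 lev2, of \<xi>] that by (simp add: T_def)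
        hence "norm (?\<phi> \<xi>) \<le> \<rho>" unfolding \<rho>_def by (rule real_le_rsqrt)
        hence "norm (?\<phi> \<xi>) ^ (n - s) * norm (?\<phi> \<xi>) ^ s \<le> \<rho> ^ (n - s) * norm (?\<phi> \<xi>) ^ s"
          by (intro mult_right_mono power_mono) auto
        thus ?thesis using that by (simp flip: power_add)
      qed
      have nns: "(\<integral>\<^sup>+ \<xi>. ennreal (norm (?\<phi> \<xi>) ^ s) \<partial>lborel) \<le> ennreal Cs"
        unfolding Cs_def using nn_integral_char_power[OF rd lev _ \<alpha> s] W by simp
      have ints: "integrable lborel (\<lambda>\<xi>. norm (?\<phi> \<xi>) ^ s)"
        by (rule integrableI_nonneg) (use nns in \<open>auto intro: le_less_trans\<close>)
      have Is: "(LINT \<xi>|lborel. norm (?\<phi> \<xi>) ^ s) \<le> Cs"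
        using nns Cs by (subst (asm) nn_integral_eq_integral[OF ints]) (auto simp: ennreal_le_iff)
      have intn: "integrable lborel (\<lambda>\<xi>. ?\<phi> \<xi> ^ n * iexp (- (\<xi> * t)))" if "s \<le> n" for n t
        by (rule Bochner_Integration.integrable_bound[OF ints])
           (use that le1 in \<open>auto simp: norm_mult norm_power intro!: power_decreasing simp del: of_real_mult\<close>)
      have main1: "integrable lborel (\<lambda>\<xi>. ?\<phi> \<xi> ^ (N - 1))"
        using intn[OF Ns, of 0] by simp
      have main2: "fourier_inv (\<lambda>\<xi>. ?\<phi> \<xi> ^ N) N \<le> L"
      proof -
        have "Re (CLINT \<xi>|lborel. ?\<phi> \<xi> ^ N * iexp (- (\<xi> * N))) \<le> norm (CLINT \<xi>|lborel. ?\<phi> \<xi> ^ N * iexp (- (\<xi> * N)))"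
          by (rule complex_Re_le_cmod)
        also have "\<dots> \<le> (LINT \<xi>|lborel. norm (?\<phi> \<xi> ^ N * iexp (- (\<xi> * N))))"
          by (rule integral_norm_bound)
        also have "\<dots> \<le> (LINT \<xi>|lborel. norm (?\<phi> \<xi>) ^ s)"
          by (rule integral_mono[OF integrable_norm[OF intn] ints])
             (use le1 Ns in \<open>auto simp: norm_mult norm_power intro!: power_decreasing simp del: of_real_mult\<close>)
        also have "\<dots> \<le> Cs" by (rule Is)
        finally have "fourier_inv (\<lambda>\<xi>. ?\<phi> \<xi> ^ N) N \<le> Cs / (2 * pi)"
          unfolding fourier_inv_def by (rule divide_right_mono) simp
        also have "\<dots> \<le> Cs / 1" using Cs pi_ge_two by (intro divide_left_mono) auto
        also have "\<dots> \<le> L" using c B D Cs by (simp add: L_def)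
        finally show ?thesis .
      qed
      have main3: "\<bar>fourier_inv (\<lambda>\<xi>. ?\<phi> \<xi> ^ (N - 1)) (real N - x) - fourier_inv (\<lambda>\<xi>. ?\<phi> \<xi> ^ N) N\<bar> \<le> L * (1 + x) / N"
        if x: "x \<ge> 0" for x :: real
      proof -
        let ?n = "N - 1"
        define a' where "a' = c * ?n / 2"
        have n2: "real N / 2 \<le> real ?n" using N(2) by (simp add: of_nat_diff)
        have a': "a' > 0" "c * N / 4 \<le> a'"
        proof -
          have "c * (real N / 2) \<le> c * ?n" using c n2 by (intro mult_left_mono) auto
          thus "c * N / 4 \<le> a'" by (simp add: a'_def)
          thus "a' > 0" using c Npos by (meson divide_pos_pos less_le_trans mult_pos_pos zero_less_numeral)
        qed
        let ?F = "\<lambda>\<xi>. ?\<phi> \<xi> ^ ?n * iexp (- (\<xi> * (real N - x))) - ?\<phi> \<xi> ^ N * iexp (- (\<xi> * N))"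
        let ?G = "\<lambda>\<xi>. (x + B) * (\<bar>\<xi>\<bar> * exp (- (a' * \<xi>\<^sup>2))) + 2 * \<rho> ^ (?n - s) * norm (?\<phi> \<xi>) ^ s"
        have intF: "integrable lborel ?F"
          by (intro Bochner_Integration.integrable_diff intn) (use Ns in auto)
        have intG: "integrable lborel ?G"
          by (intro Bochner_Integration.integrable_add integrable_mult_right ints gaussian_abs_moment(1) a')
        have abs1: "(LINT y|\<mu>. \<bar>y\<bar>) \<le> B"
        proof -
          have "(LINT y|\<mu>. \<bar>y\<bar>) \<le> (LINT y|\<mu>. 1 / 2 + y\<^sup>2 / 2)"
          proof (rule integral_mono)
            show "\<bar>y\<bar> \<le> 1 / 2 + y\<^sup>2 / 2" for y :: real
              using zero_le_power2[of "\<bar>y\<bar> - 1"] by (simp add: power2_eq_square algebra_simps)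
          qed (use i1 i2 in auto)
          also have "\<dots> = 1 / 2 + (LINT y|\<mu>. y\<^sup>2) / 2" using i2 prob_space by simp
          finally show ?thesis using e2 B by simp
        qed
        have phi1: "norm (1 - ?\<phi> \<xi>) \<le> \<bar>\<xi>\<bar> * B" for \<xi>
        proof -
          have ie: "integrable \<mu> (\<lambda>y. iexp (\<xi> * y))"
            by (rule integrable_const_bound[of _ 1]) auto
          have "1 - ?\<phi> \<xi> = (CLINT y|\<mu>. 1 - iexp (\<xi> * y))"
            unfolding char_def using ie prob_space by (subst Bochner_Integration.integral_diff) auto
          also have "norm \<dots> \<le> (LINT y|\<mu>. norm (1 - iexp (\<xi> * y)))" by (rule integral_norm_bound)
          also have "\<dots> \<le> (LINT y|\<mu>. \<bar>\<xi>\<bar> * \<bar>y\<bar>)"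
          proof (rule integral_mono)
            show "norm (1 - iexp (\<xi> * y)) \<le> \<bar>\<xi>\<bar> * \<bar>y\<bar>" for y
              using norm_iexp_minus_one_le[of "\<xi> * y"] by (simp add: abs_mult norm_minus_commute)
          qed (use ie i1 in auto)
          also have "\<dots> \<le> \<bar>\<xi>\<bar> * B" using abs1 by (simp add: mult_left_mono)
          finally show ?thesis .
        qed
        have pt: "norm (?F \<xi>) \<le> ?G \<xi>" for \<xi>
        proof -
          have "N = Suc ?n" using Npos by simp
          hence 1: "?\<phi> \<xi> ^ N = ?\<phi> \<xi> ^ ?n * ?\<phi> \<xi>" by (metis power_Suc2)
          have 2: "iexp (- (\<xi> * (real N - x))) = iexp (- (\<xi> * N)) * iexp (\<xi> * x)"
            by (simp flip: exp_add add: algebra_simps)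
          \<comment> \<open>Dropping a summand and shifting the point together produce the single
            factor \<open>iexp (\<xi> * x) - ?\<phi> \<xi>\<close>, which vanishes linearly at the
            origin. The extra \<open>|\<xi>|\<close> improves the Gaussian integral from order
            \<open>1 / sqrt N\<close> to order \<open>1 / N\<close>.\<close>
          have F: "?F \<xi> = ?\<phi> \<xi> ^ ?n * iexp (- (\<xi> * N)) * (iexp (\<xi> * x) - ?\<phi> \<xi>)"
            unfolding 1 2 by (simp only: right_diff_distrib mult_ac)
          have eq: "norm (?F \<xi>) = norm (?\<phi> \<xi>) ^ ?n * norm (iexp (\<xi> * x) - ?\<phi> \<xi>)"
            unfolding F by (simp add: norm_mult norm_power del: of_real_mult)
          show ?thesis
          proof (cases "\<bar>\<xi>\<bar> \<le> T")
            case True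
            have "norm (iexp (\<xi> * x) - ?\<phi> \<xi>) \<le> norm (iexp (\<xi> * x) - 1) + norm (1 - ?\<phi> \<xi>)"
              using norm_triangle_ineq[of "iexp (\<xi> * x) - 1" "1 - ?\<phi> \<xi>"]
              by (simp only: add_diff_eq diff_add_cancel)
            also have "\<dots> \<le> \<bar>\<xi>\<bar> * x + \<bar>\<xi>\<bar> * B"
              using norm_iexp_minus_one_le[of "\<xi> * x"] phi1 x by (intro add_mono) (auto simp: abs_mult)
            finally have "norm (?F \<xi>) \<le> exp (- (a' * \<xi>\<^sup>2)) * (\<bar>\<xi>\<bar> * x + \<bar>\<xi>\<bar> * B)"
              unfolding eq a'_def using near[OF True, of ?n] by (intro mult_mono) auto
            also have "\<dots> \<le> ?G \<xi>" using \<rho> by (simp add: algebra_simps)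
            finally show ?thesis .
          next
            case False
            have "norm (iexp (\<xi> * x) - ?\<phi> \<xi>) \<le> norm (iexp (\<xi> * x)) + norm (?\<phi> \<xi>)"
              by (rule norm_triangle_ineq4)
            also have "\<dots> \<le> 2" using le1[of \<xi>] by (simp del: of_real_mult)
            finally have "norm (?F \<xi>) \<le> (\<rho> ^ (?n - s) * norm (?\<phi> \<xi>) ^ s) * 2"
              unfolding eq using far[of \<xi> ?n] False Ns \<rho> by (intro mult_mono) auto
            also have "\<dots> \<le> ?G \<xi>" using x B by simp
            finally show ?thesis .
          qed
        qed
        have "fourier_inv (\<lambda>\<xi>. ?\<phi> \<xi> ^ ?n) (real N - x) - fourier_inv (\<lambda>\<xi>. ?\<phi> \<xi> ^ N) N =
          Re (CLINT \<xi>|lborel. ?F \<xi>) / (2 * pi)"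
          unfolding fourier_inv_def using Ns
          by (subst Bochner_Integration.integral_diff[OF intn[OF Ns] intn[of N]]) (auto simp: diff_divide_distrib)
        moreover have "\<bar>Re (CLINT \<xi>|lborel. ?F \<xi>)\<bar> \<le> L * (1 + x) / N"
        proof -
          have "\<bar>Re (CLINT \<xi>|lborel. ?F \<xi>)\<bar> \<le> norm (CLINT \<xi>|lborel. ?F \<xi>)" by (rule abs_Re_le_cmod)
          also have "\<dots> \<le> (LINT \<xi>|lborel. norm (?F \<xi>))" by (rule integral_norm_bound)
          also have "\<dots> \<le> (LINT \<xi>|lborel. ?G \<xi>)"
            by (rule integral_mono[OF integrable_norm[OF intF] intG pt])
          also have "\<dots> = (x + B) * (1 / a') + 2 * \<rho> ^ (?n - s) * (LINT \<xi>|lborel. norm (?\<phi> \<xi>) ^ s)"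
            using gaussian_abs_moment[OF a'(1)] ints by (subst Bochner_Integration.integral_add) auto
          also have "\<dots> \<le> (x + B) * (1 / (c * N / 4)) + 2 * (D / N) * Cs"
            using x B a' c Npos \<rho> D D_le[of N] Is Cs
            by (intro add_mono mult_mono divide_left_mono mult_left_mono) auto
          also have "\<dots> = ((x + B) * (4 / c) + 2 * D * Cs) / N" using c Npos by (simp add: field_simps)
          also have "\<dots> \<le> L * (1 + x) / N"
          proof (rule divide_right_mono)
            have "x + B \<le> B * (1 + x)" using B x mult_right_mono[of 1 B x] by (simp add: distrib_left)
            hence "(x + B) * (4 / c) \<le> B * (1 + x) * (4 / c)" using c by (intro mult_right_mono) auto
            moreover have "2 * D * Cs * 1 \<le> 2 * D * Cs * (1 + x)" using D Cs x by (intro mult_left_mono) auto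
            moreover have "0 \<le> Cs * (1 + x)" using Cs x by simp
            ultimately show "(x + B) * (4 / c) + 2 * D * Cs \<le> L * (1 + x)"
              by (simp add: L_def algebra_simps)
          qed simp
          finally show ?thesis .
        qed
        moreover have "\<bar>Re (CLINT \<xi>|lborel. ?F \<xi>) / (2 * pi)\<bar> \<le> \<bar>Re (CLINT \<xi>|lborel. ?F \<xi>)\<bar> / 1"
          unfolding abs_divide using pi_ge_two by (intro divide_left_mono) auto
        ultimately show ?thesis by linarith
      qed
      have main4: "c0 / sqrt N \<le> fourier_inv (\<lambda>\<xi>. ?\<phi> \<xi> ^ N) N"
      proof -
        \<comment> \<open>The characteristic function of the centred variable. The sum of
          \<open>N\<close> copies is evaluated at its mean \<open>N\<close>, so centring absorbs the
          oscillating factor of the inversion integral.\<close>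
        define \<psi> where "\<psi> \<xi> = ?\<phi> \<xi> * iexp (- \<xi>)" for \<xi>
        have \<psi>N: "\<psi> \<xi> ^ N = ?\<phi> \<xi> ^ N * iexp (- (\<xi> * N))" for \<xi>
          by (simp add: \<psi>_def power_mult_distrib flip: exp_of_nat_mult) (simp add: mult_ac)
        have n\<psi>: "norm (\<psi> \<xi>) = norm (?\<phi> \<xi>)" for \<xi> by (simp add: \<psi>_def norm_mult)
        define v where "v = (LINT x|\<mu>. (x - 1)\<^sup>2)"
        have iv: "integrable \<mu> (\<lambda>x. (x - 1)\<^sup>2)"
          using i1 i2 by (simp add: power2_diff)
        have "v = (LINT x|\<mu>. x\<^sup>2) - 1"
          unfolding v_def using i1 i2 e1 prob_space by (simp add: power2_diff)
        hence "v \<le> B" using e2 by linarith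
        moreover have "0 \<le> v" unfolding v_def by (rule integral_nonneg_AE) simp
        ultimately have v: "0 \<le> v" "v \<le> B" by auto
        define h where "h = a / sqrt N"
        have h: "h > 0" using a Npos by (simp add: h_def)
        have hT: "h \<le> T"
        proof -
          have "a / T \<le> sqrt N" using N(4) by (rule real_le_rsqrt)
          thus ?thesis using T Npos by (simp add: h_def field_simps)
        qed
        have h2: "h\<^sup>2 * B \<le> 1" using N(3) Npos by (simp add: h_def power_divide field_simps)
        have taylor: "norm (\<psi> \<xi> - (1 - \<xi>\<^sup>2 * v / 2)) \<le> \<xi>\<^sup>2 * \<bar>\<xi>\<bar> powr \<delta> * K" for \<xi>
        proof -
          have c\<psi>: "char (distr \<mu> borel (\<lambda>x. x - 1)) \<xi> = \<psi> \<xi>"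
          proof -
            have "char (distr \<mu> borel (\<lambda>x. x - 1)) \<xi> = (CLINT x|\<mu>. iexp (\<xi> * (x - 1)))"
              unfolding char_def by (rule integral_distr) auto
            also have "\<dots> = (CLINT x|\<mu>. iexp (\<xi> * x) * iexp (- \<xi>))"
              by (intro Bochner_Integration.integral_cong refl) (simp flip: exp_add add: algebra_simps)
            also have "\<dots> = \<psi> \<xi>" unfolding \<psi>_def char_def by (rule integral_mult_left_zero)
            finally show ?thesis .
          qed
          have e0: "(LINT x|\<mu>. x - 1) = 0" using i1 e1 prob_space by simp
          have A: "norm (char (distr \<mu> borel (\<lambda>x. x - 1)) \<xi> - (1 - \<xi>\<^sup>2 * v / 2)) \<le>
            (\<xi>\<^sup>2 / 6) * (LINT x|\<mu>. min (6 * (x - 1)\<^sup>2) (\<bar>\<xi>\<bar> * \<bar>x - 1\<bar> ^ 3))"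
          proof (rule char_approx3'[OF _ _ iv e0 _ refl])
            show "(\<lambda>x. x - 1) \<in> borel_measurable \<mu>" by measurable
            show "integrable \<mu> (\<lambda>x. x - 1)" using i1 by simp
            show "(LINT x|\<mu>. (x - 1 - (LINT x|\<mu>. x - 1))\<^sup>2) = v" unfolding e0 v_def by simp
          qed
          have "(LINT x|\<mu>. min (6 * (x - 1)\<^sup>2) (\<bar>\<xi>\<bar> * \<bar>x - 1\<bar> ^ 3)) \<le>
            (LINT x|\<mu>. 6 * \<bar>\<xi>\<bar> powr \<delta> * (8 * (\<bar>x\<bar> powr (2 + \<delta>) + 1)))"
          proof (rule integral_mono)
            show "integrable \<mu> (\<lambda>x. min (6 * (x - 1)\<^sup>2) (\<bar>\<xi>\<bar> * \<bar>x - 1\<bar> ^ 3))"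
              by (rule Bochner_Integration.integrable_bound[of _ "\<lambda>x. 6 * (x - 1)\<^sup>2"]) (use iv in auto)
            show "min (6 * (x - 1)\<^sup>2) (\<bar>\<xi>\<bar> * \<bar>x - 1\<bar> ^ 3) \<le> 6 * \<bar>\<xi>\<bar> powr \<delta> * (8 * (\<bar>x\<bar> powr (2 + \<delta>) + 1))" for x
              using min_cube_le_powr[OF \<delta>, of "x - 1" \<xi>]
                mult_left_mono[OF centred_powr_le[OF \<delta>, of x], of "6 * \<bar>\<xi>\<bar> powr \<delta>"] by simp
          qed (use i3 in auto)
          also have "\<dots> = 6 * \<bar>\<xi>\<bar> powr \<delta> * (8 * ((LINT x|\<mu>. \<bar>x\<bar> powr (2 + \<delta>)) + 1))"
            using i3 prob_space by simp
          also have "\<dots> \<le> 6 * \<bar>\<xi>\<bar> powr \<delta> * K"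
            unfolding K_def using e3 by (intro mult_left_mono) auto
          finally have "(\<xi>\<^sup>2 / 6) * (LINT x|\<mu>. min (6 * (x - 1)\<^sup>2) (\<bar>\<xi>\<bar> * \<bar>x - 1\<bar> ^ 3)) \<le>
            (\<xi>\<^sup>2 / 6) * (6 * \<bar>\<xi>\<bar> powr \<delta> * K)"
            by (rule mult_left_mono) simp
          also have "\<dots> = \<xi>\<^sup>2 * \<bar>\<xi>\<bar> powr \<delta> * K" by simp
          finally show ?thesis using A unfolding c\<psi> by linarith
        qed
        \<comment> \<open>A minorant with explicitly computable or already bounded integrals: the
          main term, the Taylor error up to \<open>h\<close>, the Gaussian tail between
          \<open>h\<close> and \<open>T\<close>, and the far frequencies. The factor
          \<open>|\<xi>| / h\<close>, at least 1 on the tail, allows the complete integral of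
          \<open>|\<xi>|\<close> against the Gaussian to be used there.\<close>
        let ?low = "\<lambda>\<xi>. 1 / 2 * indicator {- (b / sqrt N)..b / sqrt N} \<xi> - N * h powr (2 + \<delta>) * K * indicator {-h..h} \<xi>
          - 1 / h * (\<bar>\<xi>\<bar> * exp (- (c * N / 2 * \<xi>\<^sup>2))) - \<rho> ^ (N - s) * norm (?\<phi> \<xi>) ^ s"
        have bh: "b / sqrt N \<le> h" using a Npos by (simp add: h_def divide_right_mono)
        have pt: "?low \<xi> \<le> Re (\<psi> \<xi> ^ N)" for \<xi>
        proof -
          have neg: "- (norm (?\<phi> \<xi>) ^ N) \<le> Re (\<psi> \<xi> ^ N)"
            using abs_Re_le_cmod[of "\<psi> \<xi> ^ N"] by (simp add: norm_power n\<psi>)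
          have g0: "0 \<le> 1 / h * (\<bar>\<xi>\<bar> * exp (- (c * N / 2 * \<xi>\<^sup>2)))" using h by simp
          have s0: "0 \<le> \<rho> ^ (N - s) * norm (?\<phi> \<xi>) ^ s" using \<rho> by simp
          consider "\<bar>\<xi>\<bar> \<le> h" | "h < \<bar>\<xi>\<bar>" "\<bar>\<xi>\<bar> \<le> T" | "T < \<bar>\<xi>\<bar>" by linarith
          thus ?thesis
          proof cases
            case 1
            define q where "q = 1 - \<xi>\<^sup>2 * v / 2"
            have "\<xi>\<^sup>2 \<le> h\<^sup>2" using 1 h by (metis abs_of_pos abs_le_square_iff)
            hence "\<xi>\<^sup>2 * v \<le> h\<^sup>2 * B" using v by (intro mult_mono) auto
            hence q: "0 \<le> q" "q \<le> 1" using h2 v by (auto simp: q_def)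
            have "norm (\<psi> \<xi> ^ N - complex_of_real q ^ N) \<le> N * norm (\<psi> \<xi> - complex_of_real q)"
              by (rule norm_power_diff) (use le1 q n\<psi> in auto)
            also have "\<dots> \<le> N * (\<xi>\<^sup>2 * \<bar>\<xi>\<bar> powr \<delta> * K)"
              using taylor[of \<xi>] by (intro mult_left_mono) (auto simp: q_def)
            also have "\<dots> \<le> N * (h\<^sup>2 * h powr \<delta> * K)"
              using 1 h \<open>\<xi>\<^sup>2 \<le> h\<^sup>2\<close> \<delta> K by (intro mult_left_mono mult_mono powr_mono2 mult_right_mono) auto
            also have "h\<^sup>2 * h powr \<delta> = h powr (2 + \<delta>)" using h by (simp add: powr_add)
            finally have d: "norm (\<psi> \<xi> ^ N - complex_of_real q ^ N) \<le> N * h powr (2 + \<delta>) * K"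
              by (simp add: mult.assoc)
            have "Re (\<psi> \<xi> ^ N - complex_of_real q ^ N) = Re (\<psi> \<xi> ^ N) - q ^ N"
              by (simp flip: of_real_power)
            hence 2: "q ^ N - N * h powr (2 + \<delta>) * K \<le> Re (\<psi> \<xi> ^ N)"
              using abs_Re_le_cmod[of "\<psi> \<xi> ^ N - complex_of_real q ^ N"] d by linarith
            have 3: "1 / 2 * indicator {- (b / sqrt N)..b / sqrt N} \<xi> \<le> q ^ N"
            proof (cases "\<xi> \<in> {- (b / sqrt N)..b / sqrt N}")
              case True
              hence "\<bar>\<xi>\<bar> \<le> \<bar>b / sqrt N\<bar>" using b by auto
              hence "\<xi>\<^sup>2 \<le> (b / sqrt N)\<^sup>2" by (simp only: abs_le_square_iff)
              hence "\<xi>\<^sup>2 * v \<le> (b / sqrt N)\<^sup>2 * B" using v by (intro mult_mono) auto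
              also have "\<dots> = 1 / N" using b Npos by (simp add: power_divide)
              finally have "N * (\<xi>\<^sup>2 * v / 2) \<le> 1 / 2" using Npos by (simp add: field_simps)
              moreover have "1 + real N * (- (\<xi>\<^sup>2 * v / 2)) \<le> (1 + - (\<xi>\<^sup>2 * v / 2)) ^ N"
                by (rule Bernoulli_inequality) (use q in \<open>auto simp: q_def\<close>)
              ultimately show ?thesis using True by (simp add: q_def)
            qed (use q in simp)
            have ind1: "indicator {-h..h} \<xi> = (1::real)" using 1 by (auto simp: indicator_def)
            show ?thesis unfolding ind1 using 2 3 g0 s0 by linarith
          next
            case 2
            have "\<xi> \<notin> {-h..h}" "\<xi> \<notin> {- (b / sqrt N)..b / sqrt N}" using 2 bh by auto
            moreover have "norm (?\<phi> \<xi>) ^ N \<le> 1 / h * (\<bar>\<xi>\<bar> * exp (- (c * N / 2 * \<xi>\<^sup>2)))"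
            proof -
              have "norm (?\<phi> \<xi>) ^ N \<le> 1 * exp (- (c * N / 2 * \<xi>\<^sup>2))" using near[OF 2(2), of N] by simp
              also have "\<dots> \<le> (\<bar>\<xi>\<bar> / h) * exp (- (c * N / 2 * \<xi>\<^sup>2))"
                using 2 h by (intro mult_right_mono) auto
              finally show ?thesis by simp
            qed
            ultimately show ?thesis using neg s0 by simp
          next
            case 3
            have "\<xi> \<notin> {-h..h}" "\<xi> \<notin> {- (b / sqrt N)..b / sqrt N}" using 3 bh hT by auto
            moreover have "norm (?\<phi> \<xi>) ^ N \<le> \<rho> ^ (N - s) * norm (?\<phi> \<xi>) ^ s"
              by (rule far) (use 3 Ns in auto)
            ultimately show ?thesis using neg g0 by simp
          qed
        qed
        have ind: "integrable lborel (indicat_real {-y..y})" "(LINT \<xi>|lborel. indicat_real {-y..y} \<xi>) = 2 * y" if "y \<ge> 0" for y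
          using that by auto
        have intlow: "integrable lborel ?low"
          by (intro Bochner_Integration.integrable_diff integrable_mult_right ints gaussian_abs_moment(1) ind)
             (use c Npos h b in auto)
        have int\<psi>: "integrable lborel (\<lambda>\<xi>. \<psi> \<xi> ^ N)" unfolding \<psi>N by (rule intn) (use Ns in simp)
        have "(LINT \<xi>|lborel. ?low \<xi>) = 1 / 2 * (2 * (b / sqrt N)) - N * h powr (2 + \<delta>) * K * (2 * h)
          - 1 / h * (1 / (c * N / 2)) - \<rho> ^ (N - s) * (LINT \<xi>|lborel. norm (?\<phi> \<xi>) ^ s)"
        proof -
          have p: "c * N / 2 > 0" "b / sqrt N \<ge> 0" "h \<ge> 0" using c Npos b h by auto
          show ?thesis
            using ind[OF p(2)] ind[OF p(3)] gaussian_abs_moment[OF p(1)] ints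
            by (simp del: integral_indicator)
        qed
        also have "\<dots> \<ge> b / sqrt N - b / 4 / sqrt N - b / 4 / sqrt N - b / 4 / sqrt N"
        proof -
          have sN: "sqrt N > 0" "sqrt N * sqrt N = N" using Npos by auto
          have "N * h powr (2 + \<delta>) * K * (2 * h) = 2 * a powr (3 + \<delta>) * K * real N powr (- \<delta> / 2) / sqrt N"
          proof -
            have "h powr (2 + \<delta>) * h = h powr (3 + \<delta>)"
              using h powr_add[of h "2 + \<delta>" 1] by (simp add: add.commute add.left_commute)
            also have "\<dots> = a powr (3 + \<delta>) / real N powr ((3 + \<delta>) / 2)"
              using a Npos by (simp add: h_def powr_divide powr_half_sqrt[symmetric] powr_powr)
            also have "\<dots> = a powr (3 + \<delta>) * real N powr (- ((3 + \<delta>) / 2))"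
              by (simp only: powr_minus divide_inverse)
            also have "real N powr (- ((3 + \<delta>) / 2)) = real N powr (- \<delta> / 2) * real N powr (- (1 / 2)) * real N powr (- 1)"
              unfolding powr_add[symmetric] by (rule arg_cong2[where f = "(powr)"]) (simp_all add: field_simps)
            also have "\<dots> = real N powr (- \<delta> / 2) / sqrt N / N"
              using Npos by (simp add: powr_minus_divide powr_half_sqrt)
            finally show ?thesis using Npos by (simp add: field_simps)
          qed
          also have "\<dots> \<le> b / 4 / sqrt N"
            using N(1) sN by (intro divide_right_mono) auto
          finally have 1: "N * h powr (2 + \<delta>) * K * (2 * h) \<le> b / 4 / sqrt N" .
          have "1 / h * (1 / (c * N / 2)) = (2 / (a * c)) / sqrt N"
            using sN a c unfolding h_def by (simp add: field_simps)
          also have "\<dots> \<le> b / 4 / sqrt N"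
          proof (rule divide_right_mono)
            show "2 / (a * c) \<le> b / 4" using a b c by (simp add: field_simps)
          qed simp
          finally have 2: "1 / h * (1 / (c * N / 2)) \<le> b / 4 / sqrt N" .
          have "\<rho> ^ (N - s) \<le> \<rho> ^ (N - 1 - s)" using \<rho> by (intro power_decreasing) auto
          also have "\<dots> \<le> D / N" by (rule D_le) (use Npos in simp)
          finally have "\<rho> ^ (N - s) * (LINT \<xi>|lborel. norm (?\<phi> \<xi>) ^ s) \<le> D / N * Cs"
            using Is D Npos \<rho> by (intro mult_mono) auto
          also have "\<dots> = D * Cs / sqrt N / sqrt N" using sN by simp
          also have "\<dots> \<le> b / 4 / sqrt N"
          proof (rule divide_right_mono)
            have "4 * D * Cs / b \<le> sqrt N" using N(5) by (rule real_le_rsqrt)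
            thus "D * Cs / sqrt N \<le> b / 4" using b sN by (simp add: field_simps)
          qed simp
          finally have 3: "\<rho> ^ (N - s) * (LINT \<xi>|lborel. norm (?\<phi> \<xi>) ^ s) \<le> b / 4 / sqrt N" .
          show ?thesis using 1 2 3 by simp
        qed
        finally have "b / 4 / sqrt N \<le> (LINT \<xi>|lborel. ?low \<xi>)" by simp
        also have "\<dots> \<le> (LINT \<xi>|lborel. Re (\<psi> \<xi> ^ N))"
          by (rule integral_mono[OF intlow _ pt]) (use int\<psi> in auto)
        also have "\<dots> = Re (CLINT \<xi>|lborel. \<psi> \<xi> ^ N)" by (rule integral_Re[OF int\<psi>])
        finally have "b / 4 / sqrt N / (2 * pi) \<le> fourier_inv (\<lambda>\<xi>. ?\<phi> \<xi> ^ N) N"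
          unfolding fourier_inv_def \<psi>N by (rule divide_right_mono) simp
        thus ?thesis by (simp add: c0_def mult_ac)
      qed
      show ?case unfolding local_limit_at_def using main1 main2 main3 main4 by blast
    qed
  qed
  with L c0 show ?thesis by blast
qed

section \<open>Fourier inversion and the density of a sum of squares\<close>

lemma fourier_inv_measurable [measurable]:
  assumes [measurable]: "\<phi> \<in> borel_measurable borel"
  shows "fourier_inv \<phi> \<in> borel_measurable borel"
  unfolding fourier_inv_def by measurable

lemma integral_iexp_interval:
  assumes "a \<le> b" "t \<noteq> 0"
  shows "(CLINT s|lborel. indicator {a..b} s *\<^sub>R iexp (- (t * s))) = (iexp (- (t * a)) - iexp (- (t * b))) / (\<i> * t)"
proof -
  let ?F = "\<lambda>s. - (iexp (- (t * s)) / (\<i> * t))"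
  have d: "(?F has_vector_derivative iexp (- (t * s))) (at s within A)" for s A
  proof -
    let ?c = "- (\<i> * complex_of_real t)"
    have "((\<lambda>s. (- 1 / (\<i> * t)) * exp (s *\<^sub>R ?c)) has_vector_derivative (- 1 / (\<i> * t)) * (exp (s *\<^sub>R ?c) * ?c)) (at s within A)"
      by (intro has_vector_derivative_mult_right exp_scaleR_has_vector_derivative_right)
    moreover have "exp (s *\<^sub>R ?c) = iexp (- (t * s))" for s
      by (simp add: scaleR_conv_of_real mult_ac)
    ultimately show ?thesis using assms(2) by simp
  qed
  have "(CLINT s|lborel. indicator {a..b} s *\<^sub>R iexp (- (t * s))) = ?F b - ?F a"
    by (rule integral_FTC_atLeastAtMost[OF assms(1) d]) (intro continuous_intros)
  thus ?thesis by (simp add: diff_divide_distrib)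
qed

text \<open>Levy's inversion formula gives a limit of truncated integrals. Integrability of the
  characteristic function removes the truncation by dominated convergence; writing the kernel as an
  integral of exponentials over \<open>{a..b}\<close> and applying Fubini then exposes the
  density.\<close>

lemma measure_Ioc_eq_fourier_inv:
  assumes "real_distribution M" and atom: "\<And>x. measure M {x} = 0"
    and \<phi>: "integrable lborel (char M)" and ab: "a \<le> b"
  shows "measure M {a<..b} = (LINT s|lborel. indicator {a..b} s * fourier_inv (char M) s)"
    and "integrable lborel (\<lambda>s. indicator {a..b} s * fourier_inv (char M) s)"
proof -
  interpret real_distribution M by fact
  let ?\<phi> = "char M"
  have [measurable]: "?\<phi> \<in> borel_measurable borel" by (rule char_measurable)
  let ?F = "\<lambda>t. (iexp (- (t * a)) - iexp (- (t * b))) / (\<i> * complex_of_real t)"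
  \<comment> \<open>At \<open>t = 0\<close> the quotient is 0 by the convention for division. Hence
    it agrees with the integral of exponentials over \<open>{a..b}\<close> only almost everywhere,
    which is how it is identified below.\<close>
  have Fb: "norm (?F t) \<le> b - a" for t
  proof (cases "t = 0")
    case False
    have "norm (?F t) = norm ((iexp (t * (- a)) - iexp (t * (- b))) / (\<i> * t))" by simp
    also have "\<dots> \<le> - a - (- b)" by (rule Levy_Inversion_aux2) (use ab False in auto)
    finally show ?thesis by simp
  qed (use ab in simp)
  have ind_mult: "norm (indicator S x *\<^sub>R (c * d)) \<le> norm c * norm d" for S and x :: real and c d :: complex
    by (auto simp: indicator_def norm_mult)
  have lim1: "(\<lambda>T::nat. (CLBINT t=ereal (real_of_int (- int T))..ereal (real T). ?F t * ?\<phi> t)) \<longlonglongrightarrow> (CLINT t|lborel. ?F t * ?\<phi> t)"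
  proof -
    have "(\<lambda>n::nat. (CLINT t|lborel. indicator (einterval (- ereal (real n)) (ereal (real n))) t *\<^sub>R (?F t * ?\<phi> t)))
      \<longlonglongrightarrow> (CLINT t|lborel. ?F t * ?\<phi> t)"
  proof (rule integral_dominated_convergence[where w = "\<lambda>t. (b - a) * norm (?\<phi> t)"])
    show "AE x in lborel. (\<lambda>n. indicator (einterval (- ereal (real n)) (ereal (real n))) x *\<^sub>R (?F x * ?\<phi> x)) \<longlonglongrightarrow> ?F x * ?\<phi> x"
    proof (rule AE_I2)
      fix x :: real
      have "eventually (\<lambda>n. indicator (einterval (- ereal (real n)) (ereal (real n))) x *\<^sub>R (?F x * ?\<phi> x) = ?F x * ?\<phi> x) sequentially"
        using eventually_gt_at_top[of "nat \<lceil>\<bar>x\<bar>\<rceil>"]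
      proof eventually_elim
        case (elim n)
        hence "\<bar>x\<bar> < real n" by linarith
        thus ?case by (auto simp: einterval_def indicator_def)
      qed
      thus "(\<lambda>n. indicator (einterval (- ereal (real n)) (ereal (real n))) x *\<^sub>R (?F x * ?\<phi> x)) \<longlonglongrightarrow> ?F x * ?\<phi> x"
        by (rule tendsto_eventually)
    qed
    show "AE x in lborel. norm (indicator (einterval (- ereal (real n)) (ereal (real n))) x *\<^sub>R (?F x * ?\<phi> x)) \<le> (b - a) * norm (?\<phi> x)" for n
    proof (rule AE_I2)
      fix x :: real
      have "norm (indicator (einterval (- ereal (real n)) (ereal (real n))) x *\<^sub>R (?F x * ?\<phi> x)) \<le> norm (?F x) * norm (?\<phi> x)"
        by (rule ind_mult)
      also have "\<dots> \<le> (b - a) * norm (?\<phi> x)" by (rule mult_right_mono[OF Fb]) simp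
      finally show "norm (indicator (einterval (- ereal (real n)) (ereal (real n))) x *\<^sub>R (?F x * ?\<phi> x)) \<le> (b - a) * norm (?\<phi> x)" .
    qed
  qed (use \<phi> in auto)
    thus ?thesis unfolding interval_lebesgue_integral_def set_lebesgue_integral_def by simp
  qed
  have lim2: "(\<lambda>T::nat. 1 / (2 * pi) * (CLBINT t=-T..T. ?F t * ?\<phi> t)) \<longlonglongrightarrow> complex_of_real (measure M {a<..b})"
    by (rule Levy_Inversion) (use ab atom in auto)
  have eq1: "complex_of_real (measure M {a<..b}) = 1 / (2 * pi) * (CLINT t|lborel. ?F t * ?\<phi> t)"
    by (rule LIMSEQ_unique[OF lim2 tendsto_mult[OF tendsto_const lim1]])
  let ?g = "\<lambda>t s. indicator {a..b} s *\<^sub>R (?\<phi> t * iexp (- (t * s)))"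
  have int2: "integrable (lborel \<Otimes>\<^sub>M lborel) (case_prod ?g)"
  proof (rule lborel_pair.Fubini_integrable)
    show "case_prod ?g \<in> borel_measurable (lborel \<Otimes>\<^sub>M lborel)" by measurable
    have "(LINT s|lborel. norm (case_prod ?g (t, s))) = (b - a) * norm (?\<phi> t)" for t
    proof -
      have "(LINT s|lborel. norm (case_prod ?g (t, s))) = (LINT s|lborel. norm (?\<phi> t) * indicator {a..b} s)"
        by (intro Bochner_Integration.integral_cong refl) (auto simp: indicator_def norm_mult)
      thus ?thesis using ab by simp
    qed
    thus "integrable lborel (\<lambda>t. LINT s|lborel. norm (case_prod ?g (t, s)))" using \<phi> by simp
    show "AE t in lborel. integrable lborel (\<lambda>s. case_prod ?g (t, s))"
    proof (rule AE_I2)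
      fix t :: real
      have "integrable lborel (\<lambda>s. norm (?\<phi> t) * indicator {a..b} s)"
        by (intro integrable_mult_right integrable_real_indicator) (use ab in auto)
      thus "integrable lborel (\<lambda>s. case_prod ?g (t, s))"
        by (rule Bochner_Integration.integrable_bound) (auto simp: indicator_def norm_mult)
    qed
  qed
  have "(CLINT t|lborel. ?F t * ?\<phi> t) = (CLINT t|lborel. (CLINT s|lborel. ?g t s))"
  proof (rule integral_cong_AE)
    show "AE t in lborel. ?F t * ?\<phi> t = (CLINT s|lborel. ?g t s)"
      using AE_lborel_singleton[of "0::real"]
    proof eventually_elim
      case (elim t)
      have "?F t * ?\<phi> t = ?\<phi> t * (CLINT s|lborel. indicator {a..b} s *\<^sub>R iexp (- (t * s)))"
        unfolding integral_iexp_interval[OF ab elim] by (rule mult.commute)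
      also have "\<dots> = (CLINT s|lborel. ?g t s)"
        by (subst integral_mult_right_zero[symmetric]) simp
      finally show ?case .
    qed
  qed measurable
  also have "\<dots> = (CLINT s|lborel. (CLINT t|lborel. ?g t s))"
    by (rule lborel_pair.Fubini_integral[OF int2, symmetric])
  finally have eq2: "complex_of_real (measure M {a<..b}) = 1 / (2 * pi) * (CLINT s|lborel. (CLINT t|lborel. ?g t s))"
    unfolding eq1 by simp
  have int3: "integrable lborel (\<lambda>s. (CLINT t|lborel. ?g t s))"
    using lborel_pair.integrable_snd[OF int2] by simp
  have fi: "Re (CLINT t|lborel. ?g t s) / (2 * pi) = indicator {a..b} s * fourier_inv ?\<phi> s" for s
    unfolding fourier_inv_def by (simp add: indicator_def)
  have "measure M {a<..b} = Re (1 / (2 * pi) * (CLINT s|lborel. (CLINT t|lborel. ?g t s)))"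
    using eq2 by (metis Re_complex_of_real)
  also have "\<dots> = Re (CLINT s|lborel. (CLINT t|lborel. ?g t s)) / (2 * pi)"
  proof -
    have "Re (1 / (2 * complex_of_real pi) * z) = Re z / (2 * pi)" for z
      using Re_divide_of_real[of z "2 * pi"] by (simp add: mult.commute)
    thus ?thesis by simp
  qed
  also have "\<dots> = (LINT s|lborel. Re (CLINT t|lborel. ?g t s) / (2 * pi))"
    by (subst integral_divide_zero) (simp only: integral_Re[OF int3])
  finally show "measure M {a<..b} = (LINT s|lborel. indicator {a..b} s * fourier_inv ?\<phi> s)"
    unfolding fi .
  show "integrable lborel (\<lambda>s. indicator {a..b} s * fourier_inv ?\<phi> s)"
    unfolding fi[symmetric] by (intro integrable_divide integrable_Re int3)
qed

text \<open>The inverse transform is not known to be nonnegative in advance, so its negative part is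
  moved to the other side: its positive part and \<open>J\<close> plus its negative part are
  compared as densities on half-open intervals. Their equality almost everywhere forces the negative
  part to vanish, as both parts cannot be positive at one point.\<close>

theorem density_eq_fourier_inv:
  assumes [measurable]: "J \<in> borel_measurable borel" and M: "real_distribution (density lborel J)"
    and \<phi>: "integrable lborel (char (density lborel J))"
  shows "AE t in lborel. 0 \<le> fourier_inv (char (density lborel J)) t \<and> J t = ennreal (fourier_inv (char (density lborel J)) t)"
proof -
  interpret real_distribution "density lborel J" by fact
  let ?M = "density lborel J"
  let ?g = "fourier_inv (char ?M)"
  have [measurable]: "char ?M \<in> borel_measurable borel" by (rule char_measurable)
  have atom: "measure ?M {x} = 0" for x
  proof -
    have "{x} \<in> null_sets lborel" by (simp add: null_sets_def)
    moreover have "absolutely_continuous lborel ?M" by (rule absolutely_continuousI_density) simp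
    ultimately have "{x} \<in> null_sets ?M" unfolding absolutely_continuous_def by blast
    thus ?thesis by (simp add: null_sets_def measure_def)
  qed
  define A where "A = density lborel (\<lambda>t. ennreal (?g t))"
  define B where "B = density lborel (\<lambda>t. J t + ennreal (- ?g t))"
  have fin: "emeasure A {a<..b} \<noteq> \<infinity> \<and> emeasure A {a<..b} = emeasure B {a<..b}" for a b
  proof (cases "a \<le> b")
    case True
    note L = measure_Ioc_eq_fourier_inv[OF M atom \<phi> True]
    have ae: "AE s in lborel. indicator {a<..b} s = (indicator {a..b} s :: ennreal)"
      using AE_lborel_singleton[of a] by eventually_elim (auto simp: indicator_def)
    have pA: "emeasure A {a<..b} = (\<integral>\<^sup>+ s. ennreal (indicator {a..b} s * ?g s) \<partial>lborel)"
      unfolding A_def using ae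
      by (subst emeasure_density) (auto intro!: nn_integral_cong_AE simp: indicator_def)
    have "emeasure B {a<..b} = (\<integral>\<^sup>+ s. J s * indicator {a<..b} s + ennreal (- ?g s) * indicator {a<..b} s \<partial>lborel)"
      unfolding B_def by (subst emeasure_density) (auto intro!: nn_integral_cong simp: distrib_right)
    also have "\<dots> = emeasure ?M {a<..b} + (\<integral>\<^sup>+ s. ennreal (- ?g s) * indicator {a<..b} s \<partial>lborel)"
      by (subst nn_integral_add) (auto simp: emeasure_density)
    also have "(\<integral>\<^sup>+ s. ennreal (- ?g s) * indicator {a<..b} s \<partial>lborel) = (\<integral>\<^sup>+ s. ennreal (- (indicator {a..b} s * ?g s)) \<partial>lborel)"
      using ae by (intro nn_integral_cong_AE) (auto simp: indicator_def)
    finally have pB: "emeasure B {a<..b} = ennreal (measure ?M {a<..b}) + (\<integral>\<^sup>+ s. ennreal (- (indicator {a..b} s * ?g s)) \<partial>lborel)"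
      by (simp add: emeasure_eq_measure)
    have p: "(\<integral>\<^sup>+ s. ennreal (indicator {a..b} s * ?g s) \<partial>lborel) < \<infinity>"
      "(\<integral>\<^sup>+ s. ennreal (- (indicator {a..b} s * ?g s)) \<partial>lborel) < \<infinity>"
      using L(2) unfolding real_integrable_def by (auto simp: less_top)
    obtain x where x: "x \<ge> 0" "(\<integral>\<^sup>+ s. ennreal (indicator {a..b} s * ?g s) \<partial>lborel) = ennreal x"
      using p(1) by (cases "\<integral>\<^sup>+ s. ennreal (indicator {a..b} s * ?g s) \<partial>lborel") auto
    obtain y where y: "y \<ge> 0" "(\<integral>\<^sup>+ s. ennreal (- (indicator {a..b} s * ?g s)) \<partial>lborel) = ennreal y"
      using p(2) by (cases "\<integral>\<^sup>+ s. ennreal (- (indicator {a..b} s * ?g s)) \<partial>lborel") auto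
    have "measure ?M {a<..b} = x - y"
      unfolding L(1) real_lebesgue_integral_def[OF L(2)] x(2) y(2) using x(1) y(1) by (simp only: enn2real_ennreal)
    moreover have "0 \<le> measure ?M {a<..b}" by simp
    ultimately show ?thesis unfolding pA pB x(2) y(2) using y(1) by (simp flip: ennreal_plus)
  qed simp
  have "A = B"
  proof (rule measure_eqI_generator_eq[where E = "range (\<lambda>(a, b). {a<..b::real})" and \<Omega> = UNIV and A = "\<lambda>i. {- real i<..real i}"])
    show "Int_stable (range (\<lambda>(a, b). {a<..b::real}))"
      by (auto simp: Int_stable_def)
    show "sets A = sigma_sets UNIV (range (\<lambda>(a, b). {a<..b::real}))"
      "sets B = sigma_sets UNIV (range (\<lambda>(a, b). {a<..b::real}))"
      by (simp_all add: A_def B_def borel_sigma_sets_Ioc)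
    show "(\<Union>i. {- real i<..real i}) = UNIV"
    proof (intro set_eqI iffI UNIV_I)
      fix x :: real
      have "\<bar>x\<bar> < real (nat \<lceil>\<bar>x\<bar>\<rceil> + 1)" by linarith
      hence "x \<in> {- real (nat \<lceil>\<bar>x\<bar>\<rceil> + 1)<..real (nat \<lceil>\<bar>x\<bar>\<rceil> + 1)}" by auto
      thus "x \<in> (\<Union>i. {- real i<..real i})" by blast
    qed
    show "emeasure A {- real i<..real i} \<noteq> \<infinity>" for i using fin by blast
    show "emeasure A X = emeasure B X" if "X \<in> range (\<lambda>(a, b). {a<..b::real})" for X
      using that fin by (metis (mono_tags, lifting) case_prod_conv imageE surj_pair)
  qed auto
  hence "AE t in lborel. ennreal (?g t) = J t + ennreal (- ?g t)"
    unfolding A_def B_def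
    by (subst (asm) sigma_finite_measure.density_unique_iff[OF lborel.sigma_finite_measure_axioms]) auto
  thus ?thesis
  proof eventually_elim
    case (elim t)
    show ?case
    proof (cases "0 \<le> ?g t")
      case True
      thus ?thesis using elim by (simp add: ennreal_neg)
    next
      case False
      hence "ennreal (?g t) = 0" "0 < ennreal (- ?g t)" by (auto simp: ennreal_neg)
      thus ?thesis using elim by simp
    qed
  qed
qed

section \<open>The density of a sum of squares, first almost everywhere and then pointwise\<close>

lemma PiM_density:
  fixes f :: "real \<Rightarrow> real"
  assumes [measurable]: "f \<in> borel_measurable borel" and p: "prob_space (density lborel (\<lambda>v. ennreal (f v)))"
    and I: "finite I"
  shows "(\<Pi>\<^sub>M i\<in>I. density lborel (\<lambda>v. ennreal (f v))) = density (lborel_PiM I) (\<lambda>y. \<Prod>i\<in>I. ennreal (f (y i)))"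
proof -
  let ?D = "density lborel (\<lambda>v. ennreal (f v))"
  interpret D: prob_space ?D by fact
  interpret D: product_sigma_finite "\<lambda>_::nat. ?D" by standard
  have [measurable]: "(\<lambda>y. \<Prod>i\<in>I. ennreal (f (y i))) \<in> borel_measurable (lborel_PiM I)"
    by measurable
  show ?thesis
  proof (rule D.PiM_eqI[OF I, symmetric])
    show "sets (density (lborel_PiM I) (\<lambda>y. \<Prod>i\<in>I. ennreal (f (y i)))) = sets (\<Pi>\<^sub>M i\<in>I. ?D)"
      by (simp cong: sets_PiM_cong)
    fix A assume "\<And>i. i \<in> I \<Longrightarrow> A i \<in> sets ?D"
    hence A [measurable]: "i \<in> I \<Longrightarrow> A i \<in> sets borel" for i by simp
    have AP: "Pi\<^sub>E I A \<in> sets (lborel_PiM I)" by (rule sets_PiM_I_finite) (use I A in auto)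
    have "emeasure (density (lborel_PiM I) (\<lambda>y. \<Prod>i\<in>I. ennreal (f (y i)))) (Pi\<^sub>E I A) =
      (\<integral>\<^sup>+ y. (\<Prod>i\<in>I. ennreal (f (y i))) * indicator (Pi\<^sub>E I A) y \<partial>lborel_PiM I)"
      by (rule emeasure_density) (use AP in auto)
    also have "\<dots> = (\<integral>\<^sup>+ y. (\<Prod>i\<in>I. ennreal (f (y i)) * indicator (A i) (y i)) \<partial>lborel_PiM I)"
    proof (rule nn_integral_cong)
      fix y assume y: "y \<in> space (lborel_PiM I)"
      have "indicator (Pi\<^sub>E I A) y = (\<Prod>i\<in>I. indicator (A i) (y i) :: ennreal)"
      proof (cases "y \<in> Pi\<^sub>E I A")
        case True
        thus ?thesis by (simp add: PiE_iff)
      next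
        case False
        then obtain i where "i \<in> I" "y i \<notin> A i" using y by (auto simp: space_PiM PiE_iff)
        thus ?thesis using False I by (auto simp: indicator_def)
      qed
      thus "(\<Prod>i\<in>I. ennreal (f (y i))) * indicator (Pi\<^sub>E I A) y = (\<Prod>i\<in>I. ennreal (f (y i)) * indicator (A i) (y i))"
        by (simp add: prod.distrib)
    qed
    also have "\<dots> = (\<Prod>i\<in>I. (\<integral>\<^sup>+ v. ennreal (f v) * indicator (A i) v \<partial>lborel))"
      by (rule lborel_product.product_nn_integral_prod) (use I in auto)
    also have "\<dots> = (\<Prod>i\<in>I. emeasure ?D (A i))"
      by (intro prod.cong refl) (simp add: emeasure_density)
    finally show "emeasure (density (lborel_PiM I) (\<lambda>y. \<Prod>i\<in>I. ennreal (f (y i)))) (Pi\<^sub>E I A) = (\<Prod>i\<in>I. emeasure ?D (A i))" .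
  qed
qed

lemma sphere_integral_cmult:
  assumes "finite I" and [measurable]: "G \<in> borel_measurable (lborel_PiM I)"
  shows "sphere_integral I t (\<lambda>y. c * G y) = c * sphere_integral I t G"
proof -
  have "(\<integral>\<^sup>+ y. indicator {y. sq_norm I y \<le> 1} y * (c * G (radial I t y)) \<partial>lborel_PiM I) =
    (\<integral>\<^sup>+ y. c * (indicator {y. sq_norm I y \<le> 1} y * G (radial I t y)) \<partial>lborel_PiM I)"
    by (simp only: mult_ac)
  also have "\<dots> = c * (\<integral>\<^sup>+ y. indicator {y. sq_norm I y \<le> 1} y * G (radial I t y) \<partial>lborel_PiM I)"
    by (rule nn_integral_cmult) measurable
  finally show ?thesis unfolding sphere_integral_def by (simp only: mult_ac)
qed

lemma sphere_integral_cong: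
  assumes "finite I" "I \<noteq> {}"
    and "\<And>y. y \<in> space (lborel_PiM I) \<Longrightarrow> sq_norm I y = t \<Longrightarrow> G y = H y"
  shows "sphere_integral I t G = sphere_integral I t H"
proof (cases "t > 0")
  case True
  have "(\<integral>\<^sup>+ y. indicator {y. sq_norm I y \<le> 1} y * G (radial I t y) \<partial>lborel_PiM I) =
    (\<integral>\<^sup>+ y. indicator {y. sq_norm I y \<le> 1} y * H (radial I t y) \<partial>lborel_PiM I)"
  proof (rule nn_integral_cong_AE, use AE_sq_norm_pos[OF assms(1,2)] in eventually_elim)
    case (elim y)
    have "radial I t y \<in> space (lborel_PiM I)" by (simp add: radial_def space_PiM)
    thus ?case using True elim by (simp add: assms(3) sq_norm_radial)
  qed
  thus ?thesis by (simp add: sphere_integral_def)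
qed (simp add: sphere_integral_def)

locale real_density =
  fixes f :: "real \<Rightarrow> real"
  assumes f_measurable [measurable]: "f \<in> borel_measurable borel" and f_nonneg: "0 \<le> f v"
    and f_integral: "(LINT v|lborel. f v) = 1"
begin

lemma f_integrable: "integrable lborel f"
  using f_integral by (metis not_integrable_integral_eq zero_neq_one)

lemma nn_integral_f: "(\<integral>\<^sup>+ v. ennreal (f v) \<partial>lborel) = 1"
  using f_nonneg f_integral f_integrable by (subst nn_integral_eq_integral) auto

sublocale prob_space "density lborel (\<lambda>v. ennreal (f v))"
  by (intro prob_spaceI) (simp add: emeasure_density nn_integral_f)

text \<open>The density of \<open>sq_norm I\<close> under the tensor power of \<open>f\<close>, in a
  version defined at each point through the ball, because its value at the single point
  \<open>N\<close> is needed.\<close>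

definition sq_law_density :: "nat set \<Rightarrow> real \<Rightarrow> ennreal" where
  "sq_law_density I t = sphere_integral I t (\<lambda>y. \<Prod>i\<in>I. ennreal (f (y i)))"

lemma tensor_measurable: "(\<lambda>y. \<Prod>i\<in>I. ennreal (f (y i))) \<in> borel_measurable (lborel_PiM I)"
  by measurable

text \<open>An indicator of the squared radius is constant on each sphere, so it can be moved inside
  the sphere integral; the polar decomposition does the rest.\<close>

lemma density_sq_law_density:
  assumes I: "finite I" "I \<noteq> {}"
  shows "density lborel (sq_law_density I) = distr (\<Pi>\<^sub>M i\<in>I. density lborel (\<lambda>v. ennreal (f v))) borel (sq_norm I)"
proof (rule measure_eqI)
  let ?P = "\<lambda>y. \<Prod>i\<in>I. ennreal (f (y i))"
  note tensor_measurable[measurable]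
  have J [measurable]: "sq_law_density I \<in> borel_measurable borel"
    unfolding sq_law_density_def using I by measurable
  have PD: "(\<Pi>\<^sub>M i\<in>I. density lborel (\<lambda>v. ennreal (f v))) = density (lborel_PiM I) ?P"
    by (rule PiM_density) (use I in \<open>auto intro: prob_space_axioms\<close>)
  fix A assume "A \<in> sets (density lborel (sq_law_density I))"
  hence A [measurable]: "A \<in> sets borel" by simp
  have "emeasure (density lborel (sq_law_density I)) A = (\<integral>\<^sup>+ t. indicator A t * sq_law_density I t \<partial>lborel)"
    by (subst emeasure_density) (auto simp: mult.commute)
  also have "\<dots> = (\<integral>\<^sup>+ t. sphere_integral I t (\<lambda>y. indicator A (sq_norm I y) * ?P y) \<partial>lborel)"
  proof (rule nn_integral_cong)
    fix t :: real
    have "indicator A t * sq_law_density I t = sphere_integral I t (\<lambda>y. indicator A t * ?P y)"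
      unfolding sq_law_density_def by (rule sphere_integral_cmult[symmetric]) (use I in auto)
    also have "\<dots> = sphere_integral I t (\<lambda>y. indicator A (sq_norm I y) * ?P y)"
      by (rule sphere_integral_cong) (use I in auto)
    finally show "indicator A t * sq_law_density I t = sphere_integral I t (\<lambda>y. indicator A (sq_norm I y) * ?P y)" .
  qed
  also have "\<dots> = (\<integral>\<^sup>+ y. indicator A (sq_norm I y) * ?P y \<partial>lborel_PiM I)"
    by (rule nn_integral_polar[symmetric]) (use I in auto)
  also have "\<dots> = (\<integral>\<^sup>+ y. indicator A (sq_norm I y) \<partial>density (lborel_PiM I) ?P)"
    by (subst nn_integral_density) (auto simp: mult.commute)
  also have "\<dots> = (\<integral>\<^sup>+ t. indicator A t \<partial>distr (density (lborel_PiM I) ?P) borel (sq_norm I))"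
    by (rule nn_integral_distr[symmetric]) auto
  also have "\<dots> = emeasure (distr (density (lborel_PiM I) ?P) borel (sq_norm I)) A"
    by (rule nn_integral_indicator) simp
  finally show "emeasure (density lborel (sq_law_density I)) A =
      emeasure (distr (\<Pi>\<^sub>M i\<in>I. density lborel (\<lambda>v. ennreal (f v))) borel (sq_norm I)) A"
    unfolding PD .
qed simp

lemma
  assumes I: "finite I" "I \<noteq> {}"
  shows real_distribution_sq_law: "real_distribution (density lborel (sq_law_density I))"
    and char_sq_law: "char (density lborel (sq_law_density I)) \<xi> = char (square_law f) \<xi> ^ card I"
proof -
  let ?D = "density lborel (\<lambda>v. ennreal (f v))"
  let ?PM = "\<Pi>\<^sub>M i\<in>I. ?D"
  interpret D: product_sigma_finite "\<lambda>_::nat. ?D" by standard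
  have PMs: "sets ?PM = sets (lborel_PiM I)" by (rule sets_PiM_cong) auto
  have q [measurable]: "sq_norm I \<in> borel_measurable ?PM"
    using sq_norm_measurable[of I] by (simp cong: measurable_cong_sets add: PMs)
  have "prob_space ?PM" by (rule prob_space_PiM) (rule prob_space_axioms)
  hence "prob_space (distr ?PM borel (sq_norm I))" by (rule prob_space.prob_space_distr) simp
  thus "real_distribution (density lborel (sq_law_density I))"
    unfolding density_sq_law_density[OF I]
    by (simp add: real_distribution_def real_distribution_axioms_def)
  have i: "integrable ?D (\<lambda>v. iexp (\<xi> * v\<^sup>2))"
    by (rule integrable_const_bound[of _ 1]) auto
  have "char (distr ?PM borel (sq_norm I)) \<xi> = (CLINT y|?PM. iexp (\<xi> * sq_norm I y))"
    unfolding char_def by (rule integral_distr) (use q in auto)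
  also have "\<dots> = (CLINT y|?PM. (\<Prod>i\<in>I. iexp (\<xi> * (y i)\<^sup>2)))"
    using I by (simp add: sq_norm_def sum_distrib_left exp_sum)
  also have "\<dots> = (\<Prod>i\<in>I. (CLINT v|?D. iexp (\<xi> * v\<^sup>2)))"
    by (rule D.product_integral_prod) (use I i in auto)
  also have "(CLINT v|?D. iexp (\<xi> * v\<^sup>2)) = char (square_law f) \<xi>"
    unfolding char_def square_law_def by (rule integral_distr[symmetric]) auto
  finally show "char (density lborel (sq_law_density I)) \<xi> = char (square_law f) \<xi> ^ card I"
    unfolding density_sq_law_density[OF I] by simp
qed

lemma AE_sq_law_density:
  assumes I: "finite I" "I \<noteq> {}" and int: "integrable lborel (\<lambda>\<xi>. char (square_law f) \<xi> ^ card I)"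
  shows "AE t in lborel. 0 \<le> fourier_inv (\<lambda>\<xi>. char (square_law f) \<xi> ^ card I) t \<and>
    sq_law_density I t = ennreal (fourier_inv (\<lambda>\<xi>. char (square_law f) \<xi> ^ card I) t)"
proof -
  have c: "char (density lborel (sq_law_density I)) = (\<lambda>\<xi>. char (square_law f) \<xi> ^ card I)"
    using char_sq_law[OF I] by auto
  have "sq_law_density I \<in> borel_measurable borel"
    unfolding sq_law_density_def using I tensor_measurable[of I] by measurable
  from density_eq_fourier_inv[OF this real_distribution_sq_law[OF I]] int
  show ?thesis unfolding c by simp
qed

text \<open>The recursion splits off the coordinate \<open>i\<close>. The density of the other
  squares is identified only almost everywhere, but it now stands under an integral over
  \<open>v\<close>, evaluated along \<open>t - v^2\<close>; the formula is therefore exact at every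
  positive \<open>t\<close>.\<close>

lemma sphere_integral_tensor:
  assumes I: "finite I" "I \<noteq> {}" "i \<notin> I" and int: "integrable lborel (\<lambda>\<xi>. char (square_law f) \<xi> ^ card I)"
    and t: "t > 0" and [measurable]: "h \<in> borel_measurable borel"
  shows "sphere_integral (insert i I) t (\<lambda>y. h (y i) * (\<Prod>j\<in>insert i I. ennreal (f (y j)))) =
    (\<integral>\<^sup>+ v. h v * ennreal (f v * fourier_inv (\<lambda>\<xi>. char (square_law f) \<xi> ^ card I) (t - v\<^sup>2)) \<partial>lborel)"
proof -
  let ?g = "fourier_inv (\<lambda>\<xi>. char (square_law f) \<xi> ^ card I)"
  note tensor_measurable[measurable]
  have "sphere_integral (insert i I) t (\<lambda>y. h (y i) * (\<Prod>j\<in>insert i I. ennreal (f (y j)))) =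
    (\<integral>\<^sup>+ v. sphere_integral I (t - v\<^sup>2) (\<lambda>y. h ((y(i := v)) i) * (\<Prod>j\<in>insert i I. ennreal (f ((y(i := v)) j)))) \<partial>lborel)"
    by (rule sphere_integral_insert) (use I t in auto)
  also have "\<dots> = (\<integral>\<^sup>+ v. h v * ennreal (f v) * sq_law_density I (t - v\<^sup>2) \<partial>lborel)"
  proof (rule nn_integral_cong)
    fix v :: real
    have "(\<Prod>j\<in>insert i I. ennreal (f ((y(i := v)) j))) = ennreal (f v) * (\<Prod>j\<in>I. ennreal (f (y j)))" for y
    proof -
      have "(\<Prod>j\<in>I. ennreal (f ((y(i := v)) j))) = (\<Prod>j\<in>I. ennreal (f (y j)))"
        by (rule prod.cong) (use I in auto)
      thus ?thesis using I by simp
    qed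
    hence "(\<lambda>y. h ((y(i := v)) i) * (\<Prod>j\<in>insert i I. ennreal (f ((y(i := v)) j)))) =
      (\<lambda>y. (h v * ennreal (f v)) * (\<Prod>j\<in>I. ennreal (f (y j))))"
      by (simp add: mult.assoc)
    thus "sphere_integral I (t - v\<^sup>2) (\<lambda>y. h ((y(i := v)) i) * (\<Prod>j\<in>insert i I. ennreal (f ((y(i := v)) j)))) =
      h v * ennreal (f v) * sq_law_density I (t - v\<^sup>2)"
      unfolding sq_law_density_def using I by (simp only:) (rule sphere_integral_cmult, auto)
  qed
  also have "\<dots> = (\<integral>\<^sup>+ v. h v * ennreal (f v * ?g (t - v\<^sup>2)) \<partial>lborel)"
  proof (rule nn_integral_cong_AE, use AE_minus_square[OF AE_sq_law_density[OF I(1,2) int], of t] in eventually_elim)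
    case (elim v)
    thus ?case using f_nonneg[of v] by (simp add: ennreal_mult mult.assoc)
  qed
  finally show ?thesis .
qed

text \<open>Adding one independent square convolves the density with the law of that square; by
  Fubini this is one more factor of the characteristic function.\<close>

lemma fourier_inv_convolution:
  assumes int: "integrable lborel (\<lambda>\<xi>. char (square_law f) \<xi> ^ n)"
  shows "integrable lborel (\<lambda>v. f v * fourier_inv (\<lambda>\<xi>. char (square_law f) \<xi> ^ n) (t - v\<^sup>2))"
    and "(LINT v|lborel. f v * fourier_inv (\<lambda>\<xi>. char (square_law f) \<xi> ^ n) (t - v\<^sup>2)) =
      fourier_inv (\<lambda>\<xi>. char (square_law f) \<xi> ^ Suc n) t"
proof -
  interpret R: real_distribution "square_law f"
    by (rule real_distribution_square_law) (use f_nonneg f_integral in auto)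
  let ?\<phi> = "char (square_law f)"
  have [measurable]: "?\<phi> \<in> borel_measurable borel" by (rule R.char_measurable)
  let ?k = "\<lambda>v \<xi>. f v *\<^sub>R (?\<phi> \<xi> ^ n * iexp (- (\<xi> * (t - v\<^sup>2))))"
  have int2: "integrable (lborel \<Otimes>\<^sub>M lborel) (case_prod ?k)"
  proof (rule lborel_pair.Fubini_integrable)
    show "case_prod ?k \<in> borel_measurable (lborel \<Otimes>\<^sub>M lborel)" by measurable
    have "(LINT \<xi>|lborel. norm (case_prod ?k (v, \<xi>))) = f v * (LINT \<xi>|lborel. norm (?\<phi> \<xi> ^ n))" for v
    proof -
      have "(LINT \<xi>|lborel. norm (case_prod ?k (v, \<xi>))) = (LINT \<xi>|lborel. f v * norm (?\<phi> \<xi> ^ n))"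
        using f_nonneg[of v] by (intro Bochner_Integration.integral_cong refl) (simp add: norm_mult del: of_real_mult of_real_diff)
      thus ?thesis by simp
    qed
    thus "integrable lborel (\<lambda>v. LINT \<xi>|lborel. norm (case_prod ?k (v, \<xi>)))" using f_integrable by simp
    show "AE v in lborel. integrable lborel (\<lambda>\<xi>. case_prod ?k (v, \<xi>))"
    proof (rule AE_I2)
      fix v :: real
      have "integrable lborel (\<lambda>\<xi>. f v * norm (?\<phi> \<xi> ^ n))" using int by simp
      thus "integrable lborel (\<lambda>\<xi>. case_prod ?k (v, \<xi>))"
        by (rule Bochner_Integration.integrable_bound) (use f_nonneg[of v] in \<open>auto simp: norm_mult simp del: of_real_mult of_real_diff\<close>)
    qed
  qed
  have int3: "integrable lborel (\<lambda>v. (CLINT \<xi>|lborel. ?k v \<xi>))"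
    using lborel_pair.integrable_fst[OF int2] by simp
  have fi: "Re (CLINT \<xi>|lborel. ?k v \<xi>) / (2 * pi) = f v * fourier_inv (\<lambda>\<xi>. ?\<phi> \<xi> ^ n) (t - v\<^sup>2)" for v
    unfolding fourier_inv_def by simp
  show "integrable lborel (\<lambda>v. f v * fourier_inv (\<lambda>\<xi>. ?\<phi> \<xi> ^ n) (t - v\<^sup>2))"
    unfolding fi[symmetric] by (intro integrable_divide integrable_Re int3)
  have "(CLINT v|lborel. (CLINT \<xi>|lborel. ?k v \<xi>)) = (CLINT \<xi>|lborel. (CLINT v|lborel. ?k v \<xi>))"
    by (rule lborel_pair.Fubini_integral[OF int2, symmetric])
  also have "\<dots> = (CLINT \<xi>|lborel. ?\<phi> \<xi> ^ Suc n * iexp (- (\<xi> * t)))"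
  proof (intro Bochner_Integration.integral_cong refl)
    fix \<xi> :: real
    have "(CLINT v|lborel. ?k v \<xi>) = (CLINT v|lborel. (?\<phi> \<xi> ^ n * iexp (- (\<xi> * t))) * (f v *\<^sub>R iexp (\<xi> * v\<^sup>2)))"
    proof (intro Bochner_Integration.integral_cong refl)
      fix v :: real
      have "iexp (- (\<xi> * (t - v\<^sup>2))) = iexp (- (\<xi> * t)) * iexp (\<xi> * v\<^sup>2)"
        by (simp flip: exp_add add: algebra_simps)
      thus "?k v \<xi> = (?\<phi> \<xi> ^ n * iexp (- (\<xi> * t))) * (f v *\<^sub>R iexp (\<xi> * v\<^sup>2))"
        by (simp only: mult_scaleR_right mult.assoc)
    qed
    also have "\<dots> = (?\<phi> \<xi> ^ n * iexp (- (\<xi> * t))) * (CLINT v|lborel. f v *\<^sub>R iexp (\<xi> * v\<^sup>2))"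
      by (rule integral_mult_right_zero)
    also have "(CLINT v|lborel. f v *\<^sub>R iexp (\<xi> * v\<^sup>2)) = ?\<phi> \<xi>"
      unfolding char_def by (rule integral_square_law(1)[symmetric]) (use f_nonneg in auto)
    finally show "(CLINT v|lborel. ?k v \<xi>) = ?\<phi> \<xi> ^ Suc n * iexp (- (\<xi> * t))"
      by (simp only: power_Suc2 mult_ac)
  qed
  finally have eq: "(CLINT v|lborel. (CLINT \<xi>|lborel. ?k v \<xi>)) = (CLINT \<xi>|lborel. ?\<phi> \<xi> ^ Suc n * iexp (- (\<xi> * t)))" .
  have "(LINT v|lborel. f v * fourier_inv (\<lambda>\<xi>. ?\<phi> \<xi> ^ n) (t - v\<^sup>2)) = (LINT v|lborel. Re (CLINT \<xi>|lborel. ?k v \<xi>) / (2 * pi))"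
    unfolding fi ..
  also have "\<dots> = (LINT v|lborel. Re (CLINT \<xi>|lborel. ?k v \<xi>)) / (2 * pi)"
    by (rule integral_divide_zero)
  also have "(LINT v|lborel. Re (CLINT \<xi>|lborel. ?k v \<xi>)) = Re (CLINT v|lborel. (CLINT \<xi>|lborel. ?k v \<xi>))"
    by (rule integral_Re[OF int3])
  finally show "(LINT v|lborel. f v * fourier_inv (\<lambda>\<xi>. ?\<phi> \<xi> ^ n) (t - v\<^sup>2)) = fourier_inv (\<lambda>\<xi>. ?\<phi> \<xi> ^ Suc n) t"
    unfolding eq fourier_inv_def .
qed

text \<open>For \<open>I\<close> alone the inverse transform is known to be the density almost
  everywhere. Integration over the added coordinate averages the exceptional set away, which
  upgrades the identity to every positive point.\<close>

lemma sq_law_density_insert: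
  assumes I: "finite I" "I \<noteq> {}" "i \<notin> I" and int: "integrable lborel (\<lambda>\<xi>. char (square_law f) \<xi> ^ card I)"
    and t: "t > 0"
  shows "sq_law_density (insert i I) t = ennreal (fourier_inv (\<lambda>\<xi>. char (square_law f) \<xi> ^ Suc (card I)) t)"
proof -
  let ?g = "fourier_inv (\<lambda>\<xi>. char (square_law f) \<xi> ^ card I)"
  have "sq_law_density (insert i I) t = (\<integral>\<^sup>+ v. ennreal (f v * ?g (t - v\<^sup>2)) \<partial>lborel)"
    using sphere_integral_tensor[OF I int t, of "\<lambda>_. 1"] by (simp add: sq_law_density_def)
  also have "\<dots> = ennreal (LINT v|lborel. f v * ?g (t - v\<^sup>2))"
  proof (rule nn_integral_eq_integral[OF fourier_inv_convolution(1)[OF int]])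
    show "AE v in lborel. 0 \<le> f v * ?g (t - v\<^sup>2)"
      using AE_minus_square[OF AE_sq_law_density[OF I(1,2) int], of t]
    proof eventually_elim
      case (elim v)
      from elim have "0 \<le> ?g (t - v\<^sup>2)" by (rule conjunct1)
      thus ?case by (rule mult_nonneg_nonneg[OF f_nonneg])
    qed
  qed
  also have "(LINT v|lborel. f v * ?g (t - v\<^sup>2)) = fourier_inv (\<lambda>\<xi>. char (square_law f) \<xi> ^ Suc (card I)) t"
    by (rule fourier_inv_convolution(2)[OF int])
  finally show ?thesis .
qed

end

section \<open>Relative entropy of the conditioned tensor product\<close>

lemma rel_entropy_density:
  assumes "sigma_finite_measure \<nu>" and [measurable]: "g \<in> borel_measurable \<nu>" and g0: "\<And>x. 0 \<le> g x"
    and int: "integrable \<nu> (\<lambda>x. g x * ln (g x))"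
  shows "rel_entropy (density \<nu> (\<lambda>x. ennreal (g x))) \<nu> = ereal (LINT x|\<nu>. g x * ln (g x))"
proof -
  interpret sigma_finite_measure \<nu> by fact
  let ?\<mu> = "density \<nu> (\<lambda>x. ennreal (g x))"
  have ac: "absolutely_continuous \<nu> ?\<mu>" by (rule absolutely_continuousI_density) measurable
  have "AE x in \<nu>. ennreal (g x) = RN_deriv \<nu> ?\<mu> x" by (rule RN_deriv_unique) auto
  hence h: "AE x in \<nu>. enn2real (RN_deriv \<nu> ?\<mu> x) = g x"
    by eventually_elim (metis enn2real_ennreal g0)
  have pos: "(\<integral>\<^sup>+ x. ennreal (enn2real (RN_deriv \<nu> ?\<mu> x) * ln (enn2real (RN_deriv \<nu> ?\<mu> x))) \<partial>\<nu>) =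
      (\<integral>\<^sup>+ x. ennreal (g x * ln (g x)) \<partial>\<nu>)"
    by (rule nn_integral_cong_AE, use h in eventually_elim) simp
  have neg: "(\<integral>\<^sup>+ x. ennreal (- (enn2real (RN_deriv \<nu> ?\<mu> x) * ln (enn2real (RN_deriv \<nu> ?\<mu> x)))) \<partial>\<nu>) =
      (\<integral>\<^sup>+ x. ennreal (- (g x * ln (g x))) \<partial>\<nu>)"
    by (rule nn_integral_cong_AE, use h in eventually_elim) simp
  have fin: "(\<integral>\<^sup>+ x. ennreal (g x * ln (g x)) \<partial>\<nu>) < \<infinity>" "(\<integral>\<^sup>+ x. ennreal (- (g x * ln (g x))) \<partial>\<nu>) < \<infinity>"
    using int unfolding real_integrable_def by (auto simp: less_top)
  obtain x where x: "x \<ge> 0" "(\<integral>\<^sup>+ x. ennreal (g x * ln (g x)) \<partial>\<nu>) = ennreal x"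
    using fin(1) by (cases "\<integral>\<^sup>+ x. ennreal (g x * ln (g x)) \<partial>\<nu>") auto
  obtain y where y: "y \<ge> 0" "(\<integral>\<^sup>+ x. ennreal (- (g x * ln (g x))) \<partial>\<nu>) = ennreal y"
    using fin(2) by (cases "\<integral>\<^sup>+ x. ennreal (- (g x * ln (g x))) \<partial>\<nu>") auto
  have "(LINT x|\<nu>. g x * ln (g x)) = x - y"
    unfolding real_lebesgue_integral_def[OF int] x(2) y(2) using x(1) y(1) by simp
  thus ?thesis
    unfolding rel_entropy_def Let_def pos neg x(2) y(2) using ac x(1) y(1) by simp
qed

lemma std_normal_real_density: "real_density std_normal_density"
proof
  show "(LINT v|lborel. std_normal_density v) = 1"
    using integral_normal_density[of 1 0] by simp
qed auto

interpretation gauss: real_density std_normal_density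
  by (rule std_normal_real_density)

lemma tensor_power_std_normal:
  assumes "y \<in> kac_sphere N"
  shows "tensor_power std_normal_density N y = (1 / sqrt (2 * pi)) ^ N * exp (- real N / 2)"
proof -
  have "tensor_power std_normal_density N y = (\<Prod>i<N. (1 / sqrt (2 * pi)) * exp (- (y i)\<^sup>2 / 2))"
    by (simp add: tensor_power_def std_normal_density_def)
  also have "\<dots> = (1 / sqrt (2 * pi)) ^ N * exp (\<Sum>i<N. - (y i)\<^sup>2 / 2)"
    by (simp only: prod.distrib prod_constant card_lessThan exp_sum finite_lessThan)
  also have "(\<Sum>i<N. - (y i)\<^sup>2 / 2) = - real N / 2"
    using assms by (simp add: kac_sphere_def sum_divide_distrib[symmetric] sum_negf)
  finally show ?thesis .
qed

section \<open>Partition function, marginals and entropy of the conditioned product\<close>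

definition log_ratio :: "(real \<Rightarrow> real) \<Rightarrow> real \<Rightarrow> real" where
  "log_ratio f v = ln (f v / std_normal_density v)"

lemma log_ratio_measurable [measurable]:
  assumes [measurable]: "f \<in> borel_measurable borel"
  shows "log_ratio f \<in> borel_measurable borel"
  unfolding log_ratio_def std_normal_density_def by measurable

context real_density
begin

text \<open>The \<open>s n\<close> of the overview, in the version fixed by Fourier
  inversion.\<close>

definition sum_density :: "nat \<Rightarrow> real \<Rightarrow> real" where
  "sum_density n = fourier_inv (\<lambda>\<xi>. char (square_law f) \<xi> ^ n)"

lemma sum_density_measurable [measurable]: "sum_density n \<in> borel_measurable borel"
proof -
  interpret R: real_distribution "square_law f"
    by (rule real_distribution_square_law) (use f_nonneg f_integral in auto)
  have [measurable]: "char (square_law f) \<in> borel_measurable borel" by (rule R.char_measurable)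
  show ?thesis unfolding sum_density_def by measurable
qed

lemma tensor_power_measurable [measurable]: "tensor_power f N \<in> borel_measurable (kac_sigma N)"
proof -
  have "tensor_power f N \<in> borel_measurable (\<Pi>\<^sub>M i\<in>{..<N}. borel)"
    unfolding tensor_power_def by measurable
  thus ?thesis by (simp add: kac_sigma_def)
qed

lemma tensor_power_nonneg: "0 \<le> tensor_power f N y"
  unfolding tensor_power_def by (rule prod_nonneg) (simp add: f_nonneg)

text \<open>Taking \<open>I = {..<N} - {i}\<close> in the recursion reduces the integral over the
  sphere to one over the coordinate \<open>i\<close>. The total sphere integral stays symbolic: it
  cancels in the marginal, and in the quotient of the partition functions of \<open>f\<close> and
  the Gaussian.\<close>

lemma nn_integral_kac_sigma_tensor:
  assumes N: "2 \<le> N" "i < N" and int: "integrable lborel (\<lambda>\<xi>. char (square_law f) \<xi> ^ (N - 1))"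
    and [measurable]: "h \<in> borel_measurable borel"
  shows "(\<integral>\<^sup>+ y. h (y i) * ennreal (tensor_power f N y) \<partial>kac_sigma N) =
    (\<integral>\<^sup>+ v. h v * ennreal (f v * sum_density (N - 1) (real N - v\<^sup>2)) \<partial>lborel) / sphere_integral {..<N} N (\<lambda>_. 1)"
    and "(\<integral>\<^sup>+ v. ennreal (f v * sum_density (N - 1) (real N - v\<^sup>2)) \<partial>lborel) = ennreal (sum_density N N)"
proof -
  define I where "I = {..<N} - {i}"
  have I: "finite I" "i \<notin> I" "insert i I = {..<N}" "card I = N - 1" "I \<noteq> {}"
  proof -
    show "insert i I = {..<N}" using N by (auto simp: I_def)
    show c: "card I = N - 1" using N by (simp add: I_def)
    show "I \<noteq> {}" using c N by auto
  qed (auto simp: I_def)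
  have S: "Suc (N - 1) = N" using N by simp
  note int' = int[folded I(4)]
  have [measurable]: "(\<lambda>y. h (y i)) \<in> borel_measurable (\<Pi>\<^sub>M i\<in>{..<N}. borel)"
    by (rule measurable_compose[OF measurable_component_singleton]) (use N in auto)
  have T: "(\<lambda>y. h (y i) * ennreal (tensor_power f N y)) = (\<lambda>y. h (y i) * (\<Prod>j\<in>insert i I. ennreal (f (y j))))"
    unfolding tensor_power_def I(3) using f_nonneg by (simp add: prod_ennreal)
  have "(\<integral>\<^sup>+ y. h (y i) * ennreal (tensor_power f N y) \<partial>kac_sigma N) =
    sphere_integral {..<N} N (\<lambda>y. h (y i) * ennreal (tensor_power f N y)) / sphere_integral {..<N} N (\<lambda>_. 1)"
    by (rule nn_integral_kac_sigma) (use N in \<open>auto simp: tensor_power_def\<close>)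
  also have "sphere_integral {..<N} N (\<lambda>y. h (y i) * ennreal (tensor_power f N y)) = (\<integral>\<^sup>+ v. h v * ennreal (f v * sum_density (N - 1) (real N - v\<^sup>2)) \<partial>lborel)"
    using sphere_integral_tensor[OF I(1,5,2) int', of N h] N unfolding T I(3,4) sum_density_def by simp
  finally show "(\<integral>\<^sup>+ y. h (y i) * ennreal (tensor_power f N y) \<partial>kac_sigma N) =
    (\<integral>\<^sup>+ v. h v * ennreal (f v * sum_density (N - 1) (real N - v\<^sup>2)) \<partial>lborel) / sphere_integral {..<N} N (\<lambda>_. 1)" .
  have "sphere_integral {..<N} N (\<lambda>y. 1 * (\<Prod>j<N. ennreal (f (y j)))) =
      (\<integral>\<^sup>+ v. 1 * ennreal (f v * sum_density (N - 1) (real N - v\<^sup>2)) \<partial>lborel)"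
    using sphere_integral_tensor[OF I(1,5,2) int', of N "\<lambda>_. 1"] N unfolding I(3,4) sum_density_def by simp
  moreover have "sphere_integral {..<N} N (\<lambda>y. \<Prod>j<N. ennreal (f (y j))) = ennreal (sum_density N N)"
    using sq_law_density_insert[OF I(1,5,2) int', of N] N unfolding I(3,4) S sum_density_def sq_law_density_def by simp
  ultimately show "(\<integral>\<^sup>+ v. ennreal (f v * sum_density (N - 1) (real N - v\<^sup>2)) \<partial>lborel) = ennreal (sum_density N N)"
    by simp
qed

lemma partition_function:
  assumes N: "2 \<le> N" and int: "integrable lborel (\<lambda>\<xi>. char (square_law f) \<xi> ^ (N - 1))"
  shows "(\<integral>\<^sup>+ y. ennreal (tensor_power f N y) \<partial>kac_sigma N) =
    ennreal (sum_density N N) / sphere_integral {..<N} N (\<lambda>_. 1)"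
  using nn_integral_kac_sigma_tensor[OF N _ int, of 0 "\<lambda>_. 1"] N by simp

lemma sum_density_AE_nonneg:
  assumes N: "2 \<le> N" and int: "integrable lborel (\<lambda>\<xi>. char (square_law f) \<xi> ^ (N - 1))"
  shows "AE v in lborel. 0 \<le> sum_density (N - 1) (real N - v\<^sup>2)"
proof -
  have c: "card {..<N - 1} = N - 1" by simp
  have "AE t in lborel. 0 \<le> sum_density (N - 1) t"
    unfolding sum_density_def using AE_sq_law_density[of "{..<N - 1}"] int N unfolding c
    by (auto simp: lessThan_empty_iff)
  thus ?thesis by (rule AE_minus_square)
qed

text \<open>Both the integral of \<open>h (y i)\<close> and the partition function carry the factor
  \<open>1 / k\<close>, so only \<open>sum_density\<close> survives in the density of the marginal.
  That density is nonnegative only almost everywhere, which suffices to transfer Bochner integrals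
  of \<open>X\<close>.\<close>

lemma conditioned_tensor_marginal:
  fixes X :: "real \<Rightarrow> real"
  assumes N: "2 \<le> N" "i < N" and int: "integrable lborel (\<lambda>\<xi>. char (square_law f) \<xi> ^ (N - 1))"
    and pos: "0 < sum_density N N" and X [measurable]: "X \<in> borel_measurable borel"
    and intX: "integrable lborel (\<lambda>v. f v * X v * (sum_density (N - 1) (real N - v\<^sup>2) / sum_density N N))"
  shows "prob_space (conditioned_tensor f N)"
    and "integrable (conditioned_tensor f N) (\<lambda>y. X (y i))"
    and "(LINT y|conditioned_tensor f N. X (y i)) =
      (LINT v|lborel. f v * X v * (sum_density (N - 1) (real N - v\<^sup>2) / sum_density N N))"
proof -
  let ?\<sigma> = "kac_sigma N" and ?G = "sum_density N N"
  let ?\<theta> = "\<lambda>v::real. sum_density (N - 1) (real N - v\<^sup>2) / ?G"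
  let ?P = "conditioned_tensor f N"
  interpret S: prob_space ?\<sigma> by (rule prob_space_kac_sigma)
  have N0: "N > 0" using N by simp
  obtain k where k: "k > 0" "sphere_integral {..<N} N (\<lambda>_. 1) = ennreal k"
    using sphere_integral_total(1,2)[OF N0] by (cases "sphere_integral {..<N} N (\<lambda>_. 1)") (auto simp: less_le)
  have Z: "(\<integral>\<^sup>+ y. ennreal (tensor_power f N y) \<partial>?\<sigma>) = ennreal (?G / k)"
    unfolding partition_function[OF N(1) int] k(2) using k(1) pos by (simp add: divide_ennreal)
  have P: "?P = density ?\<sigma> (\<lambda>y. ennreal (tensor_power f N y) / ennreal (?G / k))"
    unfolding conditioned_tensor_def Z ..
  have yi: "(\<lambda>y. y i) \<in> borel_measurable ?\<sigma>"
    unfolding kac_sigma_def using N by simp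
  have nn: "(\<integral>\<^sup>+ y. h (y i) \<partial>?P) = (\<integral>\<^sup>+ v. h v * ennreal (f v * ?\<theta> v) \<partial>lborel)"
    if [measurable]: "h \<in> borel_measurable borel" for h
  proof -
    have [measurable]: "(\<lambda>y. h (y i)) \<in> borel_measurable ?\<sigma>"
      by (rule measurable_compose[OF yi that])
    have i1: "inverse (ennreal (?G / k)) = ennreal (k / ?G)"
      using pos k by (simp add: inverse_ennreal)
    have "(\<integral>\<^sup>+ y. h (y i) \<partial>?P) = (\<integral>\<^sup>+ y. ennreal (tensor_power f N y) / ennreal (?G / k) * h (y i) \<partial>?\<sigma>)"
      unfolding P by (rule nn_integral_density) measurable
    also have "\<dots> = (\<integral>\<^sup>+ y. h (y i) * ennreal (tensor_power f N y) * ennreal (k / ?G) \<partial>?\<sigma>)"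
      by (rule nn_integral_cong) (simp add: divide_ennreal_def i1 mult_ac)
    also have "\<dots> = (\<integral>\<^sup>+ y. h (y i) * ennreal (tensor_power f N y) \<partial>?\<sigma>) * ennreal (k / ?G)"
      by (rule nn_integral_multc) measurable
    also have "\<dots> = (\<integral>\<^sup>+ v. h v * ennreal (f v * sum_density (N - 1) (real N - v\<^sup>2)) \<partial>lborel) * (ennreal (1 / k) * ennreal (k / ?G))"
      unfolding nn_integral_kac_sigma_tensor(1)[OF N int that] k(2) using k(1)
      by (simp add: divide_ennreal_def inverse_ennreal inverse_eq_divide mult.assoc)
    also have "ennreal (1 / k) * ennreal (k / ?G) = ennreal (1 / ?G)"
      using k(1) pos by (simp flip: ennreal_mult)
    also have "(\<integral>\<^sup>+ v. h v * ennreal (f v * sum_density (N - 1) (real N - v\<^sup>2)) \<partial>lborel) * ennreal (1 / ?G) =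
      (\<integral>\<^sup>+ v. h v * ennreal (f v * sum_density (N - 1) (real N - v\<^sup>2)) * ennreal (1 / ?G) \<partial>lborel)"
      by (rule nn_integral_multc[symmetric]) measurable
    also have "\<dots> = (\<integral>\<^sup>+ v. h v * ennreal (f v * ?\<theta> v) \<partial>lborel)"
    proof (rule nn_integral_cong)
      fix v :: real
      have "ennreal (f v * sum_density (N - 1) (real N - v\<^sup>2)) * ennreal (1 / ?G) = ennreal (f v * sum_density (N - 1) (real N - v\<^sup>2) * (1 / ?G))"
        using pos by (intro ennreal_mult''[symmetric]) simp
      thus "h v * ennreal (f v * sum_density (N - 1) (real N - v\<^sup>2)) * ennreal (1 / ?G) = h v * ennreal (f v * ?\<theta> v)"
        by (simp add: mult.assoc)
    qed
    finally show ?thesis .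
  qed
  have sets_P: "sets ?P = sets ?\<sigma>" "space ?P = space ?\<sigma>" by (simp_all add: P)
  have yiP: "(\<lambda>y. y i) \<in> borel_measurable ?P"
    using yi by (simp cong: measurable_cong_sets add: sets_P)
  have D: "distr ?P borel (\<lambda>y. y i) = density lborel (\<lambda>v. ennreal (f v * ?\<theta> v))"
  proof (rule measure_eqI)
    fix A :: "real set" assume "A \<in> sets (distr ?P borel (\<lambda>y. y i))"
    hence [measurable]: "A \<in> sets borel" by simp
    have "emeasure (distr ?P borel (\<lambda>y. y i)) A = (\<integral>\<^sup>+ v. indicator A v \<partial>distr ?P borel (\<lambda>y. y i))"
      by (rule nn_integral_indicator[symmetric]) simp
    also have "\<dots> = (\<integral>\<^sup>+ y. indicator A (y i) \<partial>?P)" by (rule nn_integral_distr[OF yiP]) simp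
    also have "\<dots> = (\<integral>\<^sup>+ v. indicator A v * ennreal (f v * ?\<theta> v) \<partial>lborel)" by (rule nn) measurable
    also have "\<dots> = emeasure (density lborel (\<lambda>v. ennreal (f v * ?\<theta> v))) A"
      by (subst emeasure_density) (auto simp: mult.commute)
    finally show "emeasure (distr ?P borel (\<lambda>y. y i)) A = emeasure (density lborel (\<lambda>v. ennreal (f v * ?\<theta> v))) A" .
  qed simp
  have ae: "AE v in lborel. 0 \<le> f v * ?\<theta> v"
    using sum_density_AE_nonneg[OF N(1) int]
  proof eventually_elim
    case (elim v)
    thus ?case using pos f_nonneg[of v] by (intro mult_nonneg_nonneg divide_nonneg_pos)
  qed
  show "prob_space ?P"
  proof (rule prob_spaceI)
    have "emeasure ?P (space ?P) = (\<integral>\<^sup>+ y. ennreal (tensor_power f N y) / ennreal (?G / k) \<partial>?\<sigma>)"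
      unfolding sets_P(2) unfolding P by (subst emeasure_density) (auto intro!: nn_integral_cong)
    also have "\<dots> = (\<integral>\<^sup>+ y. ennreal (tensor_power f N y) \<partial>?\<sigma>) / ennreal (?G / k)"
      by (rule nn_integral_divide) measurable
    also have "\<dots> = 1" unfolding Z using pos k by (simp add: divide_ennreal)
    finally show "emeasure ?P (space ?P) = 1" .
  qed
  have sw: "f v * ?\<theta> v * X v = f v * X v * ?\<theta> v" for v by (simp only: mult_ac)
  have "integrable lborel (\<lambda>v. (f v * ?\<theta> v) *\<^sub>R X v)"
    using intX by (simp only: real_scaleR_def sw)
  hence "integrable (distr ?P borel (\<lambda>y. y i)) X"
    unfolding D using ae by (subst integrable_density) auto
  thus "integrable ?P (\<lambda>y. X (y i))"
    by (subst (asm) integrable_distr_eq[OF yiP]) auto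
  have "(LINT y|?P. X (y i)) = (LINT v|distr ?P borel (\<lambda>y. y i). X v)"
    by (rule integral_distr[OF yiP, symmetric]) simp
  also have "\<dots> = (LINT v|lborel. (f v * ?\<theta> v) *\<^sub>R X v)"
    unfolding D using ae by (intro integral_density) auto
  also have "\<dots> = (LINT v|lborel. f v * X v * ?\<theta> v)"
    by (simp only: real_scaleR_def sw)
  finally show "(LINT y|?P. X (y i)) = (LINT v|lborel. f v * X v * ?\<theta> v)" .
qed

text \<open>On the sphere the logarithm of the density is the sum of the
  \<open>log_ratio f (y i)\<close> plus a constant, the Gaussian factor being constant there. All
  coordinates have the same marginal, so each of the \<open>N\<close> summands contributes the same
  integral.\<close>

lemma rel_entropy_conditioned_tensor:
  assumes N: "2 \<le> N" and int: "integrable lborel (\<lambda>\<xi>. char (square_law f) \<xi> ^ (N - 1))"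
    and pos: "0 < sum_density N N"
    and g_int: "integrable lborel (\<lambda>\<xi>. char (square_law std_normal_density) \<xi> ^ (N - 1))"
    and g_pos: "0 < gauss.sum_density N N"
    and intX: "integrable lborel (\<lambda>v. f v * log_ratio f v * (sum_density (N - 1) (real N - v\<^sup>2) / sum_density N N))"
  shows "rel_entropy (conditioned_tensor f N) (kac_sigma N) =
    ereal (N * (LINT v|lborel. f v * log_ratio f v * (sum_density (N - 1) (real N - v\<^sup>2) / sum_density N N))
      + ln (gauss.sum_density N N / sum_density N N))"
proof -
  let ?\<sigma> = "kac_sigma N" and ?G = "sum_density N N" and ?H = "gauss.sum_density N N"
  let ?P = "conditioned_tensor f N"
  let ?D = "ln (?H / ?G)"
  interpret S: prob_space ?\<sigma> by (rule prob_space_kac_sigma)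
  have N0: "N > 0" using N by simp
  obtain k where k: "k > 0" "sphere_integral {..<N} N (\<lambda>_. 1) = ennreal k"
    using sphere_integral_total(1,2)[OF N0] by (cases "sphere_integral {..<N} N (\<lambda>_. 1)") (auto simp: less_le)
  have Z: "(\<integral>\<^sup>+ y. ennreal (tensor_power f N y) \<partial>?\<sigma>) = ennreal (?G / k)"
    unfolding partition_function[OF N int] k(2) using k(1) pos by (simp add: divide_ennreal)
  have gZ: "(\<integral>\<^sup>+ y. ennreal (tensor_power std_normal_density N y) \<partial>?\<sigma>) = ennreal (?H / k)"
    unfolding gauss.partition_function[OF N g_int] k(2) using k(1) g_pos by (simp add: divide_ennreal)
  \<comment> \<open>The constant value of the Gaussian on the sphere is read off its own partition
    function. No area of the sphere has to be computed: \<open>k\<close> cancels against the one in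
    \<open>?G / k\<close>.\<close>
  have gconst: "tensor_power std_normal_density N y = ?H / k" if y: "y \<in> kac_sphere N" for y
  proof -
    let ?c = "(1 / sqrt (2 * pi)) ^ N * exp (- real N / 2)"
    have "(\<integral>\<^sup>+ y. ennreal (tensor_power std_normal_density N y) \<partial>?\<sigma>) = (\<integral>\<^sup>+ y. ennreal ?c \<partial>?\<sigma>)"
      by (rule nn_integral_cong_AE, use AE_kac_sigma_kac_sphere[of N] in eventually_elim)
         (simp add: tensor_power_std_normal)
    hence "ennreal (?H / k) = ennreal ?c"
      unfolding gZ by (simp add: S.emeasure_space_1)
    hence "?H / k = ?c" using g_pos k(1) by (subst (asm) ennreal_inj) auto
    thus ?thesis using tensor_power_std_normal[OF y] by simp
  qed
  define z where "z = ?G / k"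
  have z: "z > 0" using pos k by (simp add: z_def)
  define g where "g y = tensor_power f N y / z" for y
  have [measurable]: "g \<in> borel_measurable ?\<sigma>" unfolding g_def by measurable
  have g0: "0 \<le> g y" for y using z tensor_power_nonneg by (simp add: g_def)
  have P: "?P = density ?\<sigma> (\<lambda>y. ennreal (g y))"
    unfolding conditioned_tensor_def Z g_def z_def[symmetric]
    using z tensor_power_nonneg by (simp add: divide_ennreal)
  note marg = conditioned_tensor_marginal[OF N _ int pos log_ratio_measurable[OF f_measurable] intX]
  interpret P: prob_space ?P by (rule marg(1)[of 0]) (use N in simp)
  let ?Y = "\<lambda>y. (\<Sum>i<N. log_ratio f (y i)) + ?D"
  have Yint: "integrable ?P ?Y"
    by (intro Bochner_Integration.integrable_add Bochner_Integration.integrable_sum) (auto intro: marg(2))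
  have EY: "(LINT y|?P. ?Y y) =
      N * (LINT v|lborel. f v * log_ratio f v * (sum_density (N - 1) (real N - v\<^sup>2) / ?G)) + ?D"
  proof -
    have "(LINT y|?P. ?Y y) = (LINT y|?P. (\<Sum>i<N. log_ratio f (y i))) + (LINT y|?P. ?D)"
      by (rule Bochner_Integration.integral_add) (auto intro: marg(2))
    also have "(LINT y|?P. (\<Sum>i<N. log_ratio f (y i))) = (\<Sum>i<N. (LINT y|?P. log_ratio f (y i)))"
      by (rule Bochner_Integration.integral_sum) (auto intro: marg(2))
    also have "\<dots> = (\<Sum>i<N. (LINT v|lborel. f v * log_ratio f v * (sum_density (N - 1) (real N - v\<^sup>2) / ?G)))"
      by (rule sum.cong[OF refl]) (rule marg(3), simp)
    finally show ?thesis by (simp add: P.prob_space)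
  qed
  have ae: "AE y in ?\<sigma>. g y * ln (g y) = g y * ?Y y"
    using AE_kac_sigma_kac_sphere[of N]
  proof eventually_elim
    case (elim y)
    show ?case
    \<comment> \<open>Where the tensor power vanishes, both sides are 0 through the factor
      \<open>g y\<close>; elsewhere every \<open>f (y i)\<close> is positive and the logarithm of
      the product splits.\<close>
    proof (cases "tensor_power f N y = 0")
      case False
      hence fp: "f (y i) > 0" if "i < N" for i
        using that f_nonneg[of "y i"] by (auto simp: tensor_power_def less_le)
      have gp: "std_normal_density x > 0" for x by (simp add: normal_density_pos)
      have "tensor_power f N y = (\<Prod>i<N. f (y i) / std_normal_density (y i)) * tensor_power std_normal_density N y"
        unfolding tensor_power_def prod.distrib[symmetric]
        by (intro prod.cong refl) (use gp in \<open>simp add: less_imp_neq[symmetric]\<close>)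
      hence "g y = (\<Prod>i<N. f (y i) / std_normal_density (y i)) * (?H / ?G)"
        unfolding gconst[OF elim] g_def z_def using k pos by simp
      hence "ln (g y) = ln (\<Prod>i<N. f (y i) / std_normal_density (y i)) + ?D"
        using fp gp pos g_pos by (simp only:) (intro ln_mult_pos prod_pos divide_pos_pos, auto)
      also have "ln (\<Prod>i<N. f (y i) / std_normal_density (y i)) = (\<Sum>i<N. log_ratio f (y i))"
        unfolding log_ratio_def by (rule ln_prod[OF finite_lessThan]) (metis divide_pos_pos fp gp lessThan_iff less_irrefl)
      finally show ?thesis by simp
    qed (simp add: g_def)
  qed
  have Ym: "?Y \<in> borel_measurable ?\<sigma>"
  proof (intro borel_measurable_add borel_measurable_sum borel_measurable_const)
    fix i assume "i \<in> {..<N}"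
    hence "(\<lambda>y. y i) \<in> borel_measurable ?\<sigma>" unfolding kac_sigma_def by simp
    thus "(\<lambda>y. log_ratio f (y i)) \<in> borel_measurable ?\<sigma>"
      by (rule measurable_compose) measurable
  qed
  have "integrable ?\<sigma> (\<lambda>y. g y * ?Y y)"
    using Yint unfolding P by (subst (asm) integrable_density) (use g0 Ym in auto)
  hence i2: "integrable ?\<sigma> (\<lambda>y. g y * ln (g y))"
    by (subst integrable_cong_AE[OF _ _ ae]) (use Ym in auto)
  have "rel_entropy ?P ?\<sigma> = ereal (LINT y|?\<sigma>. g y * ln (g y))"
    unfolding P by (rule rel_entropy_density) (use g0 i2 in \<open>auto intro: S.sigma_finite_measure_axioms\<close>)
  also have "(LINT y|?\<sigma>. g y * ln (g y)) = (LINT y|?\<sigma>. g y * ?Y y)"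
    by (rule integral_cong_AE) (use ae Ym in auto)
  also have "\<dots> = (LINT y|?P. ?Y y)"
    unfolding P by (subst integral_density) (use g0 Ym in auto)
  finally show ?thesis unfolding EY .
qed

lemma rel_entropy_gaussian:
  assumes "integrable lborel (\<lambda>v. f v * log_ratio f v)"
  shows "rel_entropy (density lborel (\<lambda>v. ennreal (f v))) (density lborel std_normal_density) =
    ereal (LINT v|lborel. f v * log_ratio f v)"
proof -
  let ?g = "\<lambda>v. f v / std_normal_density v"
  have gp: "std_normal_density x > 0" for x by (simp add: normal_density_pos)
  have e: "std_normal_density v * ?g v = f v" for v using gp[of v] by simp
  have d: "density std_normal_distribution (\<lambda>v. ennreal (?g v)) = density lborel (\<lambda>v. ennreal (f v))"
  proof (subst density_density_eq)
    show "density lborel (\<lambda>v. ennreal (std_normal_density v) * ennreal (?g v)) = density lborel (\<lambda>v. ennreal (f v))"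
      using e gp f_nonneg by (simp flip: ennreal_mult' add: less_imp_le)
  qed auto
  have m: "std_normal_density v * (?g v * ln (?g v)) = f v * log_ratio f v" for v
    unfolding mult.assoc[symmetric] e log_ratio_def ..
  have int: "integrable std_normal_distribution (\<lambda>v. ?g v * ln (?g v))"
  proof (subst integrable_density)
    show "integrable lborel (\<lambda>v. std_normal_density v *\<^sub>R (?g v * ln (?g v)))"
      unfolding real_scaleR_def m by fact
  qed auto
  have "rel_entropy (density std_normal_distribution (\<lambda>v. ennreal (?g v))) std_normal_distribution =
      ereal (LINT v|std_normal_distribution. ?g v * ln (?g v))"
    by (rule rel_entropy_density) (use gp f_nonneg int in \<open>auto intro: gauss.sigma_finite_measure_axioms simp: less_imp_le\<close>)
  also have "(LINT v|std_normal_distribution. ?g v * ln (?g v)) =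
      (LINT v|lborel. std_normal_density v *\<^sub>R (?g v * ln (?g v)))"
    by (rule integral_density) auto
  also have "\<dots> = (LINT v|lborel. f v * log_ratio f v)" unfolding real_scaleR_def m ..
  finally show ?thesis unfolding d .
qed

end

text \<open>
  For \<open>f < 1\<close> the logarithm is at most \<open>v\<^sup>2\<close> unless \<open>f\<close> lies below \<open>exp (- v\<^sup>2)\<close>; for \<open>f \<ge> 1\<close>
  the weight \<open>v\<^sup>2\<close> is shared between \<open>f powr p\<close> and \<open>v ^ 4 * f\<close> by the inequality of the means.
\<close>

lemma weighted_log_le:
  fixes x v p :: real
  assumes x: "0 \<le> x" and p: "1 < p"
  shows "x * \<bar>ln x\<bar> * (1 + v\<^sup>2) \<le>
    2 / (p - 1) * (2 * x powr p + v ^ 4 * x) + (v\<^sup>2 * x + v ^ 4 * x) + 2 * ((1 + v\<^sup>2) * exp (- (v\<^sup>2 / 2)))"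
proof -
  have t1: "0 \<le> 2 / (p - 1) * (2 * x powr p + v ^ 4 * x)" using x p by simp
  have t2: "0 \<le> v\<^sup>2 * x + v ^ 4 * x" using x by simp
  have t3: "0 \<le> 2 * ((1 + v\<^sup>2) * exp (- (v\<^sup>2 / 2)))" by simp
  consider "x = 0" | "x \<ge> 1" | "0 < x" "x < 1" "exp (- v\<^sup>2) \<le> x" | "0 < x" "x < 1" "x < exp (- v\<^sup>2)"
    using x by linarith
  thus ?thesis
  proof cases
    case 1 thus ?thesis using t1 t2 t3 by simp
  next
    case 2
    \<comment> \<open>Half of the surplus \<open>p - 1\<close> absorbs the logarithm. The resulting
      exponent \<open>1 + e\<close> is the midpoint of 1 and \<open>p\<close>, exactly where the
      inequality of the means splits the product.\<close>
    define e where "e = (p - 1) / 2"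
    have e: "e > 0" using p by (simp add: e_def)
    have "\<bar>ln x\<bar> \<le> x powr e / e" using ln_powr_bound[OF 2 e] 2 by simp
    hence "x * \<bar>ln x\<bar> * (1 + v\<^sup>2) \<le> x * (x powr e / e) * (1 + v\<^sup>2)"
      using x by (intro mult_right_mono mult_left_mono) auto
    also have "\<dots> = 1 / e * (x powr (1 + e) + x powr (1 + e) * v\<^sup>2)"
      using 2 by (simp add: powr_add distrib_left mult_ac add_divide_distrib)
    also have "\<dots> \<le> 1 / e * (2 * x powr p + v ^ 4 * x)"
    proof (rule mult_left_mono)
      have a: "x powr (1 + e) \<le> x powr p" using 2 p by (intro powr_mono) (auto simp: e_def field_simps)
      have "1 + e = p / 2 + 1 / 2" by (simp add: e_def field_simps)
      hence "x powr (1 + e) = x powr (p / 2) * x powr (1 / 2)" by (simp only: powr_add)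
      hence "x powr (1 + e) * v\<^sup>2 = x powr (p / 2) * (x powr (1 / 2) * v\<^sup>2)" by simp
      also have "\<dots> \<le> ((x powr (p / 2))\<^sup>2 + (x powr (1 / 2) * v\<^sup>2)\<^sup>2) / 2"
        using sum_squares_bound[of "x powr (p / 2)" "x powr (1 / 2) * v\<^sup>2"] by simp
      also have "(x powr (p / 2))\<^sup>2 = x powr p" using 2 by (simp add: power2_eq_square flip: powr_add)
      also have "(x powr (1 / 2) * v\<^sup>2)\<^sup>2 = v ^ 4 * x"
        using 2 by (simp add: power_mult_distrib powr_half_sqrt)
      finally have "x powr (1 + e) * v\<^sup>2 \<le> (x powr p + v ^ 4 * x) / 2" .
      moreover have "0 \<le> x powr p" "0 \<le> v ^ 4 * x" using x by auto
      moreover have "y + w \<le> 2 * P + Q" if "w \<le> (P + Q) / 2" "0 \<le> P" "0 \<le> Q" "y \<le> P" for y w P Q :: real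
      proof -
        have "w \<le> P / 2 + Q / 2" using that(1) by (simp add: add_divide_distrib)
        moreover have "P / 2 \<le> P" "Q / 2 \<le> Q" using that(2,3) by auto
        ultimately have "w \<le> P + Q" by (meson add_mono order_trans)
        thus ?thesis using that(4) by simp
      qed
      ultimately show "x powr (1 + e) + x powr (1 + e) * v\<^sup>2 \<le> 2 * x powr p + v ^ 4 * x" using a by blast
    qed (use e in simp)
    also have "1 / e = 2 / (p - 1)" by (simp add: e_def)
    finally show ?thesis using t2 t3 by linarith
  next
    case 3
    have "- v\<^sup>2 \<le> ln x" using 3 by (metis exp_le_cancel_iff exp_ln)
    hence "\<bar>ln x\<bar> \<le> v\<^sup>2" using 3 by (simp add: abs_if)
    hence "x * \<bar>ln x\<bar> * (1 + v\<^sup>2) \<le> x * v\<^sup>2 * (1 + v\<^sup>2)"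
      using x by (intro mult_right_mono mult_left_mono) auto
    also have "\<dots> = v\<^sup>2 * x + v ^ 4 * x" by (simp add: algebra_simps power2_eq_square power4_eq_xxxx)
    finally show ?thesis using t1 t3 by linarith
  next
    case 4
    \<comment> \<open>A square root of \<open>x\<close> absorbs the logarithm, as
      \<open>x * |ln x| <= 2 * sqrt x\<close>; the remaining \<open>sqrt x\<close> is still
      dominated by the Gaussian \<open>exp (- (v^2 / 2))\<close>.\<close>
    have s: "sqrt x > 0" "sqrt x * sqrt x = x" using 4 by auto
    have "ln (1 / sqrt x) \<le> 1 / sqrt x - 1" using s by (intro ln_le_minus_one) auto
    moreover have "ln (1 / sqrt x) = - ln x / 2" using 4 by (simp add: ln_div ln_sqrt)
    ultimately have "\<bar>ln x\<bar> \<le> 2 / sqrt x" using 4 by (simp add: abs_if)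
    hence "x * \<bar>ln x\<bar> * (1 + v\<^sup>2) \<le> x * (2 / sqrt x) * (1 + v\<^sup>2)"
      using x by (intro mult_right_mono mult_left_mono) auto
    also have "x * (2 / sqrt x) = 2 * sqrt x" using s by (simp add: field_simps)
    also have "sqrt x \<le> exp (- (v\<^sup>2 / 2))"
    proof (rule real_le_lsqrt)
      show "x \<le> (exp (- (v\<^sup>2 / 2)))\<^sup>2" using 4 by (simp flip: exp_double)
    qed auto
    hence "2 * sqrt x * (1 + v\<^sup>2) \<le> 2 * exp (- (v\<^sup>2 / 2)) * (1 + v\<^sup>2)"
      by (intro mult_right_mono) auto
    finally have "x * \<bar>ln x\<bar> * (1 + v\<^sup>2) \<le> 2 * ((1 + v\<^sup>2) * exp (- (v\<^sup>2 / 2)))" by (simp add: mult_ac)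
    thus ?thesis using t1 t2 by linarith
  qed
qed

lemma integrable_gaussian_weight: "integrable lborel (\<lambda>v::real. (1 + v\<^sup>2) * exp (- (v\<^sup>2 / 2)))"
proof -
  have "integrable lborel (\<lambda>v. sqrt (2 * pi) * (std_normal_density v * v ^ 0 + std_normal_density v * v ^ 2))"
    using integrable_std_normal_moment[of 0] integrable_std_normal_moment[of 2]
    by (intro integrable_mult_right Bochner_Integration.integrable_add)
  thus ?thesis by (simp add: std_normal_density_def algebra_simps)
qed

context real_density
begin

text \<open>The weight \<open>1 + v^2\<close> is the one in the Lipschitz bound of the local limit
  theorem. The logarithm of the Gaussian adds a quadratic polynomial, so moments up to order four
  pay for it. The right-hand side is explicit to show that \<open>f\<close> enters it only through
  \<open>A\<close> and \<open>B\<close>.\<close>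

lemma weighted_log_ratio_bound:
  assumes p: "1 < p" and fp: "integrable lborel (\<lambda>v. f v powr p)" "(LINT v|lborel. f v powr p) \<le> A"
    and f4: "integrable lborel (\<lambda>v. v ^ 4 * f v)" "(LINT v|lborel. v ^ 4 * f v) \<le> B"
    and f2: "integrable lborel (\<lambda>v. v\<^sup>2 * f v)" "(LINT v|lborel. v\<^sup>2 * f v) = 1"
  shows "integrable lborel (\<lambda>v. f v * \<bar>log_ratio f v\<bar> * (1 + v\<^sup>2))"
    and "(LINT v|lborel. f v * \<bar>log_ratio f v\<bar> * (1 + v\<^sup>2)) \<le>
      2 / (p - 1) * (2 * A + B) + (1 + B) + 2 * (LINT v::real|lborel. (1 + v\<^sup>2) * exp (- (v\<^sup>2 / 2)))
        + (ln (sqrt (2 * pi)) * 2 + (1 + B))"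
proof -
  define \<kappa> where "\<kappa> = ln (sqrt (2 * pi))"
  have \<kappa>: "\<kappa> \<ge> 0" unfolding \<kappa>_def using pi_ge_two by (intro ln_ge_zero) simp
  let ?G1 = "\<lambda>v. 2 / (p - 1) * (2 * f v powr p + v ^ 4 * f v) + (v\<^sup>2 * f v + v ^ 4 * f v) + 2 * ((1 + v\<^sup>2) * exp (- (v\<^sup>2 / 2)))"
  let ?G2 = "\<lambda>v. \<kappa> * (f v + v\<^sup>2 * f v) + (v\<^sup>2 * f v + v ^ 4 * f v)"
  let ?G = "\<lambda>v. ?G1 v + ?G2 v"
  have pt: "f v * \<bar>log_ratio f v\<bar> * (1 + v\<^sup>2) \<le> ?G v" for v
  proof (cases "f v = 0")
    case True
    thus ?thesis by simp
  next
    case False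
    hence fv: "f v > 0" using f_nonneg[of v] by simp
    have "ln (std_normal_density v) = - \<kappa> - v\<^sup>2 / 2"
      by (simp add: std_normal_density_def \<kappa>_def ln_mult ln_div)
    hence "log_ratio f v = ln (f v) + (\<kappa> + v\<^sup>2 / 2)"
      unfolding log_ratio_def using fv normal_density_pos[of 1 0 v] by (simp add: ln_div less_imp_neq[symmetric])
    hence "\<bar>log_ratio f v\<bar> \<le> \<bar>ln (f v)\<bar> + (\<kappa> + v\<^sup>2)"
      using \<kappa> zero_le_power2[of v] by linarith
    hence "f v * \<bar>log_ratio f v\<bar> * (1 + v\<^sup>2) \<le> f v * (\<bar>ln (f v)\<bar> + (\<kappa> + v\<^sup>2)) * (1 + v\<^sup>2)"
      using fv by (intro mult_right_mono mult_left_mono) auto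
    also have "\<dots> = f v * \<bar>ln (f v)\<bar> * (1 + v\<^sup>2) + ?G2 v"
      by (simp add: algebra_simps power2_eq_square power4_eq_xxxx)
    also have "\<dots> \<le> ?G v"
      by (rule add_right_mono) (rule weighted_log_le[OF f_nonneg p])
    finally show ?thesis .
  qed
  have intG: "integrable lborel ?G"
    by (intro Bochner_Integration.integrable_add integrable_mult_right fp f4 f2 f_integrable integrable_gaussian_weight)
  show int: "integrable lborel (\<lambda>v. f v * \<bar>log_ratio f v\<bar> * (1 + v\<^sup>2))"
    by (rule Bochner_Integration.integrable_bound[OF intG])
       (use pt f_nonneg in \<open>auto simp: abs_mult intro: order_trans[OF _ abs_ge_self]\<close>)
  have "(LINT v|lborel. f v * \<bar>log_ratio f v\<bar> * (1 + v\<^sup>2)) \<le> (LINT v|lborel. ?G v)"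
    by (rule integral_mono[OF int intG pt])
  also have "\<dots> = 2 / (p - 1) * (2 * (LINT v|lborel. f v powr p) + (LINT v|lborel. v ^ 4 * f v))
      + (1 + (LINT v|lborel. v ^ 4 * f v)) + 2 * (LINT v::real|lborel. (1 + v\<^sup>2) * exp (- (v\<^sup>2 / 2)))
      + (\<kappa> * 2 + (1 + (LINT v|lborel. v ^ 4 * f v)))"
  proof -
    note ii = fp(1) f4(1) f2(1) f_integrable integrable_gaussian_weight
    have "(LINT v|lborel. ?G v) = (LINT v|lborel. ?G1 v) + (LINT v|lborel. ?G2 v)"
      by (intro Bochner_Integration.integral_add Bochner_Integration.integrable_add integrable_mult_right ii)
    also have "(LINT v|lborel. ?G1 v) = (LINT v|lborel. 2 / (p - 1) * (2 * f v powr p + v ^ 4 * f v)) +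
       (LINT v|lborel. v\<^sup>2 * f v + v ^ 4 * f v) + (LINT v|lborel. 2 * ((1 + v\<^sup>2) * exp (- (v\<^sup>2 / 2))))"
      by (subst Bochner_Integration.integral_add,
          (intro Bochner_Integration.integrable_add integrable_mult_right ii)+)+ (rule refl)
    also have "(LINT v|lborel. 2 / (p - 1) * (2 * f v powr p + v ^ 4 * f v)) =
        2 / (p - 1) * (2 * (LINT v|lborel. f v powr p) + (LINT v|lborel. v ^ 4 * f v))"
      by (subst integral_mult_right_zero, subst Bochner_Integration.integral_add, (intro integrable_mult_right ii)+) simp
    also have "(LINT v|lborel. v\<^sup>2 * f v + v ^ 4 * f v) = 1 + (LINT v|lborel. v ^ 4 * f v)"
      by (subst Bochner_Integration.integral_add, (intro ii)+) (simp add: f2(2))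
    also have "(LINT v|lborel. 2 * ((1 + v\<^sup>2) * exp (- (v\<^sup>2 / 2)))) = 2 * (LINT v::real|lborel. (1 + v\<^sup>2) * exp (- (v\<^sup>2 / 2)))"
      by (rule integral_mult_right_zero)
    also have "(LINT v|lborel. ?G2 v) = (LINT v|lborel. \<kappa> * (f v + v\<^sup>2 * f v)) + (LINT v|lborel. v\<^sup>2 * f v + v ^ 4 * f v)"
      by (intro Bochner_Integration.integral_add Bochner_Integration.integrable_add integrable_mult_right ii)
    also have "(LINT v|lborel. \<kappa> * (f v + v\<^sup>2 * f v)) = \<kappa> * 2"
      by (subst integral_mult_right_zero, subst Bochner_Integration.integral_add, (intro ii)+) (simp add: f2(2) f_integral)
    also have "(LINT v|lborel. v\<^sup>2 * f v + v ^ 4 * f v) = 1 + (LINT v|lborel. v ^ 4 * f v)"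
      by (subst Bochner_Integration.integral_add, (intro ii)+) (simp add: f2(2))
    finally show ?thesis .
  qed
  also have "\<dots> \<le> 2 / (p - 1) * (2 * A + B) + (1 + B) + 2 * (LINT v::real|lborel. (1 + v\<^sup>2) * exp (- (v\<^sup>2 / 2)))
      + (\<kappa> * 2 + (1 + B))"
    using fp(2) f4(2) p by (intro add_mono mult_left_mono order_refl) auto
  finally show "(LINT v|lborel. f v * \<bar>log_ratio f v\<bar> * (1 + v\<^sup>2)) \<le>
      2 / (p - 1) * (2 * A + B) + (1 + B) + 2 * (LINT v::real|lborel. (1 + v\<^sup>2) * exp (- (v\<^sup>2 / 2)))
        + (ln (sqrt (2 * pi)) * 2 + (1 + B))"
    unfolding \<kappa>_def .
qed

end

section \<open>The rate\<close>

context real_density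
begin

text \<open>\<open>char_square_law_level\<close> controls the level \<open>2 * h\<close>, so it is
  applied at \<open>h / 2\<close>; this turns \<open>8 * pi\<close> into \<open>64 * pi\<close> and
  \<open>2 * A\<close> into \<open>4 * A\<close>. The exponent collects \<open>h ^ 3\<close> and the
  \<open>2 / (p - 1)\<close> from the squared truncation height.\<close>

lemma char_level_bound_square_law:
  assumes p: "1 < p" and fp: "integrable lborel (\<lambda>v. f v powr p)" "(LINT v|lborel. f v powr p) \<le> A" and A: "A > 0"
  shows "char_level_bound (64 * pi * (4 * A) powr (2 / (p - 1))) (3 + 2 / (p - 1)) (square_law f)"
  unfolding char_level_bound_def
proof (intro allI impI)
  fix h :: real assume h: "0 < h" "h \<le> 1"
  define \<beta> where "\<beta> = 2 / (p - 1)"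
  have "emeasure lborel {\<xi>. norm (char (square_law f) \<xi>) > 2 * (h / 2)} \<le>
    ennreal (8 * pi * ((2 * A / (h / 2)) powr (1 / (p - 1)))\<^sup>2 / (h / 2) ^ 3)"
    by (rule char_square_law_level) (use f_nonneg f_integral p fp A h in auto)
  also have "8 * pi * ((2 * A / (h / 2)) powr (1 / (p - 1)))\<^sup>2 / (h / 2) ^ 3 =
      64 * pi * (4 * A) powr \<beta> * h powr (- (3 + \<beta>))"
  proof -
    have "((2 * A / (h / 2)) powr (1 / (p - 1)))\<^sup>2 = (4 * A / h) powr \<beta>"
      using A h by (simp add: \<beta>_def power2_eq_square flip: powr_add)
    also have "\<dots> = (4 * A) powr \<beta> / h powr \<beta>" by (rule powr_divide)
    finally have 1: "((2 * A / (h / 2)) powr (1 / (p - 1)))\<^sup>2 = (4 * A) powr \<beta> / h powr \<beta>" .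
    have "h powr (- (3 + \<beta>)) = 1 / (h ^ 3 * h powr \<beta>)"
      using h by (simp only: powr_minus_divide powr_add) (use h in simp)
    thus ?thesis unfolding 1 using h by (simp add: power_divide mult_ac)
  qed
  finally show "emeasure lborel {\<xi>. norm (char (square_law f) \<xi>) > h} \<le>
      ennreal (64 * pi * (4 * A) powr (2 / (p - 1)) * h powr (- (3 + 2 / (p - 1))))"
    by (simp add: \<beta>_def)
qed

lemma moment_bounds:
  assumes r: "0 < r" and m: "integrable lborel (\<lambda>v. \<bar>v\<bar> powr (4 + r) * f v)"
    and f2: "(LINT v|lborel. v\<^sup>2 * f v) = 1"
  shows "integrable lborel (\<lambda>v. v\<^sup>2 * f v)" and "integrable lborel (\<lambda>v. v ^ 4 * f v)"
    and "(LINT v|lborel. v ^ 4 * f v) \<le> 1 + abs_moment (4 + r) f" and "0 \<le> abs_moment (4 + r) f"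
proof -
  show "integrable lborel (\<lambda>v. v\<^sup>2 * f v)" using f2 by (metis not_integrable_integral_eq zero_neq_one)
  have pt: "v ^ 4 * f v \<le> f v + \<bar>v\<bar> powr (4 + r) * f v" for v
  proof -
    have "v ^ 4 \<le> 1 + \<bar>v\<bar> powr (4 + r)"
    proof (cases "\<bar>v\<bar> \<le> 1")
      case True
      hence "\<bar>v\<bar> ^ 4 \<le> 1" by (intro power_le_one) auto
      thus ?thesis by (simp add: power_abs[symmetric] add_increasing2)
    next
      case False
      hence "\<bar>v\<bar> powr 4 \<le> \<bar>v\<bar> powr (4 + r)" using r by (intro powr_mono) auto
      moreover have "\<bar>v\<bar> powr 4 = v ^ 4" using False powr_realpow[of "\<bar>v\<bar>" 4] by simp
      ultimately show ?thesis by simp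
    qed
    hence "v ^ 4 * f v \<le> (1 + \<bar>v\<bar> powr (4 + r)) * f v" by (rule mult_right_mono[OF _ f_nonneg])
    thus ?thesis by (simp add: distrib_right)
  qed
  have i: "integrable lborel (\<lambda>v. f v + \<bar>v\<bar> powr (4 + r) * f v)" using f_integrable m by simp
  show int4: "integrable lborel (\<lambda>v. v ^ 4 * f v)"
  proof (rule Bochner_Integration.integrable_bound[OF i])
    show "AE v in lborel. norm (v ^ 4 * f v) \<le> norm (f v + \<bar>v\<bar> powr (4 + r) * f v)"
    proof (rule AE_I2)
      fix v :: real
      have "0 \<le> v ^ 4 * f v" using f_nonneg[of v] by simp
      thus "norm (v ^ 4 * f v) \<le> norm (f v + \<bar>v\<bar> powr (4 + r) * f v)"
        using pt[of v] unfolding real_norm_def by linarith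
    qed
  qed measurable
  have "(LINT v|lborel. v ^ 4 * f v) \<le> (LINT v|lborel. f v + \<bar>v\<bar> powr (4 + r) * f v)"
    by (rule integral_mono[OF int4 i pt])
  also have "\<dots> = 1 + abs_moment (4 + r) f"
    unfolding abs_moment_def using f_integrable m f_integral by simp
  finally show "(LINT v|lborel. v ^ 4 * f v) \<le> 1 + abs_moment (4 + r) f" .
  show "0 \<le> abs_moment (4 + r) f"
    unfolding abs_moment_def by (rule integral_nonneg_AE) (simp add: f_nonneg)
qed

lemma admissible_square_law:
  assumes r: "0 < r" and m: "integrable lborel (\<lambda>v. \<bar>v\<bar> powr (4 + r) * f v)"
    and f2: "(LINT v|lborel. v\<^sup>2 * f v) = 1"
    and B: "1 + abs_moment (4 + r) f \<le> B" and lev: "char_level_bound W \<alpha> (square_law f)"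
  shows "admissible_law W \<alpha> B (r / 2) (square_law f)"
proof -
  note mb = moment_bounds[OF r m f2]
  have rd: "real_distribution (square_law f)"
    by (rule real_distribution_square_law) (use f_nonneg f_integral in auto)
  note I = integral_square_law[OF f_measurable _ f_nonneg]
  have pw: "\<bar>v\<^sup>2\<bar> powr (2 + r / 2) = \<bar>v\<bar> powr (4 + r)" for v :: real
  proof (cases "v = 0")
    case False
    hence "\<bar>v\<^sup>2\<bar> = \<bar>v\<bar> powr 2" by simp
    thus ?thesis by (simp only: powr_powr) (simp add: distrib_left)
  qed simp
  have "integrable (square_law f) (\<lambda>x. x)" "(LINT x|square_law f. x) = 1"
    using I[of "\<lambda>x. x"] mb(1) f2 by (simp_all add: mult.commute)
  moreover have "integrable (square_law f) (\<lambda>x. x\<^sup>2)" "(LINT x|square_law f. x\<^sup>2) \<le> B"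
    using I[of "\<lambda>x. x\<^sup>2"] mb(2,3) B by (simp_all add: mult.commute)
  moreover have "integrable (square_law f) (\<lambda>x. \<bar>x\<bar> powr (2 + r / 2))" "(LINT x|square_law f. \<bar>x\<bar> powr (2 + r / 2)) \<le> B"
    using I[of "\<lambda>x. \<bar>x\<bar> powr (2 + r / 2)"] m B by (simp_all only: pw) (simp_all add: mult.commute abs_moment_def)
  ultimately show ?thesis using rd lev by (simp add: admissible_law_def)
qed

lemma abs_ln_sum_density_le:
  assumes "0 < N" "0 < c" "c / sqrt N \<le> x" "x \<le> L"
  shows "\<bar>ln x\<bar> \<le> \<bar>ln L\<bar> + \<bar>ln c\<bar> + ln (real N) / 2"
proof -
  have pos: "0 < c / sqrt N" using assms by simp
  have x: "0 < x" using pos assms(3) by linarith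
  have "ln (c / sqrt N) \<le> ln x" using pos x assms by (intro ln_mono) auto
  moreover have "ln (c / sqrt N) = ln c - ln (real N) / 2" using assms by (simp add: ln_div ln_sqrt)
  moreover have "ln x \<le> ln L" using x assms by (intro ln_mono) auto
  moreover have "0 \<le> ln (real N)" using assms by simp
  ultimately show ?thesis by linarith
qed

text \<open>Replacing the marginal by \<open>f\<close> costs \<open>L * (1 + v^2) / N\<close>
  relative to a density of size at least \<open>c / sqrt N\<close>, that is
  \<open>L / c * (1 + v^2) / sqrt N\<close>, integrated against \<open>f * |log_ratio f|\<close>.
  The logarithm of the partition function is \<open>O(ln N)\<close>, because both densities at
  \<open>N\<close> lie between a multiple of \<open>1 / sqrt N\<close> and a constant.\<close>

theorem entropy_gap_le:
  assumes N: "2 \<le> N" and c: "0 < c" "0 < c'" and L: "0 < L"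
    and int: "integrable lborel (\<lambda>\<xi>. char (square_law f) \<xi> ^ (N - 1))"
    and low: "c / sqrt N \<le> sum_density N N" and up: "sum_density N N \<le> L"
    and lip: "\<And>x. 0 \<le> x \<Longrightarrow> \<bar>sum_density (N - 1) (real N - x) - sum_density N N\<bar> \<le> L * (1 + x) / N"
    and int': "integrable lborel (\<lambda>\<xi>. char (square_law std_normal_density) \<xi> ^ (N - 1))"
    and low': "c' / sqrt N \<le> gauss.sum_density N N" and up': "gauss.sum_density N N \<le> L'"
    and w: "integrable lborel (\<lambda>v. f v * \<bar>log_ratio f v\<bar> * (1 + v\<^sup>2))"
      "(LINT v|lborel. f v * \<bar>log_ratio f v\<bar> * (1 + v\<^sup>2)) \<le> E"
  shows "prob_space (conditioned_tensor f N)"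
    and "\<bar>rel_entropy (conditioned_tensor f N) (kac_sigma N) / ereal (real N)
      - rel_entropy (density lborel (\<lambda>v. ennreal (f v))) (density lborel std_normal_density)\<bar> \<le>
      ereal ((L / c * E + (\<bar>ln L\<bar> + \<bar>ln c\<bar> + \<bar>ln L'\<bar> + \<bar>ln c'\<bar> + 2)) / sqrt N)"
proof -
  let ?G = "sum_density N N" and ?H = "gauss.sum_density N N"
  let ?\<theta> = "\<lambda>v::real. sum_density (N - 1) (real N - v\<^sup>2) / ?G"
  let ?l = "log_ratio f"
  have Np: "N > 0" "real N > 0" "sqrt N > 0" "sqrt N * sqrt N = N" using N by auto
  have G: "?G > 0" using low c Np by (meson divide_pos_pos less_le_trans)
  have H: "?H > 0" using low' c Np by (meson divide_pos_pos less_le_trans)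
  have \<theta>: "\<bar>?\<theta> v - 1\<bar> \<le> L / c / sqrt N * (1 + v\<^sup>2)" for v
  proof -
    have "?\<theta> v - 1 = (sum_density (N - 1) (real N - v\<^sup>2) - ?G) / ?G" using G by (simp add: diff_divide_distrib)
    hence "\<bar>?\<theta> v - 1\<bar> = \<bar>sum_density (N - 1) (real N - v\<^sup>2) - ?G\<bar> / ?G" using G by (simp add: abs_divide)
    also have "\<dots> \<le> (L * (1 + v\<^sup>2) / N) / (c / sqrt N)"
      using lip[of "v\<^sup>2"] low c Np L by (intro frac_le) auto
    also have "\<dots> = (L * (1 + v\<^sup>2) / (sqrt N * sqrt N)) / (c / sqrt N)" by (simp only: Np(4))
    also have "\<dots> = L / c / sqrt N * (1 + v\<^sup>2)" using Np(3) c by (simp add: field_simps)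
    finally show ?thesis .
  qed
  define k where "k = L / c / sqrt N"
  have k: "k > 0" using L c Np by (simp add: k_def)
  have int0: "integrable lborel (\<lambda>v. f v * ?l v)"
  proof (rule Bochner_Integration.integrable_bound[OF w(1)])
    show "AE v in lborel. norm (f v * ?l v) \<le> norm (f v * \<bar>?l v\<bar> * (1 + v\<^sup>2))"
    proof (rule AE_I2)
      fix v :: real
      have "f v * \<bar>?l v\<bar> * 1 \<le> f v * \<bar>?l v\<bar> * (1 + v\<^sup>2)"
        using f_nonneg[of v] by (intro mult_left_mono) auto
      thus "norm (f v * ?l v) \<le> norm (f v * \<bar>?l v\<bar> * (1 + v\<^sup>2))"
        using f_nonneg[of v] by (simp add: abs_mult)
    qed
  qed measurable
  have dpt: "\<bar>f v * ?l v * (?\<theta> v - 1)\<bar> \<le> k * (f v * \<bar>?l v\<bar> * (1 + v\<^sup>2))" for v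
  proof -
    have "\<bar>f v * ?l v * (?\<theta> v - 1)\<bar> = f v * \<bar>?l v\<bar> * \<bar>?\<theta> v - 1\<bar>"
      using f_nonneg[of v] by (simp add: abs_mult)
    also have "\<dots> \<le> f v * \<bar>?l v\<bar> * (k * (1 + v\<^sup>2))"
      using \<theta>[of v] f_nonneg[of v] by (intro mult_left_mono) (auto simp: k_def)
    finally show ?thesis by (simp add: mult_ac)
  qed
  have intw: "integrable lborel (\<lambda>v. k * (f v * \<bar>?l v\<bar> * (1 + v\<^sup>2)))" using w(1) by simp
  have intd: "integrable lborel (\<lambda>v. f v * ?l v * (?\<theta> v - 1))"
  proof (rule Bochner_Integration.integrable_bound[OF intw])
    show "AE v in lborel. norm (f v * ?l v * (?\<theta> v - 1)) \<le> norm (k * (f v * \<bar>?l v\<bar> * (1 + v\<^sup>2)))"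
      using dpt by (intro AE_I2) (simp only: real_norm_def, metis abs_ge_self order_trans)
  qed measurable
  have split: "f v * ?l v * ?\<theta> v = f v * ?l v + f v * ?l v * (?\<theta> v - 1)" for v
    by (simp add: right_diff_distrib)
  have int1: "integrable lborel (\<lambda>v. f v * ?l v * ?\<theta> v)"
    unfolding split by (intro Bochner_Integration.integrable_add int0 intd)
  show "prob_space (conditioned_tensor f N)"
    by (rule conditioned_tensor_marginal(1)[OF N _ int G log_ratio_measurable[OF f_measurable] int1, of 0]) (use N in simp)
  define X where "X = (LINT v|lborel. f v * ?l v * ?\<theta> v)"
  define Y where "Y = (LINT v|lborel. f v * ?l v)"
  define D where "D = ln (?H / ?G)"
  have ent: "rel_entropy (conditioned_tensor f N) (kac_sigma N) = ereal (N * X + D)"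
    unfolding X_def D_def by (rule rel_entropy_conditioned_tensor[OF N int G int' H int1])
  have ent0: "rel_entropy (density lborel (\<lambda>v. ennreal (f v))) (density lborel std_normal_density) = ereal Y"
    unfolding Y_def by (rule rel_entropy_gaussian[OF int0])
  have XY: "\<bar>X - Y\<bar> \<le> k * E"
  proof -
    have "X - Y = (LINT v|lborel. f v * ?l v * (?\<theta> v - 1))"
      unfolding X_def Y_def split by (subst Bochner_Integration.integral_add[OF int0 intd]) simp
    hence "\<bar>X - Y\<bar> \<le> (LINT v|lborel. \<bar>f v * ?l v * (?\<theta> v - 1)\<bar>)" by (simp only: integral_abs_bound)
    also have "\<dots> \<le> (LINT v|lborel. k * (f v * \<bar>?l v\<bar> * (1 + v\<^sup>2)))"
      by (rule integral_mono[OF integrable_abs[OF intd] intw dpt])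
    also have "\<dots> = k * (LINT v|lborel. f v * \<bar>?l v\<bar> * (1 + v\<^sup>2))" by (rule integral_mult_right_zero)
    also have "\<dots> \<le> k * E" using w(2) k by (intro mult_left_mono) auto
    finally show ?thesis .
  qed
  define K where "K = \<bar>ln L\<bar> + \<bar>ln c\<bar> + \<bar>ln L'\<bar> + \<bar>ln c'\<bar>"
  have K: "K \<ge> 0" by (simp add: K_def)
  have DN: "\<bar>D\<bar> / N \<le> (K + 2) / sqrt N"
  proof -
    have "D = ln ?H - ln ?G" using G H by (simp add: D_def ln_div)
    hence "\<bar>D\<bar> \<le> \<bar>ln ?H\<bar> + \<bar>ln ?G\<bar>" by (simp add: abs_triangle_ineq4)
    also have "\<dots> \<le> (\<bar>ln L'\<bar> + \<bar>ln c'\<bar> + ln (real N) / 2) + (\<bar>ln L\<bar> + \<bar>ln c\<bar> + ln (real N) / 2)"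
      by (rule add_mono[OF abs_ln_sum_density_le[OF Np(1) c(2) low' up'] abs_ln_sum_density_le[OF Np(1) c(1) low up]])
    also have "\<dots> = K + ln (real N)" by (simp add: K_def)
    finally have "\<bar>D\<bar> \<le> K + ln (real N)" .
    \<comment> \<open>\<open>ln N\<close> is at most \<open>2 * sqrt N\<close>, which is where the
      summand 2 in the final constant comes from.\<close>
    moreover have "ln (real N) = 2 * ln (sqrt N)" using Np by (simp add: ln_sqrt)
    moreover have "2 * ln (sqrt N) \<le> 2 * sqrt N" using ln_le_minus_one[of "sqrt N"] Np by simp
    ultimately have "\<bar>D\<bar> \<le> K * 1 + 2 * sqrt N" by linarith
    also have "\<dots> \<le> K * sqrt N + 2 * sqrt N"
      using K Np N by (intro add_right_mono mult_left_mono) auto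
    finally have "\<bar>D\<bar> / N \<le> ((K + 2) * sqrt N) / N" using Np by (intro divide_right_mono) (auto simp: distrib_right)
    also have "\<dots> = ((K + 2) * sqrt N) / (sqrt N * sqrt N)" by (simp only: Np(4))
    also have "\<dots> = (K + 2) / sqrt N"
      by (rule nonzero_mult_divide_mult_cancel_right) (use Np in simp)
    finally show ?thesis .
  qed
  have "\<bar>(N * X + D) / N - Y\<bar> = \<bar>(X - Y) + D / N\<bar>" using Np by (simp add: add_divide_distrib)
  also have "\<dots> \<le> \<bar>X - Y\<bar> + \<bar>D\<bar> / N" using Np abs_triangle_ineq[of "X - Y" "D / N"] by (simp add: abs_divide)
  also have "\<dots> \<le> k * E + (K + 2) / sqrt N" using XY DN by linarith
  also have "\<dots> = (L / c * E + (K + 2)) / sqrt N" by (simp add: k_def add_divide_distrib)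
  finally have "\<bar>(N * X + D) / N - Y\<bar> \<le> (L / c * E + (K + 2)) / sqrt N" .
  moreover have "\<bar>ereal (N * X + D) / ereal (real N) - ereal Y\<bar> = ereal \<bar>(N * X + D) / N - Y\<bar>"
    using Np by simp
  ultimately show "\<bar>rel_entropy (conditioned_tensor f N) (kac_sigma N) / ereal (real N)
      - rel_entropy (density lborel (\<lambda>v. ennreal (f v))) (density lborel std_normal_density)\<bar> \<le>
      ereal ((L / c * E + (\<bar>ln L\<bar> + \<bar>ln c\<bar> + \<bar>ln L'\<bar> + \<bar>ln c'\<bar> + 2)) / sqrt N)"
    unfolding ent ent0 K_def by simp
qed

end

section \<open>The Gaussian reference and the choice of constants\<close>

lemma std_normal_density_le_1: "std_normal_density v \<le> 1"
proof -
  have "1 \<le> sqrt (2 * pi)" using pi_ge_two by simp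
  hence "1 / sqrt (2 * pi) * exp (- v\<^sup>2 / 2) \<le> 1 * 1" by (intro mult_mono) auto
  thus ?thesis by (simp add: std_normal_density_def)
qed

text \<open>The Gaussian lies in the class treated above, here with \<open>p = 2\<close> and the
  sixth moment, that is \<delta> equal to 1. The constants obtained are absolute.\<close>

lemma gaussian_local_limit:
  "\<exists>L c. \<exists>N0::nat. 0 < c \<and> (\<forall>N\<ge>N0. integrable lborel (\<lambda>\<xi>. char (square_law std_normal_density) \<xi> ^ (N - 1)) \<and>
     c / sqrt N \<le> gauss.sum_density N N \<and> gauss.sum_density N N \<le> L)"
proof -
  have i2: "integrable lborel (\<lambda>v. std_normal_density v powr 2)"
  proof (rule Bochner_Integration.integrable_bound[OF gauss.f_integrable])
    show "AE v in lborel. norm (std_normal_density v powr 2) \<le> norm (std_normal_density v)"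
    proof (rule AE_I2)
      fix v :: real
      have "std_normal_density v powr 2 = std_normal_density v * std_normal_density v"
        using normal_density_pos[of 1 0 v] by (simp add: power2_eq_square)
      also have "\<dots> \<le> std_normal_density v * 1"
        by (intro mult_left_mono std_normal_density_le_1) simp
      finally show "norm (std_normal_density v powr 2) \<le> norm (std_normal_density v)" by simp
    qed
  qed measurable
  have i6: "integrable lborel (\<lambda>v. \<bar>v\<bar> powr (4 + 2) * std_normal_density v)"
  proof -
    have "integrable lborel (\<lambda>v. std_normal_density v * v ^ 6)" by (rule integrable_std_normal_moment)
    moreover have "\<bar>v\<bar> powr (4 + 2) = v ^ 6" for v :: real
      using powr_realpow'[of "\<bar>v\<bar>" 6] by (simp add: power_abs[symmetric])
    ultimately show ?thesis by (simp add: mult.commute)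
  qed
  have m2: "(LINT v|lborel. v\<^sup>2 * std_normal_density v) = 1"
    using integral_std_normal_moment_even[of 1] by (simp add: mult.commute)
  define A where "A = (LINT v|lborel. std_normal_density v powr 2) + 1"
  have A: "A > 0" "(LINT v|lborel. std_normal_density v powr 2) \<le> A"
  proof -
    have "0 \<le> (LINT v|lborel. std_normal_density v powr 2)" by (rule integral_nonneg_AE) simp
    thus "A > 0" "(LINT v|lborel. std_normal_density v powr 2) \<le> A" unfolding A_def by linarith+
  qed
  define B where "B = 1 + abs_moment (4 + 2) std_normal_density"
  have B: "B \<ge> 1" using gauss.moment_bounds(4)[OF _ i6 m2] by (simp add: B_def)
  have lev: "char_level_bound (64 * pi * (4 * A) powr (2 / (2 - 1))) (3 + 2 / (2 - 1)) (square_law std_normal_density)"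
    by (rule gauss.char_level_bound_square_law[OF _ i2 A(2,1)]) simp
  define W where "W = 64 * pi * (4 * A) powr (2 / (2 - 1))"
  define \<alpha> where "\<alpha> = 3 + 2 / (2 - 1 :: real)"
  have W: "W > 0" "\<alpha> > 0" using A by (auto simp: W_def \<alpha>_def)
  have "admissible_law W \<alpha> B (2 / 2) (square_law std_normal_density)"
    by (rule gauss.admissible_square_law[OF _ i6 m2 _ lev[folded W_def \<alpha>_def]]) (simp_all add: B_def)
  hence adm: "admissible_law W \<alpha> B 1 (square_law std_normal_density)" by simp
  from local_limit_bounds[OF W B] obtain L c where c: "0 < c"
    and llt: "\<And>\<delta>. 0 < \<delta> \<Longrightarrow> \<delta> \<le> 1 \<Longrightarrow> \<exists>N0::nat. \<forall>\<mu>. admissible_law W \<alpha> B \<delta> \<mu> \<longrightarrow>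
    (\<forall>N\<ge>N0. local_limit_at L c (char \<mu>) N)"
    by blast
  have "0 < (1::real)" "(1::real) \<le> 1" by auto
  from llt[OF this] obtain N0 where N0: "\<And>\<mu> N. admissible_law W \<alpha> B 1 \<mu> \<Longrightarrow> N \<ge> N0 \<Longrightarrow> local_limit_at L c (char \<mu>) N"
    by blast
  show ?thesis
  proof (intro exI conjI allI impI)
    show "0 < c" by (rule c)
    fix N assume N: "N0 \<le> N"
    note b = N0[OF adm N, unfolded local_limit_at_def, folded gauss.sum_density_def]
    show "integrable lborel (\<lambda>\<xi>. char (square_law std_normal_density) \<xi> ^ (N - 1))"
      by (rule b[THEN conjunct1])
    show "c / sqrt N \<le> gauss.sum_density N N" by (rule b[THEN conjunct2, THEN conjunct1])
    show "gauss.sum_density N N \<le> L" by (rule b[THEN conjunct2, THEN conjunct2, THEN conjunct1])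
  qed
qed

text \<open>The norm and the moment of \<open>f\<close> are fixed as numbers \<open>a\<close> and
  \<open>m\<close>, and \<open>f\<close> is quantified inside. Constants chosen for given
  \<open>p\<close>, \<open>a\<close>, \<open>m\<close> are then functions of these numbers and of
  nothing else about \<open>f\<close>.\<close>

definition entropy_rate_from :: "real \<Rightarrow> real \<Rightarrow> real \<Rightarrow> real \<Rightarrow> real \<Rightarrow> nat \<Rightarrow> bool" where
  "entropy_rate_from p a m C r N0 \<longleftrightarrow>
     (\<forall>f. f \<in> borel_measurable borel \<longrightarrow> (\<forall>v. 0 \<le> f v) \<longrightarrow> (LINT v|lborel. f v) = 1 \<longrightarrow>
       1 < p \<longrightarrow> integrable lborel (\<lambda>v. \<bar>f v\<bar> powr p) \<longrightarrow> 0 < r \<longrightarrow> r \<le> 2 \<longrightarrow>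
       integrable lborel (\<lambda>v. \<bar>v\<bar> powr (4 + r) * f v) \<longrightarrow> (LINT v|lborel. v\<^sup>2 * f v) = 1 \<longrightarrow>
       Lp_norm p f = a \<longrightarrow> abs_moment (4 + r) f = m \<longrightarrow>
       (\<forall>N\<ge>N0. prob_space (conditioned_tensor f N) \<and>
          \<bar>rel_entropy (conditioned_tensor f N) (kac_sigma N) / ereal (real N)
             - rel_entropy (density lborel f) (density lborel std_normal_density)\<bar>
          \<le> ereal (C * real N powr (- r / 4))))"

text \<open>
  The bound holds with the rate \<open>N\<close> to the power \<open>-1/2\<close>; the moment of order \<open>4 + r\<close> only
  determines from which \<open>N\<close> on the lower bound of the local limit theorem is available.
\<close>

lemma entropy_rate: "\<exists>C. \<forall>r. \<exists>N0. entropy_rate_from p a m C r N0"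
proof (cases "1 < p")
  case True
  note p = True
  \<comment> \<open>For an actual \<open>f\<close> the number \<open>a powr p\<close> is the
    integral of \<open>f powr p\<close>. The summand 1 makes \<open>A\<close> positive, and the
    absolute value makes \<open>B\<close> at least 1, for all real \<open>a\<close> and
    \<open>m\<close>, even those that no density attains.\<close>
  define A where "A = a powr p + 1"
  define B where "B = 1 + \<bar>m\<bar>"
  define W where "W = 64 * pi * (4 * A) powr (2 / (p - 1))"
  define \<alpha> where "\<alpha> = 3 + 2 / (p - 1)"
  have A: "A > 0" unfolding A_def by (simp add: add_nonneg_pos)
  have W: "W > 0" using A by (simp add: W_def)
  have \<alpha>: "\<alpha> > 0" using p by (simp add: \<alpha>_def add_pos_pos)
  have B: "B \<ge> 1" by (simp add: B_def)
  from local_limit_bounds[OF W \<alpha> B] obtain L c where L: "0 < L" and c: "0 < c"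
    and llt: "\<And>\<delta>. 0 < \<delta> \<Longrightarrow> \<delta> \<le> 1 \<Longrightarrow> \<exists>N0::nat. \<forall>\<mu>. admissible_law W \<alpha> B \<delta> \<mu> \<longrightarrow>
    (\<forall>N\<ge>N0. local_limit_at L c (char \<mu>) N)"
    by blast
  obtain L' c' and N1 :: nat where c': "0 < c'"
    and g: "\<And>N. N \<ge> N1 \<Longrightarrow> integrable lborel (\<lambda>\<xi>. char (square_law std_normal_density) \<xi> ^ (N - 1))"
    "\<And>N. N \<ge> N1 \<Longrightarrow> c' / sqrt N \<le> gauss.sum_density N N"
    "\<And>N. N \<ge> N1 \<Longrightarrow> gauss.sum_density N N \<le> L'"
    using gaussian_local_limit by blast
  define E where "E = 2 / (p - 1) * (2 * A + B) + (1 + B) + 2 * (LINT v::real|lborel. (1 + v\<^sup>2) * exp (- (v\<^sup>2 / 2)))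
        + (ln (sqrt (2 * pi)) * 2 + (1 + B))"
  define C where "C = L / c * E + (\<bar>ln L\<bar> + \<bar>ln c\<bar> + \<bar>ln L'\<bar> + \<bar>ln c'\<bar> + 2)"
  show ?thesis
  proof (intro exI[of _ C] allI)
    fix r :: real
    show "\<exists>N0. entropy_rate_from p a m C r N0"
    proof (cases "0 < r \<and> r \<le> 2")
      case True
      hence "0 < r / 2" "r / 2 \<le> 1" by auto
      from llt[OF this] obtain N0 where N0: "\<And>\<mu> N. admissible_law W \<alpha> B (r / 2) \<mu> \<Longrightarrow> N \<ge> N0 \<Longrightarrow> local_limit_at L c (char \<mu>) N"
        by blast
      show ?thesis
        unfolding entropy_rate_from_def
      proof (intro exI[of _ "max 2 (max N0 N1)"] allI impI, goal_cases)
        case (1 f N)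
        interpret real_density f by unfold_locales (use 1 in auto)
        have N: "2 \<le> N" "N0 \<le> N" "N1 \<le> N" using 1 by auto
        have absf: "\<bar>f v\<bar> = f v" for v using f_nonneg[of v] by simp
        have fp: "integrable lborel (\<lambda>v. f v powr p)" using 1(5) by (simp only: absf)
        have fpA: "(LINT v|lborel. f v powr p) \<le> A"
        proof -
          have n: "0 \<le> (LINT v|lborel. f v powr p)" by (rule integral_nonneg_AE) simp
          have "a powr p = (LINT v|lborel. f v powr p)"
            using 1(10) p n unfolding Lp_norm_def absf by (auto simp: powr_powr)
          thus ?thesis by (simp add: A_def)
        qed
        have r0: "0 < r" using True by simp
        note mb = moment_bounds[OF r0 1(8,9)]
        have mB: "1 + abs_moment (4 + r) f \<le> B" using 1(11) by (simp add: B_def)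
        have lev: "char_level_bound W \<alpha> (square_law f)"
          unfolding W_def \<alpha>_def by (rule char_level_bound_square_law[OF p fp fpA A])
        have adm: "admissible_law W \<alpha> B (r / 2) (square_law f)"
          by (rule admissible_square_law[OF r0 1(8,9) mB lev])
        note b = N0[OF adm N(2), unfolded local_limit_at_def, folded sum_density_def]
        have w: "integrable lborel (\<lambda>v. f v * \<bar>log_ratio f v\<bar> * (1 + v\<^sup>2))"
          "(LINT v|lborel. f v * \<bar>log_ratio f v\<bar> * (1 + v\<^sup>2)) \<le> E"
          unfolding E_def using weighted_log_ratio_bound[OF p fp fpA mb(2) _ mb(1) 1(9), of B] mb(3) mB by auto
        have lip: "\<bar>sum_density (N - 1) (real N - x) - sum_density N N\<bar> \<le> L * (1 + x) / N" if "0 \<le> x" for x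
          using b that by blast
        note gap = entropy_gap_le[OF N(1) c c' L b[THEN conjunct1] b[THEN conjunct2, THEN conjunct1]
            b[THEN conjunct2, THEN conjunct2, THEN conjunct1] lip g(1)[OF N(3)] g(2)[OF N(3)] g(3)[OF N(3)] w]
        \<comment> \<open>Weakening the exponent from \<open>- 1/2\<close> to
          \<open>- r / 4\<close>, possible because \<open>r <= 2\<close>, needs a nonnegative
          constant; \<open>E\<close> is nonnegative as a bound for a nonnegative integral.\<close>
        have "0 \<le> (LINT v|lborel. f v * \<bar>log_ratio f v\<bar> * (1 + v\<^sup>2))"
          by (rule integral_nonneg_AE) (simp add: f_nonneg)
        hence "0 \<le> L / c * E" using w(2) L c by simp
        hence C: "0 \<le> C" by (simp add: C_def)
        have "C / sqrt N = C * real N powr (- (1 / 2))"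
          using N by (simp add: powr_minus_divide powr_half_sqrt)
        also have "\<dots> \<le> C * real N powr (- r / 4)"
          using True N C by (intro mult_left_mono powr_mono) auto
        finally have "ereal (C / sqrt N) \<le> ereal (C * real N powr (- r / 4))" by simp
        with gap show ?case unfolding C_def[symmetric] by (blast intro: order_trans)
      qed
    next
      case False
      thus ?thesis unfolding entropy_rate_from_def by blast
    qed
  qed
next
  case False
  thus ?thesis unfolding entropy_rate_from_def by blast
qed

theorem lemma30:
  "\<exists>(C :: real \<Rightarrow> real \<Rightarrow> real \<Rightarrow> real) (N\<^sub>0 :: real \<Rightarrow> real \<Rightarrow> real \<Rightarrow> real \<Rightarrow> nat).
     \<forall>(f :: real \<Rightarrow> real) (p :: real) (r :: real).
       f \<in> borel_measurable borel \<longrightarrow>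
       (\<forall>v. 0 \<le> f v) \<longrightarrow>
       (LINT v|lborel. f v) = 1 \<longrightarrow>
       1 < p \<longrightarrow>
       integrable lborel (\<lambda>v. \<bar>f v\<bar> powr p) \<longrightarrow>
       0 < r \<longrightarrow> r \<le> 2 \<longrightarrow>
       integrable lborel (\<lambda>v. \<bar>v\<bar> powr (4 + r) * f v) \<longrightarrow>
       (LINT v|lborel. v\<^sup>2 * f v) = 1 \<longrightarrow>
       (\<forall>N \<ge> N\<^sub>0 r p (Lp_norm p f) (abs_moment (4 + r) f).
          prob_space (conditioned_tensor f N) \<and>
          \<bar>rel_entropy (conditioned_tensor f N) (kac_sigma N) / ereal (real N)
             - rel_entropy (density lborel f) (density lborel std_normal_density)\<bar>
          \<le> ereal (C p (Lp_norm p f) (abs_moment (4 + r) f) * real N powr (- r / 4)))"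
proof -
  \<comment> \<open>The order of quantifiers records the dependence: the constant is chosen before
    \<open>r\<close>, the threshold after it.\<close>
  have "\<forall>p a m. \<exists>C. \<forall>r. \<exists>N0. entropy_rate_from p a m C r N0"
    using entropy_rate by blast
  then obtain C where "\<forall>p a m r. \<exists>N0. entropy_rate_from p a m (C p a m) r N0" by metis
  then obtain N0 where N0: "entropy_rate_from p a m (C p a m) r (N0 p a m r)" for p a m r by metis
  show ?thesis
  proof (intro exI[of _ C] exI[of _ "\<lambda>r p a m. N0 p a m r"] allI impI, goal_cases)
    case (1 f p r N)
    note all_N = N0[of p "Lp_norm p f" "abs_moment (4 + r) f" r, unfolded entropy_rate_from_def, THEN spec, THEN mp, OF 1(1),
        THEN mp, OF 1(2), THEN mp, OF 1(3), THEN mp, OF 1(4), THEN mp, OF 1(5), THEN mp, OF 1(6),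
        THEN mp, OF 1(7), THEN mp, OF 1(8), THEN mp, OF 1(9), THEN mp, OF refl, THEN mp, OF refl]
    show ?case by (rule all_N[THEN spec, THEN mp, OF 1(10)])
  qed
qed

end
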